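(* For every integer $n\ge 1$, $$A_n(t,1,q)=\sum_{k=0}^{\lfloor (n-1)/2\rfloor}\Bigl(\sum_{\sigma\in\mathfrak{D}_{n,k}} q^{\mathrm{inv}(\sigma)}\Bigr)\, t^k(1+t)^{n-1-2k}.$$
   Context: $\mathfrak{S}_n$ is the set of permutations $\sigma=\sigma_1\cdots\sigma_n$ of $[n]=\{1,\dots,n\}$. For $\sigma\in\mathfrak{S}_n$: $\mathrm{exc}(\sigma)=|\{i:\sigma_i>i\}|$, $\mathrm{fix}(\sigma)=|\{i:\sigma_i=i\}|$, $\mathrm{maj}(\sigma)=\sum_{i:\sigma_i>\sigma_{i+1}} i$, $\mathrm{des}(\sigma)=|\{i\in[n-1]:\sigma_i>\sigma_{i+1}\}|$, and $\mathrm{inv}(\sigma)=|\{(i,j):1\le i<j\le n,\ \sigma_i>\sigma_j\}|$. The basic Eulerian polynomial is $A_n(t,r,q)=\sum_{\sigma\in\mathfrak{S}_n} t^{\mathrm{exc}(\sigma)}r^{\mathrm{fix}(\sigma)}q^{\mathrm{maj}(\sigma)-\mathrm{exc}(\sigma)}$. With the convention $\sigma_0=\sigma_{n+1}=+\infty$, the entry $\sigma_i$ ($1\le i\le n$) is a double descent if $\sigma_{i-1}>\sigma_i>\sigma_{i+1}$; $\mathrm{dd}(\sigma)$ is the number of double descents. $\mathfrak{D}_{n,k}=\{\sigma\in\mathfrak{S}_n:\mathrm{dd}(\sigma)=0,\ \mathrm{des}(\sigma)=k\}$. *)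

theory Defs
  imports Complex_Main "HOL-Combinatorics.Permutations" "HOL-Library.Extended_Nat"
begin

text \<open>
  A permutation of \<open>[n] = {1..n}\<close> is a function \<open>s\<close> with \<open>s permutes {1..n}\<close>;
  its word is \<open>s 1, \<dots>, s n\<close>.
\<close>

definition sym_grp :: "nat \<Rightarrow> (nat \<Rightarrow> nat) set" where
  "sym_grp n = {s. s permutes {1..n}}"

definition exc :: "nat \<Rightarrow> (nat \<Rightarrow> nat) \<Rightarrow> nat" where
  "exc n s = card {i \<in> {1..n}. s i > i}"

definition fixpts :: "nat \<Rightarrow> (nat \<Rightarrow> nat) \<Rightarrow> nat" where
  "fixpts n s = card {i \<in> {1..n}. s i = i}"

definition descent_set :: "nat \<Rightarrow> (nat \<Rightarrow> nat) \<Rightarrow> nat set" where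
  "descent_set n s = {i \<in> {1..<n}. s i > s (i + 1)}"

definition des :: "nat \<Rightarrow> (nat \<Rightarrow> nat) \<Rightarrow> nat" where
  "des n s = card (descent_set n s)"

definition maj :: "nat \<Rightarrow> (nat \<Rightarrow> nat) \<Rightarrow> nat" where
  "maj n s = (\<Sum>i\<in>descent_set n s. i)"

definition invs :: "nat \<Rightarrow> (nat \<Rightarrow> nat) \<Rightarrow> nat" where
  "invs n s = card {(i, j). 1 \<le> i \<and> i < j \<and> j \<le> n \<and> s i > s j}"

text \<open>The word of \<open>s\<close> with the boundary convention \<open>s 0 = s (n + 1) = \<infinity>\<close>.\<close>

definition ext_word :: "nat \<Rightarrow> (nat \<Rightarrow> nat) \<Rightarrow> nat \<Rightarrow> enat" where
  "ext_word n s i = (if i \<in> {1..n} then enat (s i) else \<infinity>)"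

definition dd :: "nat \<Rightarrow> (nat \<Rightarrow> nat) \<Rightarrow> nat" where
  "dd n s = card {i \<in> {1..n}. ext_word n s (i - 1) > ext_word n s i
                              \<and> ext_word n s i > ext_word n s (i + 1)}"

definition no_dd_perms :: "nat \<Rightarrow> nat \<Rightarrow> (nat \<Rightarrow> nat) set" where
  "no_dd_perms n k = {s \<in> sym_grp n. dd n s = 0 \<and> des n s = k}"

text \<open>
  The natural-number subtraction in the exponent of \<open>q\<close> never truncates, by \<open>exc_le_maj\<close> below.
  Quantifying over \<open>t\<close>, \<open>r\<close>, \<open>q\<close> in an arbitrary commutative ring amounts to an identity
  between polynomials with integer coefficients.
\<close>

definition basic_eulerian :: "nat \<Rightarrow> 'a::comm_ring_1 \<Rightarrow> 'a \<Rightarrow> 'a \<Rightarrow> 'a" where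
  "basic_eulerian n t r q =
     (\<Sum>s\<in>sym_grp n. t ^ exc n s * r ^ fixpts n s * q ^ (maj n s - exc n s))"

lemma exc_le_maj:
  assumes "s \<in> sym_grp n"
  shows "exc n s \<le> maj n s"
proof -
  have p: "s permutes {1..n}" using assms by (simp add: sym_grp_def)
  have fin: "finite (descent_set n s)" by (simp add: descent_set_def)
  have ex: "\<exists>d\<in>descent_set n s. i \<le> d" if i: "i \<in> {1..n}" "s i > i" for i
  proof (rule ccontr)
    assume "\<not> ?thesis"
    have nd: "s j \<le> s (j + 1)" if "i \<le> j" "j < n" for j
    proof (rule ccontr)
      assume "\<not> s j \<le> s (j + 1)"
      hence "j \<in> descent_set n s" using that i by (simp add: descent_set_def)
      with \<open>\<not> (\<exists>d\<in>descent_set n s. i \<le> d)\<close> that show False by blast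
    qed
    have asc: "s j < s (j + 1)" if "i \<le> j" "j < n" for j
    proof -
      have "s j \<noteq> s (j + 1)" using inj_eq[OF permutes_inj[OF p]] by simp
      with nd[OF that] show ?thesis by simp
    qed
    have "s i + k \<le> s (i + k)" if "i + k \<le> n" for k
      using that
    proof (induction k)
      case (Suc k)
      then show ?case using asc[of "i + k"] by simp
    qed simp
    from this[of "n - i"] i have "s i + (n - i) \<le> s n" by simp
    moreover have "s n \<in> {1..n}" using permutes_in_image[OF p, of n] i by auto
    ultimately show False using i by auto
  qed
  show ?thesis
  proof (cases "descent_set n s = {}")
    case True
    hence "{i \<in> {1..n}. s i > i} = {}" using ex by blast
    thus ?thesis by (simp only: exc_def card.empty)
  next
    case False
    define m where "m = Max (descent_set n s)"
    have m: "m \<in> descent_set n s" using False fin by (simp add: m_def)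
    have "{i \<in> {1..n}. s i > i} \<subseteq> {1..m}"
    proof
      fix i assume i: "i \<in> {i \<in> {1..n}. s i > i}"
      then obtain d where "d \<in> descent_set n s" "i \<le> d" using ex by blast
      moreover from this have "d \<le> m" using Max_ge[OF fin] by (simp add: m_def)
      ultimately show "i \<in> {1..m}" using i by simp
    qed
    hence "exc n s \<le> m" unfolding exc_def
      using card_mono[of "{1..m}"] by simp
    also have "m \<le> maj n s" unfolding maj_def
      using member_le_sum[OF m, of "\<lambda>i. i"] fin by simp
    finally show ?thesis .
  qed
qed

end

theory Submission
  imports Defs "HOL-Analysis.Analysis" "HOL-Combinatorics.Multiset_Permutations"
begin

text \<open>
  Write \<open>A n\<close> for the basic Eulerian polynomial at \<open>r = 1\<close>. Both sides satisfy
  \<open>A (n + 1) = (1 + t) A n + t (\<Sum>k=1..n-1. [n choose k]_q q^(n-k) A k A (n-k))\<close>.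
  For the sum over permutations without double descents this is the decomposition at the
  largest entry.

  For the excedance side it follows from
  \<open>F(z) (E(tz) - t E(z)) = (1 - t) E(z)\<close>, where \<open>E(z) = \<Sum> z^n / (q;q)_n\<close> and
  \<open>F(z) = \<Sum> A n z^n / (q;q)_n\<close>, which is proved as follows.
  MacMahon's method turns \<open>t^exc q^maj / (q;q)_n\<close> into a sum over pairs of a permutation
  and a monotone sequence that jumps at descents, i.e. over words in the letters \<open>0, \<dots>, m - 1\<close> as
  \<open>m \<rightarrow> \<infinity>\<close>. Write the sorted rearrangement of a word above the word. A column with two
  different letters decides by itself whether it is an excedance. The columns with two equal letters
  sum to geometric series, which can be absorbed into weights of the remaining columns.
  What is left is a MacMahon master theorem sum over two-line words with product weights. It is
  evaluated by eliminating the largest letter, which amounts to a Schur complement of the weight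
  matrix. The shape of the weight matrix is preserved, with a single parameter that changes by a
  fractional linear map, so the sum has a closed form.

  All this is done for real \<open>0 < q < 1\<close> and \<open>0 < t < q\<close>, which suffices for an identity between
  integer polynomials.
\<close>

section \<open>Two-line words and elimination of a letter\<close>

text \<open>The weight of a word is not a product over columns: whether a column with two equal
  letters counts as an excedance depends on how stable sorting breaks ties, hence on its position.
  But each block has a threshold: a letter \<open>u\<close> preceded in the block of
  \<open>u\<close> by at most \<open>left_count f u\<close> other letters weighs \<open>x u\<close>,
  a later one \<open>t * x u\<close>. Up to one gap, the gaps of the two kinds are as many as the
  occurrences of \<open>u\<close> under smaller and under larger letters, so every such occurrence
  can absorb one geometric series; hence the quotients in \<open>column_weight\<close>. The gap left
  over for each letter is cancelled by the product of the \<open>1 - x i\<close> that elimination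
  produces.

  In the coordinate \<open>V\<close> the elimination map is even affine, which makes its iterates
  along a geometric progression explicit.

  Weights are nonnegative reals so that infinite sums may be regrouped freely. The permutation side
  is handled with the weight \<open>t ^ exc * q ^ maj\<close>, so the parameter called
  \<open>t\<close> in the overview is \<open>t * q\<close> there; \<open>t \<le> 1\<close> then
  leads to the range below \<open>q\<close>.\<close>

lemma has_sum_Sigma_nonneg:
  fixes f :: "'a \<times> 'b \<Rightarrow> real"
  assumes "\<And>x. x \<in> A \<Longrightarrow> ((\<lambda>y. f (x, y)) has_sum g x) (B x)"
    and "(g has_sum S) A"
    and "\<And>x y. x \<in> A \<Longrightarrow> y \<in> B x \<Longrightarrow> f (x, y) \<ge> 0"
  shows "(f has_sum S) (Sigma A B)"
  by (rule has_sum_SigmaI[OF assms(1,2) summable_on_SigmaI[OF assms(1) has_sum_imp_summable[OF assms(2)] assms(3)]])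

lemma has_sum_Times_mult_nonneg:
  fixes f :: "'a \<Rightarrow> real" and g :: "'b \<Rightarrow> real"
  assumes "(f has_sum S) A" "(g has_sum T) B"
    and "\<And>x. x \<in> A \<Longrightarrow> f x \<ge> 0" "\<And>y. y \<in> B \<Longrightarrow> g y \<ge> 0"
  shows "((\<lambda>(x, y). f x * g y) has_sum S * T) (A \<times> B)"
  by (rule has_sum_Sigma_nonneg[where g = "\<lambda>x. f x * T"])
     (use assms in \<open>auto intro!: has_sum_cmult_right has_sum_cmult_left\<close>)

lemma has_sum_geometric_nonneg:
  fixes z :: real
  assumes "0 \<le> z" "z < 1"
  shows "((\<lambda>n. z ^ n) has_sum (1 / (1 - z))) UNIV"
proof (rule norm_summable_imp_has_sum)
  show "summable (\<lambda>n. norm (z ^ n))" using assms by (simp add: norm_power)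
  show "(\<lambda>n. z ^ n) sums (1 / (1 - z))" using assms geometric_sums[of z] by simp
qed

text \<open>Decorations of different entries are chosen independently, so the sum factors. It will
  be applied to the marks that \<open>insert_letter\<close> reads.\<close>

lemma has_sum_decorated_lists:
  fixes c :: "'a \<Rightarrow> 'b \<Rightarrow> real"
  assumes nn: "\<And>x o'. c x o' \<ge> 0" and s: "\<And>x. x \<in> set xs \<Longrightarrow> (c x has_sum s x) UNIV"
  shows "((\<lambda>ys. prod_list (map (\<lambda>(x, o'). c x o') ys)) has_sum prod_list (map s xs)) {ys. map fst ys = xs}"
  using s
proof (induction xs)
  case Nil
  then show ?case by (simp add: has_sum_finite_iff)
next
  case (Cons x xs)
  let ?w = "\<lambda>ys. prod_list (map (\<lambda>(x, o'). c x o') ys)"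
  let ?h = "\<lambda>(o', ys). (x, o') # ys"
  have im: "?h ` (UNIV \<times> {ys. map fst ys = xs}) = {ys. map fst ys = x # xs}"
    by (auto simp: image_iff map_eq_Cons_conv)
  have "((\<lambda>(o', ys). c x o' * ?w ys) has_sum s x * prod_list (map s xs)) (UNIV \<times> {ys. map fst ys = xs})"
    using Cons nn by (intro has_sum_Times_mult_nonneg) (auto intro!: prod_list_nonneg)
  also have "(\<lambda>(o', ys). c x o' * ?w ys) = ?w \<circ> ?h" by (auto simp: fun_eq_iff)
  also have "(?w \<circ> ?h has_sum s x * prod_list (map s xs)) (UNIV \<times> {ys. map fst ys = xs})
     \<longleftrightarrow> (?w has_sum s x * prod_list (map s xs)) {ys. map fst ys = x # xs}"
    by (subst im[symmetric], subst has_sum_reindex) (auto simp: inj_on_def)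
  finally show ?case by simp
qed

lemma count_mset_map_eq_length: "count (mset (map f xs)) a = length (filter (\<lambda>x. f x = a) xs)"
  by (induction xs) auto

lemma sorted_fst_split:
  assumes "sorted (map fst xs)" "\<forall>c\<in>set xs. fst c \<le> m"
  shows "xs = filter (\<lambda>c. fst c \<noteq> m) xs @ filter (\<lambda>c. fst c = m) xs"
  using assms
proof (induction xs)
  case (Cons c xs)
  show ?case
  proof (cases "fst c = m")
    case True
    have "\<forall>d\<in>set xs. fst d = m"
    proof
      fix d assume "d \<in> set xs"
      with Cons.prems True have "fst d \<le> m" "m \<le> fst d" by auto
      then show "fst d = m" by (rule order_antisym)
    qed
    then show ?thesis using True by (simp add: filter_id_conv)
  qed (use Cons in auto)
qed auto

section \<open>Elimination of the largest letter as a bijection\<close>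

definition biwords :: "nat \<Rightarrow> (nat \<times> nat) list set" where
  "biwords m = {xs. set xs \<subseteq> {..<m} \<times> {..<m} \<and> sorted (map fst xs)
                    \<and> mset (map fst xs) = mset (map snd xs)}"

text \<open>
  A column \<open>(u, w)\<close> marked \<open>Some i\<close> is split into \<open>(u, l)\<close> and, in the final block of the letter \<open>l\<close>,
  \<open>i\<close> columns \<open>(l, l)\<close> followed by \<open>(l, w)\<close>; then \<open>j\<close> more columns \<open>(l, l)\<close> are appended.
  This inverts the elimination of \<open>l\<close>.
\<close>

definition insert_letter :: "nat \<Rightarrow> ((nat \<times> nat) \<times> nat option) list \<Rightarrow> nat \<Rightarrow> (nat \<times> nat) list" where
  "insert_letter l ys j =
     map (\<lambda>((u, w), p). (u, case p of None \<Rightarrow> w | Some _ \<Rightarrow> l)) ys @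
     map (Pair l) (concat (map (\<lambda>((u, w), p). case p of None \<Rightarrow> [] | Some i \<Rightarrow> replicate i l @ [w]) ys)
                   @ replicate j l)"

lemma replicate_append_Cons_eq:
  assumes "replicate i l @ w # xs = replicate j l @ v # ys" "w \<noteq> l" "v \<noteq> l"
  shows "i = j \<and> w = v \<and> xs = ys"
  using assms
proof (induction i arbitrary: j)
  case 0 then show ?case by (cases j) auto
next
  case (Suc i) then show ?case by (cases j) auto
qed

text \<open>Both rows can be decoded from the left: since \<open>w \<noteq> l\<close>, a lower
  letter \<open>l\<close> in the first segment betrays a marked column, and the run of
  \<open>l\<close> before the next other letter of the second segment is its mark.\<close>

lemma insert_letter_inj_aux:
  assumes "map (\<lambda>((u, w), p). (u, case p of None \<Rightarrow> w | Some (_::nat) \<Rightarrow> l)) ys =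
           map (\<lambda>((u, w), p). (u, case p of None \<Rightarrow> w | Some _ \<Rightarrow> l)) ys'"
    and "concat (map (\<lambda>((u, w), p). case p of None \<Rightarrow> [] | Some i \<Rightarrow> replicate i l @ [w]) ys) @ replicate j l =
         concat (map (\<lambda>((u, w), p). case p of None \<Rightarrow> [] | Some i \<Rightarrow> replicate i l @ [w]) ys') @ replicate j' l"
    and "\<And>u w p. ((u, w), p) \<in> set ys \<union> set ys' \<Longrightarrow> w \<noteq> l"
  shows "ys = ys' \<and> j = j'"
  using assms
proof (induction ys arbitrary: ys')
  case Nil
  then show ?case by (auto simp: replicate_eq_replicate)
next
  case (Cons y ys)
  then obtain y' zs where ys': "ys' = y' # zs" by (cases ys') auto
  obtain u w p u' w' p' where y: "y = ((u, w), p)" "y' = ((u', w'), p')" by (metis surj_pair)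
  have ne: "w \<noteq> l" "w' \<noteq> l" using Cons.prems(3) unfolding ys' y by auto
  have IH: "concat (map (\<lambda>((u, w), p). case p of None \<Rightarrow> [] | Some i \<Rightarrow> replicate i l @ [w]) ys) @ replicate j l =
         concat (map (\<lambda>((u, w), p). case p of None \<Rightarrow> [] | Some i \<Rightarrow> replicate i l @ [w]) zs) @ replicate j' l
       \<Longrightarrow> ys = zs \<and> j = j'"
    using Cons.IH[of zs] Cons.prems(1,3) unfolding ys' y by auto
  show ?case
  proof (cases p)
    case None
    with Cons.prems ne have "p' = None" unfolding ys' y by (auto split: option.splits)
    with None Cons.prems IH show ?thesis unfolding ys' y by auto
  next
    case (Some i)
    with Cons.prems ne obtain i' where p': "p' = Some i'" unfolding ys' y by (auto split: option.splits)
    from Cons.prems(2) have "i = i' \<and> w = w' \<and>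
      concat (map (\<lambda>((u, w), p). case p of None \<Rightarrow> [] | Some i \<Rightarrow> replicate i l @ [w]) ys) @ replicate j l =
         concat (map (\<lambda>((u, w), p). case p of None \<Rightarrow> [] | Some i \<Rightarrow> replicate i l @ [w]) zs) @ replicate j' l"
      unfolding ys' y Some p' by (intro replicate_append_Cons_eq[OF _ ne]) simp
    with IH Cons.prems(1) show ?thesis unfolding ys' y Some p' by auto
  qed
qed

lemma insert_letter_inj:
  assumes eq: "insert_letter l ys j = insert_letter l ys' j'"
    and "fst ` set ys \<subseteq> {..<l} \<times> {..<l}" "fst ` set ys' \<subseteq> {..<l} \<times> {..<l}"
  shows "ys = ys' \<and> j = j'"
proof -
  have f: "filter (\<lambda>c. fst c \<noteq> l) (insert_letter l zs i) =
      map (\<lambda>((u, w), p). (u, case p of None \<Rightarrow> w | Some _ \<Rightarrow> l)) zs"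
    "filter (\<lambda>c. fst c = l) (insert_letter l zs i) =
      map (Pair l) (concat (map (\<lambda>((u, w), p). case p of None \<Rightarrow> [] | Some i \<Rightarrow> replicate i l @ [w]) zs) @ replicate i l)"
    if "fst ` set zs \<subseteq> {..<l} \<times> {..<l}" for zs i
  proof -
    have "\<forall>c\<in>set (map (\<lambda>((u, w), p). (u, case p of None \<Rightarrow> w | Some _ \<Rightarrow> l)) zs). fst c \<noteq> l"
      using that by force
    then show "filter (\<lambda>c. fst c \<noteq> l) (insert_letter l zs i) =
        map (\<lambda>((u, w), p). (u, case p of None \<Rightarrow> w | Some _ \<Rightarrow> l)) zs"
      "filter (\<lambda>c. fst c = l) (insert_letter l zs i) =
        map (Pair l) (concat (map (\<lambda>((u, w), p). case p of None \<Rightarrow> [] | Some i \<Rightarrow> replicate i l @ [w]) zs) @ replicate i l)"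
      unfolding insert_letter_def filter_append by (subst filter_True filter_False; auto)+
  qed
  show ?thesis
  proof (rule insert_letter_inj_aux)
    show "map (\<lambda>((u, w), p). (u, case p of None \<Rightarrow> w | Some (_::nat) \<Rightarrow> l)) ys =
           map (\<lambda>((u, w), p). (u, case p of None \<Rightarrow> w | Some _ \<Rightarrow> l)) ys'"
      using f(1)[OF assms(2), of j] f(1)[OF assms(3), of j'] eq by simp
    have "map (Pair l) (concat (map (\<lambda>((u, w), p). case p of None \<Rightarrow> [] | Some i \<Rightarrow> replicate i l @ [w]) ys) @ replicate j l) =
       map (Pair l) (concat (map (\<lambda>((u, w), p). case p of None \<Rightarrow> [] | Some i \<Rightarrow> replicate i l @ [w]) ys') @ replicate j' l)"
      using f(2)[OF assms(2), of j] f(2)[OF assms(3), of j'] eq by simp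
    then show "concat (map (\<lambda>((u, w), p). case p of None \<Rightarrow> [] | Some i \<Rightarrow> replicate i l @ [w]) ys) @ replicate j l =
       concat (map (\<lambda>((u, w), p). case p of None \<Rightarrow> [] | Some i \<Rightarrow> replicate i l @ [w]) ys') @ replicate j' l"
      by (rule map_injective) (auto simp: inj_def)
  qed (use assms(2,3) in force)
qed

text \<open>Decoding is greedy: each column of \<open>fr\<close> with lower letter \<open>l\<close>
  takes the next run of \<open>l\<close> in \<open>ts\<close> together with the other letter that
  ends it. Equal counts ensure that no such letter is missing or left over; the trailing copies of
  \<open>l\<close> give \<open>j\<close>.\<close>

lemma insert_letter_surj_aux:
  assumes "length (filter (\<lambda>c. snd c = l) fr) = length (filter (\<lambda>w. w \<noteq> l) ts)"
  shows "\<exists>ys j. fr = map (\<lambda>((u, w), p). (u, case p of None \<Rightarrow> w | Some (_::nat) \<Rightarrow> l)) ys \<and>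
     ts = concat (map (\<lambda>((u, w), p). case p of None \<Rightarrow> [] | Some i \<Rightarrow> replicate i l @ [w]) ys) @ replicate j l \<and>
     (\<forall>((u, w), p) \<in> set ys. w \<noteq> l)"
  using assms
proof (induction fr arbitrary: ts)
  case Nil
  then have "\<forall>w\<in>set ts. w = l" by (auto simp: filter_empty_conv)
  then have "ts = replicate (length ts) l" by (simp add: replicate_length_same)
  then show ?case by (intro exI[of _ "[]"] exI[of _ "length ts"]) auto
next
  case (Cons c fr)
  obtain u w where c: "c = (u, w)" by force
  show ?case
  proof (cases "w = l")
    case False
    from Cons.IH[of ts] Cons.prems False obtain ys j where
      *: "fr = map (\<lambda>((u, w), p). (u, case p of None \<Rightarrow> w | Some (_::nat) \<Rightarrow> l)) ys"
      "ts = concat (map (\<lambda>((u, w), p). case p of None \<Rightarrow> [] | Some i \<Rightarrow> replicate i l @ [w]) ys) @ replicate j l"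
      "\<forall>((u, w), p) \<in> set ys. w \<noteq> l"
      by (auto simp: c)
    show ?thesis
      by (rule exI[of _ "((u, w), None) # ys"], rule exI[of _ j]) (use * False in \<open>auto simp: c\<close>)
  next
    case True
    define i where "i = length (takeWhile (\<lambda>w. w = l) ts)"
    have tw: "takeWhile (\<lambda>w. w = l) ts = replicate i l"
      unfolding i_def by (intro replicate_length_same[symmetric]) (auto dest: set_takeWhileD)
    have "filter (\<lambda>w. w \<noteq> l) ts \<noteq> []" using Cons.prems True by (auto simp: c)
    then have "dropWhile (\<lambda>w. w = l) ts \<noteq> []" by (auto simp: filter_empty_conv dropWhile_eq_Nil_conv)
    then obtain v ts' where dw: "dropWhile (\<lambda>w. w = l) ts = v # ts'" by (cases "dropWhile (\<lambda>w. w = l) ts") auto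
    have v: "v \<noteq> l" using dw hd_dropWhile[of "\<lambda>w. w = l" ts] by auto
    have ts: "ts = replicate i l @ v # ts'" using takeWhile_dropWhile_id[of "\<lambda>w. w = l" ts] tw dw by simp
    from Cons.IH[of ts'] Cons.prems True v obtain ys j where
      *: "fr = map (\<lambda>((u, w), p). (u, case p of None \<Rightarrow> w | Some (_::nat) \<Rightarrow> l)) ys"
      "ts' = concat (map (\<lambda>((u, w), p). case p of None \<Rightarrow> [] | Some i \<Rightarrow> replicate i l @ [w]) ys) @ replicate j l"
      "\<forall>((u, w), p) \<in> set ys. w \<noteq> l"
      by (auto simp: c ts)
    show ?thesis
      by (rule exI[of _ "((u, v), Some i) # ys"], rule exI[of _ j]) (use * True v in \<open>auto simp: c ts\<close>)
  qed
qed

text \<open>The additive form avoids the truncating subtraction of multisets; cancelling then shows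
  that insertion both preserves and reflects balance.\<close>

lemma insert_letter_mset:
  "mset (map fst (insert_letter l ys j)) + mset (map snd (map fst ys)) =
   mset (map snd (insert_letter l ys j)) + mset (map fst (map fst ys))"
proof (induction ys)
  case Nil
  then show ?case by (simp add: insert_letter_def map_replicate_const)
next
  case (Cons y ys)
  obtain u w p where y: "y = ((u, w), p)" by (metis surj_pair)
  show ?case using Cons
    by (cases p) (auto simp: insert_letter_def y o_def map_replicate_const)
qed

lemma insert_letter_balanced:
  "mset (map fst (insert_letter l ys j)) = mset (map snd (insert_letter l ys j)) \<longleftrightarrow>
   mset (map fst (map fst ys)) = mset (map snd (map fst ys))"
  using insert_letter_mset[of l ys j] by (metis add_left_cancel add_right_cancel)

lemma map_fst_insert_letter_prefix:
  "map fst (map (\<lambda>((u, w), p). (u, case p of None \<Rightarrow> w | Some _ \<Rightarrow> l)) ys) = map fst (map fst ys)"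
  by (auto simp: split_def)

lemma bij_betw_insert_letter:
  "bij_betw (\<lambda>(ys, j). insert_letter m ys j) ({ys. map fst ys \<in> biwords m} \<times> UNIV) (biwords (Suc m))"
  unfolding bij_betw_def
proof
  have sub: "fst ` set ys \<subseteq> {..<m} \<times> {..<m}" if "map fst ys \<in> biwords m" for ys :: "((nat \<times> nat) \<times> nat option) list"
    using that by (simp add: biwords_def)
  show "inj_on (\<lambda>(ys, j). insert_letter m ys j) ({ys. map fst ys \<in> biwords m} \<times> UNIV)"
    using insert_letter_inj[OF _ sub sub] by (auto simp: inj_on_def)
  show "(\<lambda>(ys, j). insert_letter m ys j) ` ({ys. map fst ys \<in> biwords m} \<times> UNIV) = biwords (Suc m)"
  proof (intro equalityI subsetI)
    fix xs assume "xs \<in> (\<lambda>(ys, j). insert_letter m ys j) ` ({ys. map fst ys \<in> biwords m} \<times> UNIV)"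
    then obtain ys j where ys: "map fst ys \<in> biwords m" and xs: "xs = insert_letter m ys j" by auto
    have b: "mset (map fst xs) = mset (map snd xs)"
      using ys unfolding xs insert_letter_balanced biwords_def by blast
    have s: "set xs \<subseteq> {..<Suc m} \<times> {..<Suc m}"
      using sub[OF ys] unfolding xs insert_letter_def
      by (force split: option.splits)
    have "sorted (map fst xs)"
      unfolding xs insert_letter_def map_append map_fst_insert_letter_prefix
      using ys sub[OF ys] by (auto simp: sorted_append biwords_def o_def map_replicate_const)
    with b s show "xs \<in> biwords (Suc m)" by (simp add: biwords_def)
  next
    fix xs assume xs: "xs \<in> biwords (Suc m)"
    define fr where "fr = filter (\<lambda>c. fst c \<noteq> m) xs"
    define ts where "ts = map snd (filter (\<lambda>c. fst c = m) xs)"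
    have so: "sorted (map fst xs)" and su: "set xs \<subseteq> {..<Suc m} \<times> {..<Suc m}"
      and ba: "mset (map fst xs) = mset (map snd xs)" using xs by (auto simp: biwords_def)
    have "map (Pair m) ts = filter (\<lambda>c. fst c = m) xs"
      unfolding ts_def by (auto simp: o_def intro!: map_idI)
    moreover have "\<forall>c\<in>set xs. fst c \<le> m"
    proof
      fix c assume "c \<in> set xs"
      then show "fst c \<le> m" using su by (cases c) auto
    qed
    ultimately have split: "xs = fr @ map (Pair m) ts"
      using sorted_fst_split[OF so, of m] unfolding fr_def by simp
    have fr: "set fr \<subseteq> {..<m} \<times> {..<Suc m}" using su unfolding fr_def by (auto simp: less_Suc_eq)
    have ts: "set ts \<subseteq> {..<Suc m}" using su unfolding ts_def by auto
    \<comment> \<open>Balance at the letter \<open>m\<close>: in the top row it heads exactly the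
      columns of the final block, in the lower row it occurs in \<open>fr\<close> or in
      \<open>ts\<close>. Cancelling the occurrences in \<open>ts\<close> gives the equality of
      counts needed for decoding.\<close>
    have "count (mset (map fst xs)) m = length ts"
    proof -
      have "\<forall>c\<in>set fr. fst c \<noteq> m" unfolding fr_def by auto
      then have "count (mset (map fst fr)) m = 0" by (auto simp: count_eq_zero_iff)
      then show ?thesis unfolding split by (simp add: o_def map_replicate_const)
    qed
    moreover have "count (mset (map snd xs)) m = length (filter (\<lambda>c. snd c = m) fr) + length (filter (\<lambda>w. w = m) ts)"
      using count_mset_map_eq_length[of snd fr m] count_mset_map_eq_length[of "\<lambda>w. w" ts m]
      unfolding split by (simp add: o_def)
    moreover have "length ts = length (filter (\<lambda>w. w = m) ts) + length (filter (\<lambda>w. w \<noteq> m) ts)"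
      by (simp add: sum_length_filter_compl)
    ultimately have "length (filter (\<lambda>c. snd c = m) fr) = length (filter (\<lambda>w. w \<noteq> m) ts)" using ba by simp
    from insert_letter_surj_aux[OF this] obtain ys j where
      ys: "fr = map (\<lambda>((u, w), p). (u, case p of None \<Rightarrow> w | Some (_::nat) \<Rightarrow> m)) ys"
      "ts = concat (map (\<lambda>((u, w), p). case p of None \<Rightarrow> [] | Some i \<Rightarrow> replicate i m @ [w]) ys) @ replicate j m"
      "\<forall>((u, w), p) \<in> set ys. w \<noteq> m" by blast
    have eq: "xs = insert_letter m ys j" unfolding insert_letter_def ys(1,2)[symmetric] by (rule split)
    have mf: "map fst fr = map fst (map fst ys)"
      unfolding ys(1) by (rule map_fst_insert_letter_prefix)
    have "sorted (map fst (map fst ys))"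
      unfolding mf[symmetric] using so split by (simp add: sorted_append)
    moreover have "mset (map fst (map fst ys)) = mset (map snd (map fst ys))"
      using ba unfolding eq insert_letter_balanced .
    moreover have "set (map fst ys) \<subseteq> {..<m} \<times> {..<m}"
    proof
      fix c assume "c \<in> set (map fst ys)"
      then obtain u w p where c: "((u, w), p) \<in> set ys" "c = (u, w)" by force
      have "u < m" using fr c unfolding ys(1) by force
      moreover have "w < Suc m"
      proof (cases p)
        case None then show ?thesis using fr c unfolding ys(1) by force
      next
        case (Some i) 
        then have "w \<in> set ts" using c unfolding ys(2) by force
        then show ?thesis using ts by auto
      qed
      moreover have "w \<noteq> m" using ys(3) c by auto
      ultimately show "c \<in> {..<m} \<times> {..<m}" using c by auto
    qed
    ultimately have "map fst ys \<in> biwords m" unfolding biwords_def by blast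
    then show "xs \<in> (\<lambda>(ys, j). insert_letter m ys j) ` ({ys. map fst ys \<in> biwords m} \<times> UNIV)"
      unfolding eq by (auto intro!: image_eqI[of _ _ "(ys, j)"])
  qed
qed

lemma prod_list_insert_letter:
  fixes b :: "nat \<times> nat \<Rightarrow> 'a::comm_monoid_mult"
  shows "prod_list (map b (insert_letter l ys j)) =
    prod_list (map (\<lambda>((u, w), p). case p of None \<Rightarrow> b (u, w) | Some i \<Rightarrow> b (u, l) * b (l, l) ^ i * b (l, w)) ys)
    * b (l, l) ^ j"
proof (induction ys)
  case Nil
  then show ?case by (simp add: insert_letter_def prod_list_replicate)
next
  case (Cons y ys)
  obtain u w p where y: "y = ((u, w), p)" by (metis surj_pair)
  show ?case using Cons
    by (cases p) (auto simp: insert_letter_def y o_def prod_list_replicate map_replicate_const ac_simps)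
qed

text \<open>Summing over the mark of a column \<open>(u, w)\<close> gives \<open>b (u, w)\<close>
  for \<open>None\<close> and a geometric series in \<open>b (m, m)\<close> for the marks
  \<open>Some i\<close>, which together are the Schur complement entry \<open>b'\<close>. The
  columns \<open>(m, m)\<close> appended at the end contribute the factor in front.\<close>

lemma has_sum_biwords_Suc:
  fixes b :: "nat \<times> nat \<Rightarrow> real"
  assumes nn: "\<And>c. b c \<ge> 0" and d: "b (m, m) < 1"
    and S: "((\<lambda>xs. prod_list (map b' xs)) has_sum S) (biwords m)"
    and b': "\<And>u w. u < m \<Longrightarrow> w < m \<Longrightarrow> b' (u, w) = b (u, w) + b (u, m) * b (m, w) / (1 - b (m, m))"
  shows "((\<lambda>xs. prod_list (map b xs)) has_sum S / (1 - b (m, m))) (biwords (Suc m))"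
proof -
  define c where "c = (\<lambda>(u, w) p. case p of None \<Rightarrow> b (u, w) | Some i \<Rightarrow> b (u, m) * b (m, m) ^ i * b (m, w))"
  have cnn: "c x p \<ge> 0" for x p by (cases x) (auto simp: c_def nn split: option.splits)
  have c: "(c x has_sum b' x) UNIV" if "x \<in> {..<m} \<times> {..<m}" for x
  proof -
    from that obtain u w where x: "x = (u, w)" "u < m" "w < m" by (cases x) auto
    have "((\<lambda>i. b (u, m) * b (m, m) ^ i * b (m, w)) has_sum b (u, m) * (1 / (1 - b (m, m))) * b (m, w)) UNIV"
      using nn d by (intro has_sum_cmult_left has_sum_cmult_right has_sum_geometric_nonneg)
    then have "(c x has_sum b (u, m) * (1 / (1 - b (m, m))) * b (m, w)) (range Some)"
      by (subst has_sum_reindex) (auto simp: c_def x o_def)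
    moreover have "(c x has_sum b (u, w)) {None}" by (simp add: has_sum_finite_iff c_def x)
    ultimately have "(c x has_sum b (u, m) * (1 / (1 - b (m, m))) * b (m, w) + b (u, w)) (range Some \<union> {None})"
      by (intro has_sum_Un_disjoint) auto
    moreover have "range Some \<union> {None} = (UNIV :: nat option set)" using notin_range_Some by blast
    ultimately have "(c x has_sum b (u, m) * (1 / (1 - b (m, m))) * b (m, w) + b (u, w)) UNIV"
      by (simp only:)
    then show ?thesis using b'[OF x(2,3)] by (simp add: x add.commute)
  qed
  let ?w = "\<lambda>ys. prod_list (map (\<lambda>(x, p). c x p) ys)"
  have "((\<lambda>z. ?w (snd z)) has_sum S) (Sigma (biwords m) (\<lambda>xs. {ys. map fst ys = xs}))"
  proof (rule has_sum_Sigma_nonneg[OF _ S])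
    fix xs assume "xs \<in> biwords m"
    then have "x \<in> {..<m} \<times> {..<m}" if "x \<in> set xs" for x using that by (auto simp: biwords_def)
    then show "((\<lambda>ys. ?w (snd (xs, ys))) has_sum prod_list (map b' xs)) {ys. map fst ys = xs}"
      using has_sum_decorated_lists[OF cnn c, of xs] by simp
  qed (auto intro!: prod_list_nonneg cnn)
  moreover have bij: "bij_betw (\<lambda>ys. (map fst ys, ys)) {ys. map fst ys \<in> biwords m} (Sigma (biwords m) (\<lambda>xs. {ys. map fst ys = xs}))"
    by (rule bij_betwI[where g = snd]) auto
  ultimately have "(?w has_sum S) {ys. map fst ys \<in> biwords m}"
    using has_sum_reindex_bij_betw[OF bij, of "\<lambda>z. ?w (snd z)" S] by simp
  then have "((\<lambda>(ys, j). ?w ys * b (m, m) ^ j) has_sum S * (1 / (1 - b (m, m)))) ({ys. map fst ys \<in> biwords m} \<times> UNIV)"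
    using nn d by (intro has_sum_Times_mult_nonneg has_sum_geometric_nonneg) (auto intro!: prod_list_nonneg cnn)
  moreover have "(\<lambda>(ys, j). ?w ys * b (m, m) ^ j) = (\<lambda>z. prod_list (map b (case z of (ys, j) \<Rightarrow> insert_letter m ys j)))"
    unfolding prod_list_insert_letter c_def split_def by (simp add: fun_eq_iff)
  ultimately show ?thesis
    by (simp add: has_sum_reindex_bij_betw[OF bij_betw_insert_letter, of "\<lambda>xs. prod_list (map b xs)"])
qed

section \<open>A family of column weights that is stable under elimination\<close>

text \<open>
  Eliminating the largest letter, of variable \<open>x\<close>, turns the parameter \<open>l = 1 / V - 1\<close> of
  \<open>column_weight\<close> below into \<open>1 / elim_step t x V - 1\<close>.
\<close>

definition elim_step :: "real \<Rightarrow> real \<Rightarrow> real \<Rightarrow> real" where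
  "elim_step t x V = (V - t * x) * (1 - x) / (1 - t * x)"

fun elim_iter :: "nat \<Rightarrow> real \<Rightarrow> (nat \<Rightarrow> real) \<Rightarrow> real \<Rightarrow> real" where
  "elim_iter 0 t x V = V"
| "elim_iter (Suc m) t x V = elim_iter m t x (elim_step t (x m) V)"

text \<open>At \<open>l = 0\<close> the diagonal vanishes, and the other entries are the weight of
  the lower letter \<open>w\<close> times one absorbed geometric series. A positive \<open>l\<close>
  records the letters already eliminated, which add the same multiple of
  \<open>t * x w / (1 - t * x w)\<close> to all three cases.\<close>

definition column_weight :: "real \<Rightarrow> (nat \<Rightarrow> real) \<Rightarrow> real \<Rightarrow> nat \<times> nat \<Rightarrow> real" where
  "column_weight t x l = (\<lambda>(u, w).
     (if u < w then x w / (1 - x w) + l * (t * x w / (1 - t * x w))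
      else if u = w then l * (t * x w / (1 - t * x w))
      else (1 + l) * (t * x w / (1 - t * x w))))"

lemma column_weight_add:
  "column_weight t x (l + mu) (u, w) = column_weight t x l (u, w) + mu * (t * x w / (1 - t * x w))"
  by (simp add: column_weight_def algebra_simps add_divide_distrib)

text \<open>Elimination stays away from its poles: one step lowers \<open>V\<close> by at most
  \<open>2 * x\<close>, so the condition that twice the sum of the remaining variables is below
  \<open>V\<close> is inherited. The factor 2 pays for \<open>t * x\<close> and for
  \<open>V * x\<close>, each at most \<open>x\<close>.\<close>

lemma elim_step_bounds:
  assumes "0 \<le> t" "t \<le> 1" "0 \<le> x" "x < 1" "2 * x < V" "V \<le> 1"
  shows "V - 2 * x \<le> elim_step t x V" "elim_step t x V \<le> V" "t * x < 1" "t * x < V"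
proof -
  have tx: "0 \<le> t * x" "t * x \<le> x" using assms by (auto intro: mult_left_le_one_le)
  show "t * x < 1" "t * x < V" using tx assms by linarith+
  have r: "(1 - x) / (1 - t * x) \<le> 1" "1 - x \<le> (1 - x) / (1 - t * x)"
  proof -
    show "(1 - x) / (1 - t * x) \<le> 1" using tx assms by simp
    have "(1 - x) * (1 - t * x) \<le> 1 - x" using tx assms by (intro mult_left_le) auto
    then show "1 - x \<le> (1 - x) / (1 - t * x)" using \<open>t * x < 1\<close> by (simp add: le_divide_eq)
  qed
  have e: "elim_step t x V = (V - t * x) * ((1 - x) / (1 - t * x))" by (simp add: elim_step_def)
  have "elim_step t x V \<le> (V - t * x) * 1" unfolding e
    using r tx assms by (intro mult_left_mono) auto
  then show "elim_step t x V \<le> V" using tx by simp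
  have "(V - t * x) * (1 - x) \<le> elim_step t x V" unfolding e
    using r tx assms by (intro mult_left_mono) auto
  moreover have "V * x \<le> 1 * x" using assms by (intro mult_right_mono) auto
  moreover have "(V - t * x) * (1 - x) = V - t * x - V * x + t * x * x" by (simp add: algebra_simps)
  moreover have "0 \<le> t * x * x" using assms by simp
  ultimately show "V - 2 * x \<le> elim_step t x V" using tx by linarith
qed

text \<open>Each elimination contributes the factor \<open>(1 - x m) * V / V'\<close> with
  \<open>V'\<close> the next parameter, so the parameters telescope.\<close>

lemma has_sum_biwords:
  fixes x :: "nat \<Rightarrow> real"
  assumes t: "0 \<le> t" "t \<le> 1" and x: "\<And>i. 0 \<le> x i" "\<And>i. x i < 1"
    and V: "2 * (\<Sum>i<m. x i) < V" "V \<le> 1"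
  shows "((\<lambda>xs. prod_list (map (column_weight t x (1 / V - 1)) xs)) has_sum
           (\<Prod>i<m. 1 - x i) * V / elim_iter m t x V) (biwords m) \<and> elim_iter m t x V > 0"
  using V
proof (induction m arbitrary: V)
  case 0
  have "biwords 0 = {[]}" by (auto simp: biwords_def)
  then show ?case using 0 by (simp add: has_sum_finite_iff)
next
  case (Suc m)
  define V' where "V' = elim_step t (x m) V"
  have nn: "0 \<le> (\<Sum>i<m. x i)" using x by (intro sum_nonneg) auto
  have xm: "2 * x m < V" using Suc.prems nn by simp
  note b = elim_step_bounds[OF t x xm Suc.prems(2)]
  have V': "2 * (\<Sum>i<m. x i) < V'" "V' \<le> 1" using b Suc.prems unfolding V'_def by auto
  have V0: "V > 0" using xm x(1)[of m] by linarith
  have V'0: "V' > 0" using V' nn by linarith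
  define l where "l = 1 / V - 1"
  have l: "l \<ge> 0" using V0 Suc.prems(2) by (simp add: l_def field_simps)
  let ?b = "column_weight t x l"
  have tx: "t * x w < 1" for w
    using t x[of w] by (metis mult_left_le_one_le le_less_trans)
  have bnn: "?b c \<ge> 0" for c
    using t x tx l by (cases c) (auto simp: column_weight_def less_imp_le)
  have d: "1 - ?b (m, m) = (V - t * x m) / (V * (1 - t * x m))"
    using V0 tx[of m] by (simp add: column_weight_def l_def field_simps)
  have d0: "1 - ?b (m, m) > 0" unfolding d using b V0 by (intro divide_pos_pos mult_pos_pos) auto
  have b': "column_weight t x (1 / V' - 1) (u, w) = ?b (u, w) + ?b (u, m) * ?b (m, w) / (1 - ?b (m, m))"
    if uw: "u < m" "w < m" for u w
  proof -
    \<comment> \<open>For \<open>u, w < m\<close> the weight \<open>?b (u, m)\<close> does not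
      depend on \<open>u\<close>, and \<open>?b (m, w)\<close> is \<open>1 + l\<close> times
      \<open>t * x w / (1 - t * x w)\<close>. Hence the Schur correction is a constant
      \<open>mu\<close> times that quotient, which by \<open>column_weight_add\<close> is a shift of
      \<open>l\<close>.\<close>
    define mu where "mu = ?b (u, m) * (1 + l) / (1 - ?b (m, m))"
    define X where "X = 1 - x m"
    define T where "T = 1 - t * x m"
    define W where "W = V - t * x m"
    have pos: "X > 0" "T > 0" "W > 0" "V > 0" using b x[of m] V0 by (auto simp: X_def T_def W_def)
    have um: "?b (u, m) = (1 - X) / X + l * ((1 - T) / T)" using uw by (simp add: column_weight_def X_def T_def)
    have dm: "1 - ?b (m, m) = W / (V * T)" using d by (simp add: W_def T_def)
    have WT: "W = V + T - 1" by (simp add: W_def T_def)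
    have "mu = ((1 - X) / X + (1 / V - 1) * ((1 - T) / T)) * (1 / V) / (W / (V * T))"
      unfolding mu_def um dm by (simp add: l_def)
    also have "\<dots> = T / (W * X) - 1 / V"
      using pos unfolding WT by (simp add: divide_simps) (simp add: algebra_simps)
    finally have "l + mu = T / (W * X) - 1" by (simp add: l_def)
    also have "\<dots> = 1 / V' - 1" by (simp add: V'_def elim_step_def X_def T_def W_def)
    finally have lm: "1 / V' - 1 = l + mu" by simp
    have mw: "?b (m, w) = (1 + l) * (t * x w / (1 - t * x w))" using uw by (simp add: column_weight_def)
    show ?thesis unfolding lm column_weight_add mw mu_def by (simp add: ac_simps)
  qed
  from Suc.IH[OF V'] have IH: "((\<lambda>xs. prod_list (map (column_weight t x (1 / V' - 1)) xs)) has_sum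
           (\<Prod>i<m. 1 - x i) * V' / elim_iter m t x V') (biwords m)" "elim_iter m t x V' > 0" by auto
  from has_sum_biwords_Suc[OF bnn _ IH(1) b'] d0
  have "((\<lambda>xs. prod_list (map ?b xs)) has_sum ((\<Prod>i<m. 1 - x i) * V' / elim_iter m t x V') / (1 - ?b (m, m))) (biwords (Suc m))"
    by simp
  also have "((\<Prod>i<m. 1 - x i) * V' / elim_iter m t x V') / (1 - ?b (m, m)) =
     (\<Prod>i<Suc m. 1 - x i) * V / elim_iter (Suc m) t x V"
  proof -
    have "V' / (1 - ?b (m, m)) = (1 - x m) * V" 
    proof -
      have "V - t * x m \<noteq> 0" "1 - t * x m \<noteq> 0" "V \<noteq> 0" using b V0 by auto
      then show ?thesis unfolding d V'_def elim_step_def by simp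
    qed
    moreover have "((\<Prod>i<m. 1 - x i) * V' / elim_iter m t x V') / (1 - ?b (m, m)) =
        (\<Prod>i<m. 1 - x i) * (V' / (1 - ?b (m, m))) / elim_iter m t x V'" by simp
    ultimately show ?thesis by (simp add: V'_def)
  qed
  finally show ?case using IH(2) by (simp add: l_def V'_def)
qed

section \<open>Removal of the columns with two equal letters\<close>

lemma has_sum_prod_PiE_nonneg:
  fixes f :: "'a \<Rightarrow> 'b \<Rightarrow> real"
  assumes "finite A" "\<And>x. x \<in> A \<Longrightarrow> (f x has_sum s x) (B x)"
    "\<And>x y. x \<in> A \<Longrightarrow> y \<in> B x \<Longrightarrow> f x y \<ge> 0"
  shows "((\<lambda>g. \<Prod>x\<in>A. f x (g x)) has_sum (\<Prod>x\<in>A. s x)) (PiE A B)"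
  using assms
proof (induction rule: finite_induct)
  case empty
  then show ?case by (simp add: has_sum_finite_iff)
next
  case (insert a A)
  have "((\<lambda>(y, g). f a y * (\<Prod>x\<in>A. f x (g x))) has_sum s a * (\<Prod>x\<in>A. s x)) (B a \<times> PiE A B)"
    using insert by (intro has_sum_Times_mult_nonneg) (auto intro!: prod_nonneg)
  also have "?this \<longleftrightarrow> (((\<lambda>g. \<Prod>x\<in>insert a A. f x (g x)) \<circ> (\<lambda>(y, g). g(a := y))) has_sum s a * (\<Prod>x\<in>A. s x)) (B a \<times> PiE A B)"
    using insert.hyps by (intro has_sum_cong) (auto intro!: prod.cong)
  also have "\<dots> \<longleftrightarrow> ((\<lambda>g. \<Prod>x\<in>insert a A. f x (g x)) has_sum s a * (\<Prod>x\<in>A. s x)) (PiE (insert a A) B)"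
    unfolding PiE_insert_eq using insert.hyps by (intro has_sum_reindex[symmetric] inj_combinator)
  finally show ?case using insert.hyps by simp
qed

text \<open>
  Here \<open>k i\<close> is the weight of a letter \<open>u\<close> in the block of \<open>u\<close> that is preceded there by \<open>i\<close> other letters.
\<close>

fun block_weight :: "nat \<Rightarrow> (nat \<Rightarrow> real) \<Rightarrow> (nat \<Rightarrow> real) \<Rightarrow> nat \<Rightarrow> nat list \<Rightarrow> real" where
  "block_weight u k a i [] = 1"
| "block_weight u k a i (y # ys) =
     (if y = u then k i * block_weight u k a i ys else a y * block_weight u k a (Suc i) ys)"

lemma block_weight_replicate:
  "block_weight u k a i (replicate j u @ ys) = k i ^ j * block_weight u k a i ys"
  by (induction j) auto

lemma block_weight_nonneg:
  assumes "\<And>i. k i \<ge> 0" "\<And>y. a y \<ge> 0"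
  shows "block_weight u k a i ys \<ge> 0"
  using assms by (induction ys arbitrary: i) auto

lemma filter_neq_eq_Cons_iff:
  "filter (\<lambda>y. y \<noteq> u) ys = w # g \<longleftrightarrow> (\<exists>j zs. ys = replicate j u @ w # zs \<and> w \<noteq> u \<and> filter (\<lambda>y. y \<noteq> u) zs = g)"
proof
  assume "filter (\<lambda>y. y \<noteq> u) ys = w # g"
  then obtain us zs where *: "ys = us @ w # zs" "\<forall>y\<in>set us. y = u" "w \<noteq> u" "g = filter (\<lambda>y. y \<noteq> u) zs"
    by (auto simp: filter_eq_Cons_iff)
  then have "us = replicate (length us) u" by (simp add: replicate_length_same)
  with * show "\<exists>j zs. ys = replicate j u @ w # zs \<and> w \<noteq> u \<and> filter (\<lambda>y. y \<noteq> u) zs = g" by metis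
qed auto

text \<open>The lists in question arise from \<open>g\<close> by filling its
  \<open>length g + 1\<close> gaps with copies of \<open>u\<close>; the gap after \<open>j\<close>
  letters of \<open>g\<close> contributes the geometric series in \<open>k (i + j)\<close>.\<close>

lemma has_sum_block_weight:
  assumes k: "\<And>i. 0 \<le> k i" "\<And>i. k i < 1" and a: "\<And>y. 0 \<le> a y" and u: "u \<notin> set g"
  shows "(block_weight u k a i has_sum prod_list (map a g) * (\<Prod>j\<le>length g. 1 / (1 - k (i + j))))
           {ys. filter (\<lambda>y. y \<noteq> u) ys = g}"
  using u
proof (induction g arbitrary: i)
  case Nil
  have "{ys. filter (\<lambda>y. y \<noteq> u) ys = []} = range (\<lambda>j. replicate j u)"
  proof (intro equalityI subsetI)
    fix ys assume "ys \<in> {ys. filter (\<lambda>y. y \<noteq> u) ys = []}"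
    then have "ys = replicate (length ys) u" by (intro replicate_length_same[symmetric]) (auto simp: filter_empty_conv)
    then show "ys \<in> range (\<lambda>j. replicate j u)" by blast
  qed auto
  moreover have "inj (\<lambda>j. replicate j u)" by (auto simp: inj_def replicate_eq_replicate)
  moreover have "((\<lambda>j. k i ^ j) has_sum 1 / (1 - k i)) UNIV" using k by (intro has_sum_geometric_nonneg)
  moreover have "block_weight u k a i (replicate j u) = k i ^ j" for j
    using block_weight_replicate[of u k a i j "[]"] by simp
  ultimately show ?case by (simp add: has_sum_reindex o_def)
next
  case (Cons w g)
  define h where "h = (\<lambda>(j, zs). replicate j u @ w # zs)"
  have w: "w \<noteq> u" using Cons.prems by auto
  have im: "{ys. filter (\<lambda>y. y \<noteq> u) ys = w # g} = h ` (UNIV \<times> {zs. filter (\<lambda>y. y \<noteq> u) zs = g})"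
  proof (intro equalityI subsetI)
    fix ys assume "ys \<in> {ys. filter (\<lambda>y. y \<noteq> u) ys = w # g}"
    then obtain j zs where "ys = replicate j u @ w # zs" "filter (\<lambda>y. y \<noteq> u) zs = g"
      using filter_neq_eq_Cons_iff[of u ys w g] by blast
    then show "ys \<in> h ` (UNIV \<times> {zs. filter (\<lambda>y. y \<noteq> u) zs = g})"
      by (intro image_eqI[of _ _ "(j, zs)"]) (auto simp: h_def)
  next
    fix ys assume "ys \<in> h ` (UNIV \<times> {zs. filter (\<lambda>y. y \<noteq> u) zs = g})"
    then show "ys \<in> {ys. filter (\<lambda>y. y \<noteq> u) ys = w # g}" using w by (auto simp: h_def)
  qed
  have inj: "inj_on h (UNIV \<times> {zs. filter (\<lambda>y. y \<noteq> u) zs = g})"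
  proof (rule inj_onI)
    fix p p' assume "h p = h p'"
    then have "fst p = fst p' \<and> w = w \<and> snd p = snd p'"
      unfolding h_def split_def by (rule replicate_append_Cons_eq[OF _ w w])
    then show "p = p'" by (simp add: prod_eq_iff)
  qed
  have "((\<lambda>(j, zs). k i ^ j * (a w * block_weight u k a (Suc i) zs)) has_sum
      1 / (1 - k i) * (a w * (prod_list (map a g) * (\<Prod>j\<le>length g. 1 / (1 - k (Suc i + j))))))
      (UNIV \<times> {zs. filter (\<lambda>y. y \<noteq> u) zs = g})"
    using k a Cons.IH[of "Suc i"] Cons.prems block_weight_nonneg[of k a]
    by (intro has_sum_Times_mult_nonneg has_sum_geometric_nonneg has_sum_cmult_right) auto
  moreover have "block_weight u k a i \<circ> h = (\<lambda>(j, zs). k i ^ j * (a w * block_weight u k a (Suc i) zs))"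
    using w by (auto simp: fun_eq_iff h_def block_weight_replicate)
  moreover have "1 / (1 - k i) * (a w * (prod_list (map a g) * (\<Prod>j\<le>length g. 1 / (1 - k (Suc i + j))))) =
    prod_list (map a (w # g)) * (\<Prod>j\<le>length (w # g). 1 / (1 - k (i + j)))"
    by (simp add: prod.atMost_Suc_shift del: prod.atMost_Suc)
  ultimately show ?case unfolding im by (subst has_sum_reindex[OF inj]) simp
qed

section \<open>Words, their blocks and their two-line words\<close>

definition block_columns :: "nat \<Rightarrow> (nat \<Rightarrow> nat list) \<Rightarrow> (nat \<times> nat) list" where
  "block_columns m f = concat (map (\<lambda>u. map (Pair u) (f u)) [0..<m])"

lemma columns_Suc: "block_columns (Suc m) f = block_columns m f @ map (Pair m) (f m)"
  by (simp add: block_columns_def)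

lemma set_columns: "set (block_columns m f) = {(u, w). u < m \<and> w \<in> set (f u)}"
  by (auto simp: block_columns_def)

lemma filter_columns: "u < m \<Longrightarrow> filter (\<lambda>c. fst c = u) (block_columns m f) = map (Pair u) (f u)"
proof (induction m)
  case (Suc m)
  have "filter (\<lambda>c. fst c = m) (block_columns m f) = []" by (auto simp: filter_empty_conv set_columns)
  then show ?case using Suc by (cases "u = m") (auto simp: columns_Suc filter_map o_def)
qed simp

lemma sorted_columns: "sorted (map fst (block_columns m f))"
  by (induction m) (auto simp: columns_Suc sorted_append set_columns o_def map_replicate_const, simp add: block_columns_def)

lemma columns_filter:
  assumes "sorted (map fst xs)" "\<forall>c\<in>set xs. fst c < m"
  shows "block_columns m (\<lambda>u. map snd (filter (\<lambda>c. fst c = u) xs)) = xs"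
  using assms
proof (induction m arbitrary: xs)
  case 0
  then show ?case by (cases xs) (auto simp: block_columns_def)
next
  case (Suc m)
  let ?ys = "filter (\<lambda>c. fst c \<noteq> m) xs"
  have "block_columns m (\<lambda>u. map snd (filter (\<lambda>c. fst c = u) ?ys)) = ?ys"
    using Suc.prems by (intro Suc.IH) (auto simp: less_Suc_eq sorted_filter)
  moreover have "block_columns m (\<lambda>u. map snd (filter (\<lambda>c. fst c = u) ?ys)) = block_columns m (\<lambda>u. map snd (filter (\<lambda>c. fst c = u) xs))"
    unfolding block_columns_def
    by (intro arg_cong[where f = concat] map_cong refl) (auto intro!: arg_cong[where f = "map _"] filter_cong)
  moreover have "map (Pair m) (map snd (filter (\<lambda>c. fst c = m) xs)) = filter (\<lambda>c. fst c = m) xs"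
    by (auto simp: o_def intro!: map_idI)
  ultimately show ?case
    using sorted_fst_split[of xs m] Suc.prems by (simp add: columns_Suc less_Suc_eq_le)
qed

text \<open>The list \<open>f u\<close> is the segment of the word below the letters
  \<open>u\<close> of its sorted rearrangement, so its length must be the multiplicity of
  \<open>u\<close> in the word.\<close>

definition blocks :: "nat \<Rightarrow> (nat \<Rightarrow> nat list) set" where
  "blocks m = {f \<in> {..<m} \<rightarrow>\<^sub>E lists {..<m}. \<forall>u<m. length (f u) = (\<Sum>v<m. count_list (f v) u)}"

lemma count_fst_columns: "count (mset (map fst (block_columns m f))) u = (if u < m then length (f u) else 0)"
  by (induction m) (auto simp: columns_Suc o_def map_replicate_const, simp add: block_columns_def)

lemma count_snd_columns: "count (mset (map snd (block_columns m f))) u = (\<Sum>v<m. count_list (f v) u)"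
proof (induction m)
  case (Suc m)
  then show ?case by (simp add: columns_Suc o_def count_mset)
qed (simp add: block_columns_def)

lemma columns_balanced:
  assumes "f \<in> {..<m} \<rightarrow>\<^sub>E lists {..<m}"
  shows "mset (map fst (block_columns m f)) = mset (map snd (block_columns m f)) \<longleftrightarrow>
     (\<forall>u<m. length (f u) = (\<Sum>v<m. count_list (f v) u))"
proof -
  have "(\<Sum>v<m. count_list (f v) u) = 0" if "\<not> u < m" for u
    using assms that by (fastforce simp: PiE_iff intro!: count_notin)
  then show ?thesis
    unfolding multiset_eq_iff count_fst_columns count_snd_columns by auto
qed

lemma bij_betw_columns: "bij_betw (block_columns m) (blocks m) (biwords m)"
proof (rule bij_betwI[where g = "\<lambda>xs. restrict (\<lambda>u. map snd (filter (\<lambda>c. fst c = u) xs)) {..<m}"])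
  have cong: "block_columns m (restrict f {..<m}) = block_columns m f" for f
    unfolding block_columns_def by (intro arg_cong[where f = concat] map_cong) auto
  show "block_columns m \<in> blocks m \<rightarrow> biwords m"
  proof
    fix f assume f: "f \<in> blocks m"
    then have "f \<in> {..<m} \<rightarrow>\<^sub>E lists {..<m}" by (simp add: blocks_def)
    with f columns_balanced[OF this] show "block_columns m f \<in> biwords m"
      unfolding biwords_def blocks_def by (auto simp: set_columns sorted_columns simp del: mset_map)
  qed
  show "restrict (\<lambda>u. map snd (filter (\<lambda>c. fst c = u) (block_columns m f))) {..<m} = f" if "f \<in> blocks m" for f
    using that by (auto simp: fun_eq_iff filter_columns blocks_def o_def restrict_def PiE_def extensional_def)
  have *: "block_columns m (restrict (\<lambda>u. map snd (filter (\<lambda>c. fst c = u) xs)) {..<m}) = xs" if "xs \<in> biwords m" for xs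
    unfolding cong by (rule columns_filter) (use that in \<open>auto simp: biwords_def\<close>)
  then show "block_columns m (restrict (\<lambda>u. map snd (filter (\<lambda>c. fst c = u) xs)) {..<m}) = xs" if "xs \<in> biwords m" for xs
    using that .
  show "(\<lambda>xs. restrict (\<lambda>u. map snd (filter (\<lambda>c. fst c = u) xs)) {..<m}) \<in> biwords m \<rightarrow> blocks m"
  proof
    fix xs assume xs: "xs \<in> biwords m"
    let ?f = "restrict (\<lambda>u. map snd (filter (\<lambda>c. fst c = u) xs)) {..<m}"
    have "b < m" if "(a, b) \<in> set xs" for a b using xs that by (auto simp: biwords_def)
    then have f: "?f \<in> {..<m} \<rightarrow>\<^sub>E lists {..<m}" by auto
    have "mset (map fst (block_columns m ?f)) = mset (map snd (block_columns m ?f))"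
      unfolding *[OF xs] using xs by (simp add: biwords_def)
    with f show "?f \<in> blocks m" unfolding columns_balanced[OF f] blocks_def by blast
  qed
qed

text \<open>The top row is determined by the lower one: being sorted and having the same multiset,
  it is the sort of the lower row.\<close>

lemma bij_betw_map_snd_biwords: "bij_betw (map snd) (biwords m) (lists {..<m})"
proof (rule bij_betwI[where g = "\<lambda>w. zip (sort w) w"])
  show "map snd \<in> biwords m \<rightarrow> lists {..<m}" by (fastforce simp: biwords_def)
  show "(\<lambda>w. zip (sort w) w) \<in> lists {..<m} \<rightarrow> biwords m"
  proof
    fix w assume w: "w \<in> lists {..<m}"
    have "set (zip (sort w) w) \<subseteq> set w \<times> set w"
      using set_zip_leftD[of _ _ "sort w" w] set_zip_rightD[of _ _ "sort w" w] by auto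
    moreover have "set w \<subseteq> {..<m}" using w by auto
    ultimately have "set (zip (sort w) w) \<subseteq> {..<m} \<times> {..<m}" by blast
    then show "zip (sort w) w \<in> biwords m"
      by (simp add: biwords_def flip: mset_map)
  qed
  show "zip (sort (map snd xs)) (map snd xs) = xs" if "xs \<in> biwords m" for xs
  proof -
    have "sort (map snd xs) = map fst xs"
      using that by (intro properties_for_sort) (auto simp: biwords_def)
    then show ?thesis by (simp add: zip_map_fst_snd)
  qed
qed auto

lemma map_snd_columns: "map snd (block_columns m f) = concat (map f [0..<m])"
  by (induction m) (auto simp: columns_Suc o_def, simp add: block_columns_def)

lemma bij_betw_blocks_words: "bij_betw (\<lambda>f. concat (map f [0..<m])) (blocks m) (lists {..<m})"
  using bij_betw_trans[OF bij_betw_columns bij_betw_map_snd_biwords, of m]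
  by (simp add: o_def map_snd_columns)

text \<open>This is the threshold in the block of \<open>u\<close>: a letter \<open>u\<close> there
  moves left under stable sorting iff more than this many other letters precede it in the
  block.\<close>

definition left_count :: "(nat \<Rightarrow> nat list) \<Rightarrow> nat \<Rightarrow> nat" where
  "left_count f u = (\<Sum>v<u. count_list (f v) u)"

definition blocks_weight :: "real \<Rightarrow> (nat \<Rightarrow> real) \<Rightarrow> nat \<Rightarrow> (nat \<Rightarrow> nat list) \<Rightarrow> real" where
  "blocks_weight t x m f = (\<Prod>u<m. block_weight u (\<lambda>i. if i \<le> left_count f u then x u else t * x u)
      (\<lambda>y. if y < u then t * x y else x y) 0 (f u))"

lemma prod_list_map_count:
  fixes h :: "nat \<Rightarrow> real"
  assumes "set ys \<subseteq> {..<m}"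
  shows "prod_list (map h ys) = (\<Prod>w<m. h w ^ count_list ys w)"
  using assms
proof (induction ys)
  case (Cons y ys)
  have "(\<Prod>w<m. h w ^ count_list (y # ys) w) = (\<Prod>w<m. (if w = y then h w else 1) * h w ^ count_list ys w)"
    by (intro prod.cong) auto
  also have "\<dots> = h y * (\<Prod>w<m. h w ^ count_list ys w)"
    using Cons.prems by (simp add: prod.distrib)
  finally show ?case using Cons by simp
qed simp

lemma count_list_filter_neq: "v \<noteq> u \<Longrightarrow> count_list (filter (\<lambda>y. y \<noteq> v) ys) u = count_list ys u"
  by (induction ys) auto

lemma length_filter_neq: "length ys = length (filter (\<lambda>y. y \<noteq> u) ys) + count_list ys u"
  by (induction ys) auto

lemma prod_list_columns: "prod_list (map h (block_columns m f)) = (\<Prod>u<m. prod_list (map (\<lambda>w. h (u, w)) (f u)))"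
  by (induction m) (auto simp: columns_Suc o_def, simp add: block_columns_def)

definition derangement_blocks :: "nat \<Rightarrow> (nat \<Rightarrow> nat list) set" where
  "derangement_blocks m = {g \<in> blocks m. \<forall>u<m. u \<notin> set (g u)}"

text \<open>Removing a letter \<open>u\<close> from its own block lowers both the length of that
  block and the multiplicity of \<open>u\<close> by one, so balance survives. The threshold
  \<open>left_count\<close> only looks at other blocks.\<close>

lemma remove_diagonal:
  assumes f: "f \<in> extensional {..<m}" and g: "g \<in> extensional {..<m}" and
    fg: "\<And>u. u < m \<Longrightarrow> filter (\<lambda>y. y \<noteq> u) (f u) = g u"
  shows "f \<in> blocks m \<longleftrightarrow> g \<in> derangement_blocks m" "u < m \<Longrightarrow> left_count f u = left_count g u"
proof -
  have c: "count_list (g v) u = (if u = v then 0 else count_list (f v) u)" if "v < m" for u v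
    using count_list_filter_neq[of v u] by (auto simp flip: fg[OF that])
  show "left_count f u = left_count g u" if "u < m"
    unfolding left_count_def using that by (intro sum.cong) (auto simp: c)
  have l: "length (f u) = length (g u) + count_list (f u) u" if "u < m" for u
    using length_filter_neq[of "f u" u] fg[OF that] by simp
  have s: "(\<Sum>v<m. count_list (f v) u) = (\<Sum>v<m. count_list (g v) u) + count_list (f u) u" if "u < m" for u
    using that by (subst (1 2) sum.remove[of _ u]) (auto simp: c intro!: sum.cong)
  have "set (f u) \<subseteq> {..<m} \<longleftrightarrow> set (g u) \<subseteq> {..<m}" if "u < m" for u
    using that by (auto simp flip: fg)
  moreover have "u \<notin> set (g u)" if "u < m" for u using that by (auto simp flip: fg)
  ultimately show "f \<in> blocks m \<longleftrightarrow> g \<in> derangement_blocks m"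
    using f g l s by (auto simp: blocks_def derangement_blocks_def PiE_def Pi_def lists_eq_set)
qed

text \<open>There are \<open>l + 1\<close> gaps of the first kind and \<open>r\<close> of the
  second. One factor is split off because the other \<open>l + r\<close> are to be matched with
  letters.\<close>

lemma prod_gap_weights:
  fixes x :: real
  shows "(\<Prod>j\<le>l + r. 1 / (1 - (if j \<le> l then x else y))) = (1 / (1 - x)) * ((1 / (1 - x)) ^ l * (1 / (1 - y)) ^ r)"
proof (induction r)
  case 0
  have "(\<Prod>j\<le>l. 1 / (1 - (if j \<le> l then x else y))) = (\<Prod>j\<le>l. 1 / (1 - x))" by (intro prod.cong) auto
  then show ?case by simp
next
  case (Suc r)
  then show ?case by simp
qed

text \<open>The gap factors of the block of \<open>u\<close> are handed to the occurrences of
  \<open>u\<close> in other blocks: \<open>1 / (1 - x u)\<close> to the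
  \<open>left_count g u\<close> of them in blocks of smaller letters,
  \<open>1 / (1 - t * x u)\<close> to the \<open>r u\<close> of them in blocks of larger ones.
  Joined with the weight of the letter itself they form \<open>column_weight\<close> at
  \<open>l = 0\<close>; one factor \<open>1 / (1 - x u)\<close> per letter remains.\<close>

lemma derangement_block_weight:
  assumes g: "g \<in> derangement_blocks m"
  shows "(\<Prod>u<m. prod_list (map (\<lambda>y. if y < u then t * x y else x y) (g u)) *
            (\<Prod>j\<le>length (g u). 1 / (1 - (if j \<le> left_count g u then x u else t * x u)))) =
     (\<Prod>u<m. 1 / (1 - x u)) * prod_list (map (column_weight t x 0) (block_columns m g))"
proof -
  define r where "r u = (\<Sum>v\<in>{u..<m}. count_list (g v) u)" for u
  define h where "h v u = (if v < u then 1 / (1 - x u) else 1 / (1 - t * x u))" for v u :: nat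
  have sub: "set (g v) \<subseteq> {..<m}" if "v < m" for v using g that by (auto simp: derangement_blocks_def blocks_def PiE_iff)
  have split: "{..<m} = {..<u} \<union> {u..<m}" if "u < m" for u using that by auto
  have len: "length (g u) = left_count g u + r u" if "u < m" for u
  proof -
    have "length (g u) = (\<Sum>v<m. count_list (g v) u)" using g that by (simp add: derangement_blocks_def blocks_def)
    also have "\<dots> = left_count g u + r u" unfolding left_count_def r_def split[OF that]
      by (intro sum.union_disjoint) auto
    finally show ?thesis .
  qed
  have hp: "(1 / (1 - x u)) ^ left_count g u * (1 / (1 - t * x u)) ^ r u = (\<Prod>v<m. h v u ^ count_list (g v) u)" if "u < m" for u
  proof -
    have "(\<Prod>v<m. h v u ^ count_list (g v) u) = (\<Prod>v<u. h v u ^ count_list (g v) u) * (\<Prod>v\<in>{u..<m}. h v u ^ count_list (g v) u)"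
      unfolding split[OF that] by (intro prod.union_disjoint) auto
    also have "(\<Prod>v<u. h v u ^ count_list (g v) u) = (1 / (1 - x u)) ^ left_count g u"
      unfolding left_count_def power_sum by (intro prod.cong) (auto simp: h_def)
    also have "(\<Prod>v\<in>{u..<m}. h v u ^ count_list (g v) u) = (1 / (1 - t * x u)) ^ r u"
      unfolding r_def power_sum by (intro prod.cong) (auto simp: h_def)
    finally show ?thesis by simp
  qed
  have "(\<Prod>u<m. prod_list (map (\<lambda>y. if y < u then t * x y else x y) (g u)) *
            (\<Prod>j\<le>length (g u). 1 / (1 - (if j \<le> left_count g u then x u else t * x u)))) =
        (\<Prod>u<m. prod_list (map (\<lambda>y. if y < u then t * x y else x y) (g u)) *
            (1 / (1 - x u) * (\<Prod>v<m. h v u ^ count_list (g v) u)))"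
    by (intro prod.cong refl) (auto simp only: lessThan_iff len prod_gap_weights hp)
  \<comment> \<open>Swapping the double product regroups the factors, from the letter
    \<open>u\<close> whose gaps produced them to the block \<open>v\<close> in which they are
    spent.\<close>
  also have "\<dots> = (\<Prod>u<m. 1 / (1 - x u)) * ((\<Prod>u<m. prod_list (map (\<lambda>y. if y < u then t * x y else x y) (g u))) *
      (\<Prod>v<m. \<Prod>u<m. h v u ^ count_list (g v) u))"
    unfolding prod.distrib by (subst (2) prod.swap) (simp add: mult_ac)
  also have "(\<Prod>v<m. \<Prod>u<m. h v u ^ count_list (g v) u) = (\<Prod>v<m. prod_list (map (h v) (g v)))"
    using sub by (intro prod.cong refl prod_list_map_count[symmetric]) auto
  also have "(\<Prod>u<m. prod_list (map (\<lambda>y. if y < u then t * x y else x y) (g u))) * (\<Prod>v<m. prod_list (map (h v) (g v)))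
    = (\<Prod>u<m. prod_list (map (\<lambda>y. column_weight t x 0 (u, y)) (g u)))"
  proof -
    have "prod_list (map (\<lambda>y. if y < u then t * x y else x y) (g u)) * prod_list (map (h u) (g u)) =
       prod_list (map (\<lambda>y. column_weight t x 0 (u, y)) (g u))" if "u < m" for u
    proof -
      have "prod_list (map (\<lambda>y. if y < u then t * x y else x y) ys) * prod_list (map (h u) ys) =
         prod_list (map (\<lambda>y. column_weight t x 0 (u, y)) ys)" if "u \<notin> set ys" for ys
        using that by (induction ys) (auto simp: h_def column_weight_def)
      then show ?thesis using g \<open>u < m\<close> by (auto simp: derangement_blocks_def)
    qed
    then show ?thesis by (simp flip: prod.distrib)
  qed
  finally show ?thesis by (simp add: prod_list_columns)
qed

text \<open>Since \<open>column_weight\<close> vanishes on the diagonal at \<open>l = 0\<close>, the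
  given sum lives on \<open>derangement_blocks\<close>. The blocks with prescribed off-diagonal part
  \<open>g\<close> form the fibre \<open>?fib g\<close>; on it the thresholds are constant, so its
  sum is a product over the letters.\<close>

lemma has_sum_blocks_weight:
  assumes t: "0 \<le> t" "t \<le> 1" and x: "\<And>i. 0 \<le> x i" "\<And>i. x i < 1"
    and S: "((\<lambda>xs. prod_list (map (column_weight t x 0) xs)) has_sum S) (biwords m)"
  shows "(blocks_weight t x m has_sum (\<Prod>u<m. 1 / (1 - x u)) * S) (blocks m)"
proof -
  let ?cw = "\<lambda>g. prod_list (map (column_weight t x 0) (block_columns m g))"
  let ?fib = "\<lambda>g. PiE {..<m} (\<lambda>u. {ys. filter (\<lambda>y. y \<noteq> u) ys = g u})"
  have tx: "0 \<le> t * x u" "t * x u < 1" for u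
    using t x[of u] mult_left_le_one_le[of "x u" t] by (auto intro: le_less_trans)
  have nn: "blocks_weight t x m f \<ge> 0" for f
    unfolding blocks_weight_def using tx x t by (intro prod_nonneg ballI block_weight_nonneg) auto
  have "(?cw has_sum S) (blocks m)"
    using S has_sum_reindex_bij_betw[OF bij_betw_columns, of "\<lambda>xs. prod_list (map (column_weight t x 0) xs)"] by simp
  moreover have "?cw g = 0" if "g \<in> blocks m - derangement_blocks m" for g
  proof -
    from that obtain u where "u < m" "u \<in> set (g u)" by (auto simp: derangement_blocks_def)
    then have "(u, u) \<in> set (block_columns m g)" by (simp add: set_columns)
    moreover have "column_weight t x 0 (u, u) = 0" by (simp add: column_weight_def)
    ultimately show ?thesis by (metis image_eqI image_set prod_list_zero_iff)
  qed
  ultimately have "(?cw has_sum S) (derangement_blocks m)"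
    by (subst has_sum_cong_neutral[where T = "blocks m" and g = ?cw]) (auto simp: derangement_blocks_def)
  then have D: "((\<lambda>g. (\<Prod>u<m. 1 / (1 - x u)) * ?cw g) has_sum (\<Prod>u<m. 1 / (1 - x u)) * S) (derangement_blocks m)"
    by (rule has_sum_cmult_right)
  have fib: "(blocks_weight t x m has_sum (\<Prod>u<m. 1 / (1 - x u)) * ?cw g) (?fib g)" if g: "g \<in> derangement_blocks m" for g
  proof -
    let ?bw = "\<lambda>u. block_weight u (\<lambda>i. if i \<le> left_count g u then x u else t * x u) (\<lambda>y. if y < u then t * x y else x y) 0"
    have "((\<lambda>f. \<Prod>u<m. ?bw u (f u)) has_sum
       (\<Prod>u<m. prod_list (map (\<lambda>y. if y < u then t * x y else x y) (g u)) *
            (\<Prod>j\<le>length (g u). 1 / (1 - (if j \<le> left_count g u then x u else t * x u))))) (?fib g)"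
    proof (rule has_sum_prod_PiE_nonneg)
      fix u assume "u \<in> {..<m}"
      then have "u \<notin> set (g u)" using g by (simp add: derangement_blocks_def)
      from has_sum_block_weight[OF _ _ _ this, of "\<lambda>i. if i \<le> left_count g u then x u else t * x u" "\<lambda>y. if y < u then t * x y else x y" 0]
      show "(?bw u has_sum prod_list (map (\<lambda>y. if y < u then t * x y else x y) (g u)) *
            (\<Prod>j\<le>length (g u). 1 / (1 - (if j \<le> left_count g u then x u else t * x u)))) {ys. filter (\<lambda>y. y \<noteq> u) ys = g u}"
        using x tx by simp
    qed (use x tx in \<open>auto intro!: block_weight_nonneg\<close>)
    also have "?this \<longleftrightarrow> (blocks_weight t x m has_sum
       (\<Prod>u<m. prod_list (map (\<lambda>y. if y < u then t * x y else x y) (g u)) *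
            (\<Prod>j\<le>length (g u). 1 / (1 - (if j \<le> left_count g u then x u else t * x u))))) (?fib g)"
    proof (rule has_sum_cong)
      fix f assume f: "f \<in> ?fib g"
      have "left_count f u = left_count g u" if "u < m" for u
        by (rule remove_diagonal(2)[of f m g]) (use f g that in \<open>auto simp: PiE_iff derangement_blocks_def blocks_def\<close>)
      then show "(\<Prod>u<m. ?bw u (f u)) = blocks_weight t x m f" by (simp add: blocks_weight_def)
    qed
    finally show ?thesis unfolding derangement_block_weight[OF g] .
  qed
  have "((\<lambda>p. blocks_weight t x m (snd p)) has_sum (\<Prod>u<m. 1 / (1 - x u)) * S) (Sigma (derangement_blocks m) ?fib)"
    by (rule has_sum_Sigma_nonneg[OF _ D]) (use fib nn in simp_all)
  moreover have bij: "bij_betw (\<lambda>f. (restrict (\<lambda>u. filter (\<lambda>y. y \<noteq> u) (f u)) {..<m}, f)) (blocks m) (Sigma (derangement_blocks m) ?fib)"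
  proof (rule bij_betwI[where g = snd])
    show "(\<lambda>f. (restrict (\<lambda>u. filter (\<lambda>y. y \<noteq> u) (f u)) {..<m}, f)) \<in> blocks m \<rightarrow> Sigma (derangement_blocks m) ?fib"
    proof
      fix f assume f: "f \<in> blocks m"
      then have e: "f \<in> extensional {..<m}" by (auto simp: blocks_def PiE_iff)
      have "restrict (\<lambda>u. filter (\<lambda>y. y \<noteq> u) (f u)) {..<m} \<in> derangement_blocks m"
        using remove_diagonal(1)[OF e, of "restrict (\<lambda>u. filter (\<lambda>y. y \<noteq> u) (f u)) {..<m}"] f by simp
      with e show "(restrict (\<lambda>u. filter (\<lambda>y. y \<noteq> u) (f u)) {..<m}, f) \<in> Sigma (derangement_blocks m) ?fib"
        by (intro SigmaI) (auto simp: PiE_iff)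
    qed
    show "snd \<in> Sigma (derangement_blocks m) ?fib \<rightarrow> blocks m"
    proof
      fix p assume p: "p \<in> Sigma (derangement_blocks m) ?fib"
      have D: "fst p \<in> derangement_blocks m" using p by (cases p) (simp only: mem_Sigma_iff fst_conv)
      have F: "snd p \<in> ?fib (fst p)" using p by (cases p) (simp only: mem_Sigma_iff fst_conv snd_conv)
      have "snd p \<in> extensional {..<m}" "\<And>u. u < m \<Longrightarrow> filter (\<lambda>y. y \<noteq> u) (snd p u) = fst p u"
        using F by (simp_all add: PiE_iff)
      moreover have "fst p \<in> extensional {..<m}" using D by (simp add: derangement_blocks_def blocks_def PiE_iff)
      ultimately show "snd p \<in> blocks m" using remove_diagonal(1)[of "snd p" m "fst p"] D by blast
    qed
    show "(restrict (\<lambda>u. filter (\<lambda>y. y \<noteq> u) (snd p u)) {..<m}, snd p) = p" if "p \<in> Sigma (derangement_blocks m) ?fib" for p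
    proof -
      have D: "fst p \<in> derangement_blocks m" using that by (cases p) (simp only: mem_Sigma_iff fst_conv)
      have F: "snd p \<in> ?fib (fst p)" using that by (cases p) (simp only: mem_Sigma_iff fst_conv snd_conv)
      have "fst p \<in> extensional {..<m}" using D by (simp add: derangement_blocks_def blocks_def PiE_iff)
      with F have "restrict (\<lambda>u. filter (\<lambda>y. y \<noteq> u) (snd p u)) {..<m} = fst p"
        by (intro ext) (auto simp: restrict_def PiE_iff extensional_def)
      then show ?thesis by (simp add: prod_eq_iff)
    qed
  qed auto
  ultimately show ?thesis
    using has_sum_reindex_bij_betw[OF bij, of "\<lambda>p. blocks_weight t x m (snd p)"] by simp
qed

section \<open>Excedances of words\<close>

text \<open>
  With \<open>P b\<close> the number of letters smaller than \<open>b\<close>, stable sorting moves an entry \<open>y\<close> to the left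
  iff more than \<open>P y\<close> entries before it differ from \<open>y\<close>.
\<close>

fun exc_count :: "(nat \<Rightarrow> nat) \<Rightarrow> nat list \<Rightarrow> nat list \<Rightarrow> nat" where
  "exc_count P pre [] = 0"
| "exc_count P pre (y # ys) =
     (if P y < length (filter (\<lambda>z. z \<noteq> y) pre) then 1 else 0) + exc_count P (pre @ [y]) ys"

definition word_exc :: "nat list \<Rightarrow> nat" where
  "word_exc w = exc_count (\<lambda>b. length (filter (\<lambda>z. z < b) w)) [] w"

lemma exc_count_append: "exc_count P pre (ys @ zs) = exc_count P pre ys + exc_count P (pre @ ys) zs"
  by (induction ys arbitrary: pre) auto

lemma length_filter_less_eq_sum: "length (filter (\<lambda>z. z < (b::nat)) w) = (\<Sum>c<b. count_list w c)"
proof (induction w)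
  case (Cons z w)
  have "(\<Sum>c<b. count_list (z # w) c) = (\<Sum>c<b. (if c = z then 1 else 0) + count_list w c)"
    by (intro sum.cong) auto
  also have "\<dots> = (if z < b then 1 else 0) + (\<Sum>c<b. count_list w c)"
    unfolding sum.distrib by (subst sum.delta) auto
  finally show ?case using Cons by simp
qed simp

lemma count_list_concat_upt: "count_list (concat (map f [0..<k])) c = (\<Sum>v<k. count_list (f v) c)"
  by (induction k) auto

lemma length_concat_upt: "length (concat (map f [0..<k])) = (\<Sum>v<k. length (f v))"
  by (induction k) auto

text \<open>A letter smaller than that of its block always moves left, a larger one never does. For
  the letter \<open>k\<close> in its own block, the \<open>P k\<close> entries in front of the block
  contain \<open>left_count f k\<close> copies of \<open>k\<close>, so the test of
  \<open>exc_count\<close> reduces to comparing \<open>left_count f k\<close> with the number of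
  other letters in \<open>ds\<close>.\<close>

lemma blocks_weight_eq_word_weight:
  assumes f: "f \<in> blocks m"
  defines "w \<equiv> concat (map f [0..<m])"
  shows "t ^ word_exc w * prod_list (map x w) = blocks_weight t x m f"
proof -
  define P where "P b = length (filter (\<lambda>z. z < b) w)" for b
  have cnt: "count_list w c = length (f c)" if "c < m" for c
    using f that unfolding w_def count_list_concat_upt by (simp add: blocks_def)
  have P: "P b = (\<Sum>c<b. length (f c))" if "b \<le> m" for b
    unfolding P_def length_filter_less_eq_sum using that by (intro sum.cong) (auto simp: cnt)
  have Pmono: "P b \<le> P b'" if "b \<le> b'" for b b'
    unfolding P_def length_filter_less_eq_sum using that by (intro sum_mono2) auto
  have block: "t ^ exc_count P (concat (map f [0..<k]) @ ds) ys * prod_list (map x ys) =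
      block_weight k (\<lambda>i. if i \<le> left_count f k then x k else t * x k)
      (\<lambda>y. if y < k then t * x y else x y) (length (filter (\<lambda>z. z \<noteq> k) ds)) ys"
    if k: "k < m" and fk: "f k = ds @ ys" for k ds ys
    using fk
  proof (induction ys arbitrary: ds)
    case (Cons y ys)
    let ?pre = "concat (map f [0..<k])"
    have lp: "length ?pre = P k" using P[of k] k by (simp add: length_concat_upt)
    have w: "w = ?pre @ ds @ y # ys @ concat (map f [Suc k..<m])"
    proof -
      have "[0..<m] = [0..<k] @ k # [Suc k..<m]"
        using k upt_add_eq_append[of 0 k "m - k"] by (simp add: upt_conv_Cons)
      then show ?thesis unfolding w_def using Cons.prems by simp
    qed
    have crit: "(P y < length (filter (\<lambda>z. z \<noteq> y) (?pre @ ds))) \<longleftrightarrow>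
      (y < k \<or> y = k \<and> left_count f k < length (filter (\<lambda>z. z \<noteq> k) ds))"
    proof -
      have len: "length (filter (\<lambda>z. z \<noteq> y) (?pre @ ds)) + count_list (?pre @ ds) y = P k + length ds"
        using length_filter_neq[of "?pre @ ds" y] lp by simp
      consider "y < k" | "y = k" | "y > k" by linarith
      then show ?thesis
      proof cases
        case 1
        \<comment> \<open>Strict, because the entry under consideration is an occurrence of
          \<open>y\<close> outside the prefix.\<close>
        have "count_list (?pre @ ds) y < count_list w y" unfolding w by simp
        then have "count_list (?pre @ ds) y < length (f y)" using cnt[of y] 1 k by simp
        moreover have "P y + length (f y) = P (Suc y)" using P[of y] P[of "Suc y"] 1 k by simp
        moreover have "P (Suc y) \<le> P k" using 1 by (intro Pmono) simp
        ultimately have "P y < length (filter (\<lambda>z. z \<noteq> y) (?pre @ ds))" using len by linarith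
        with 1 show ?thesis by simp
      next
        case 2
        have "length ?pre = length (filter (\<lambda>z. z \<noteq> k) ?pre) + left_count f k"
          using length_filter_neq[of ?pre k] by (simp add: count_list_concat_upt left_count_def)
        then show ?thesis using 2 lp by auto
      next
        case 3
        have "length (filter (\<lambda>z. z \<noteq> y) (?pre @ ds)) \<le> P k + length (f k)" using len Cons.prems by simp
        also have "\<dots> = P (Suc k)" using P[of k] P[of "Suc k"] k by simp
        also have "\<dots> \<le> P y" using 3 by (intro Pmono) simp
        finally show ?thesis using 3 by simp
      qed
    qed
    have IH: "t ^ exc_count P (?pre @ ds @ [y]) ys * prod_list (map x ys) =
      block_weight k (\<lambda>i. if i \<le> left_count f k then x k else t * x k)
      (\<lambda>y. if y < k then t * x y else x y) (length (filter (\<lambda>z. z \<noteq> k) (ds @ [y]))) ys"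
      using Cons.IH[of "ds @ [y]"] Cons.prems by simp
    have e: "exc_count P (?pre @ ds) (y # ys) =
      (if y < k \<or> y = k \<and> left_count f k < length (filter (\<lambda>z. z \<noteq> k) ds) then 1 else 0) + exc_count P (?pre @ ds @ [y]) ys"
      unfolding exc_count.simps crit by simp
    show ?case unfolding e power_add using IH
      by (cases "y = k") (auto simp: mult_ac not_le)
  qed simp
  have "t ^ exc_count P [] (concat (map f [0..<k])) * prod_list (map x (concat (map f [0..<k]))) =
     (\<Prod>u<k. block_weight u (\<lambda>i. if i \<le> left_count f u then x u else t * x u)
      (\<lambda>y. if y < u then t * x y else x y) 0 (f u))" if "k \<le> m" for k
    using that
  proof (induction k)
    case (Suc k)
    then show ?case using block[of k "[]" "f k", symmetric] Suc.IH[symmetric]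
      by (simp add: exc_count_append power_add)
  qed simp
  from this[of m] show ?thesis
    unfolding word_exc_def blocks_weight_def w_def P_def by simp
qed

lemma has_sum_words:
  assumes t: "0 \<le> t" "t \<le> 1" and x: "\<And>i. 0 \<le> x i" "\<And>i. x i < 1"
    and s: "2 * (\<Sum>i<m. x i) < 1"
  shows "((\<lambda>w. t ^ word_exc w * prod_list (map x w)) has_sum 1 / elim_iter m t x 1) (lists {..<m})"
    and "elim_iter m t x 1 > 0"
proof -
  from has_sum_biwords[OF t x s] have
    S: "((\<lambda>xs. prod_list (map (column_weight t x 0) xs)) has_sum (\<Prod>i<m. 1 - x i) / elim_iter m t x 1) (biwords m)"
    and p: "elim_iter m t x 1 > 0" by auto
  show "elim_iter m t x 1 > 0" by (rule p)
  have "(\<Prod>u<m. 1 / (1 - x u)) * (\<Prod>i<m. 1 - x i) = (\<Prod>i<m. 1 / (1 - x i) * (1 - x i))"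
    by (simp only: prod.distrib)
  also have "\<dots> = (\<Prod>i<m. 1)" using x by (intro prod.cong) (auto simp: less_le)
  finally have one: "(\<Prod>u<m. 1 / (1 - x u)) * (\<Prod>i<m. 1 - x i) = 1" by simp
  have "(blocks_weight t x m has_sum 1 / elim_iter m t x 1) (blocks m)"
    using has_sum_blocks_weight[OF t x S] unfolding times_divide_eq_right one .
  also have "?this \<longleftrightarrow> ((\<lambda>f. t ^ word_exc (concat (map f [0..<m])) * prod_list (map x (concat (map f [0..<m])))) has_sum 1 / elim_iter m t x 1) (blocks m)"
    by (intro has_sum_cong) (simp only: blocks_weight_eq_word_weight)
  finally show "((\<lambda>w. t ^ word_exc w * prod_list (map x w)) has_sum 1 / elim_iter m t x 1) (lists {..<m})"
    by (subst (asm) has_sum_reindex_bij_betw[OF bij_betw_blocks_words, of "\<lambda>w. t ^ word_exc w * prod_list (map x w)"])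
qed

section \<open>Permutations and words\<close>

text \<open>For \<open>D\<close> the descent set of \<open>s\<close> these are the sorted words
  whose equal letters can be sent to the positions \<open>s 1, s 2, ...\<close> without reversing
  two of them; a descent of \<open>s\<close> between equal letters would do so.\<close>

definition admissible :: "nat \<Rightarrow> nat \<Rightarrow> nat set \<Rightarrow> (nat \<Rightarrow> nat) set" where
  "admissible n m D = {v \<in> {1..n} \<rightarrow>\<^sub>E {..<m}.
     \<forall>i\<in>{1..<n}. v i \<le> v (i + 1) \<and> (i \<in> D \<longrightarrow> v i < v (i + 1))}"

lemma finite_admissible [simp]: "finite (admissible n m D)"
  unfolding admissible_def by (rule finite_subset[of _ "{1..n} \<rightarrow>\<^sub>E {..<m}"]) (auto intro: finite_PiE)

lemma admissible_lex:
  assumes v: "v \<in> admissible n m (descent_set n s)" and s: "s permutes {1..n}" and ab: "1 \<le> a" "a < b" "b \<le> n"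
  shows "v a < v b \<or> v a = v b \<and> s a < s b"
  using ab(2,3)
proof (induction b)
  case (Suc b)
  have step: "v b < v (Suc b) \<or> v b = v (Suc b) \<and> s b < s (Suc b)" if "1 \<le> b"
  proof -
    have b: "b \<in> {1..<n}" using that Suc.prems by auto
    then have "v b \<le> v (b + 1)" "b \<in> descent_set n s \<Longrightarrow> v b < v (b + 1)"
      using v by (auto simp: admissible_def)
    moreover have "s b \<noteq> s (Suc b)" using inj_eq[OF permutes_inj[OF s]] by simp
    ultimately show ?thesis using b by (cases "s b < s (Suc b)") (auto simp: descent_set_def)
  qed
  show ?case
  proof (cases "a = b")
    case True then show ?thesis using step ab by simp
  next
    case False
    then show ?thesis using Suc step ab by auto
  qed
qed simp

text \<open>Standardization: the place of position \<open>j\<close> after stable sorting. The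
  identity outside \<open>{1..n}\<close> makes it a permutation in the sense of
  \<open>permutes\<close>.\<close>

definition std_rank :: "nat \<Rightarrow> (nat \<Rightarrow> nat) \<Rightarrow> nat \<Rightarrow> nat" where
  "std_rank n W j = (if j \<in> {1..n} then card {i \<in> {1..n}. W i < W j \<or> W i = W j \<and> i \<le> j} else j)"

text \<open>By \<open>admissible_lex\<close> the positions \<open>s 1, s 2, ...\<close> list the
  word in stable sorted order, so exactly \<open>s 1, ..., s a\<close> rank no higher than position
  \<open>s a\<close>.\<close>

lemma std_rank_admissible:
  assumes v: "v \<in> admissible n m (descent_set n s)" and s: "s permutes {1..n}"
    and W: "\<And>j. j \<in> {1..n} \<Longrightarrow> W j = v (inv s j)"
  shows "std_rank n W = inv s"
proof
  fix j
  show "std_rank n W j = inv s j"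
  proof (cases "j \<in> {1..n}")
    case False
    then show ?thesis using permutes_not_in[OF permutes_inv[OF s] False] by (simp only: std_rank_def if_False)
  next
    case True
    define a where "a = inv s j"
    have sa: "s a = j" unfolding a_def using permutes_inverses(1)[OF s] by simp
    have a: "a \<in> {1..n}" unfolding a_def using True permutes_in_image[OF permutes_inv[OF s]] by blast
    have Ws: "W (s c) = v c" if "c \<in> {1..n}" for c
      using W[of "s c"] permutes_in_image[OF s, of c] that permutes_inverses(2)[OF s] by simp
    have "{i \<in> {1..n}. W i < W j \<or> W i = W j \<and> i \<le> j} = s ` {1..a}"
    proof (intro equalityI subsetI)
      fix i assume i: "i \<in> {i \<in> {1..n}. W i < W j \<or> W i = W j \<and> i \<le> j}"
      define c where "c = inv s i"
      have c: "s c = i" "c \<in> {1..n}" unfolding c_def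
        using permutes_inverses(1)[OF s] i permutes_in_image[OF permutes_inv[OF s], of i] by auto
      have "c \<le> a"
      proof (rule ccontr)
        assume "\<not> c \<le> a"
        then have "v a < v c \<or> v a = v c \<and> s a < s c" using admissible_lex[OF v s, of a c] c a by simp
        moreover have "v c < v a \<or> v c = v a \<and> i \<le> j"
          using i Ws[OF c(2)] Ws[OF a] unfolding c(1) sa by simp
        ultimately show False unfolding c(1) sa by linarith
      qed
      with c show "i \<in> s ` {1..a}" by auto
    next
      fix i assume "i \<in> s ` {1..a}"
      then obtain c where c: "i = s c" "1 \<le> c" "c \<le> a" by auto
      then have cn: "c \<in> {1..n}" using a by auto
      have "i \<in> {1..n}" using permutes_in_image[OF s] cn c by auto
      moreover have "c = a \<or> (v c < v a \<or> v c = v a \<and> s c < s a)"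
        using c a admissible_lex[OF v s, of c a] by (cases "c = a") simp_all
      ultimately show "i \<in> {i \<in> {1..n}. W i < W j \<or> W i = W j \<and> i \<le> j}"
        using Ws[OF cn] Ws[OF a] sa unfolding c(1) by auto
    qed
    then have "std_rank n W j = card (s ` {1..a})" using True by (simp add: std_rank_def)
    also have "\<dots> = a" using permutes_inj_on[OF s] by (simp add: card_image)
    finally show ?thesis by (simp add: a_def)
  qed
qed

lemma std_rank_less:
  assumes "i \<in> {1..n}" "j \<in> {1..n}" "W i < W j \<or> W i = W j \<and> i < j"
  shows "std_rank n W i < std_rank n W j"
proof -
  have "{k \<in> {1..n}. W k < W i \<or> W k = W i \<and> k \<le> i} \<subset> {k \<in> {1..n}. W k < W j \<or> W k = W j \<and> k \<le> j}"
    using assms by (auto simp: psubset_eq)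
  then show ?thesis using assms by (simp add: std_rank_def psubset_card_mono)
qed

lemma std_rank_permutes: "std_rank n W permutes {1..n}"
proof (rule bij_imp_permutes)
  have "inj_on (std_rank n W) {1..n}"
  proof (rule inj_onI)
    fix i j assume ij: "i \<in> {1..n}" "j \<in> {1..n}" "std_rank n W i = std_rank n W j"
    consider "W i < W j \<or> W i = W j \<and> i < j" | "W j < W i \<or> W j = W i \<and> j < i" | "i = j" by fastforce
    then show "i = j"
      using ij std_rank_less[of i n j W] std_rank_less[of j n i W] by cases auto
  qed
  moreover have "std_rank n W ` {1..n} \<subseteq> {1..n}"
  proof
    fix k assume "k \<in> std_rank n W ` {1..n}"
    then obtain j where j: "j \<in> {1..n}" "k = std_rank n W j" by auto
    let ?S = "{i \<in> {1..n}. W i < W j \<or> W i = W j \<and> i \<le> j}"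
    have "j \<in> ?S" using j by simp
    then have "card ?S > 0" by (subst card_gt_0_iff) auto
    moreover have "card ?S \<le> card {1..n}" by (intro card_mono) auto
    ultimately show "k \<in> {1..n}" using j by (simp add: std_rank_def)
  qed
  ultimately show "bij_betw (std_rank n W) {1..n} {1..n}"
    by (simp add: bij_betw_def endo_inj_surj)
qed (auto simp: std_rank_def)

definition perm_word :: "nat \<Rightarrow> (nat \<Rightarrow> nat) \<Rightarrow> (nat \<Rightarrow> nat) \<Rightarrow> nat list" where
  "perm_word n s v = map (\<lambda>j. v (inv s j)) [1..<Suc n]"

text \<open>The inverse map takes \<open>s\<close> as the inverse of the standardization and
  \<open>v\<close> as the sorted word. Strictness of \<open>v\<close> at the descents of
  \<open>s\<close> is exactly what makes the standardization return \<open>inv s\<close>.\<close>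

lemma bij_betw_perm_word:
  "bij_betw (\<lambda>(s, v). perm_word n s v) (Sigma (sym_grp n) (\<lambda>s. admissible n m (descent_set n s)))
     {w \<in> lists {..<m}. length w = n}"
  unfolding bij_betw_def
proof
  show "inj_on (\<lambda>(s, v). perm_word n s v) (Sigma (sym_grp n) (\<lambda>s. admissible n m (descent_set n s)))"
  proof (rule inj_onI, clarify)
    fix s v s' v' assume *: "s \<in> sym_grp n" "s' \<in> sym_grp n" "v \<in> admissible n m (descent_set n s)"
      "v' \<in> admissible n m (descent_set n s')" and eq: "perm_word n s v = perm_word n s' v'"
    have s: "s permutes {1..n}" "s' permutes {1..n}" using * by (auto simp: sym_grp_def)
    have W: "v (inv s j) = v' (inv s' j)" if "j \<in> {1..n}" for j
      using eq that unfolding perm_word_def map_eq_conv by (simp del: upt_Suc)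
    have "inv s = inv s'"
      using std_rank_admissible[OF *(3) s(1), of "\<lambda>j. v (inv s j)"] std_rank_admissible[OF *(4) s(2), of "\<lambda>j. v (inv s j)"] W
      by simp
    then have ss: "s = s'" using s permutes_inv_inv by metis
    have "v i = v' i" if "i \<in> {1..n}" for i
      using W[of "s i"] permutes_in_image[OF s(1), of i] that permutes_inverses(2)[OF s(1)] ss by simp
    then have "v = v'" using *(3,4) by (intro PiE_ext[of v "{1..n}" "\<lambda>_. {..<m}" v']) (auto simp: admissible_def)
    with ss show "s = s' \<and> v = v'" by simp
  qed
  show "(\<lambda>(s, v). perm_word n s v) ` (Sigma (sym_grp n) (\<lambda>s. admissible n m (descent_set n s))) = {w \<in> lists {..<m}. length w = n}"
  proof (intro equalityI subsetI)
    fix w assume "w \<in> (\<lambda>(s, v). perm_word n s v) ` (Sigma (sym_grp n) (\<lambda>s. admissible n m (descent_set n s)))"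
    then obtain s v where w: "w = perm_word n s v" and s: "s permutes {1..n}" and v: "v \<in> admissible n m (descent_set n s)"
      by (auto simp: sym_grp_def)
    have "v (inv s j) < m" if "j \<in> {1..n}" for j
    proof -
      have "inv s j \<in> {1..n}" using permutes_in_image[OF permutes_inv[OF s], of j] that by blast
      with v show ?thesis by (auto simp: admissible_def PiE_iff)
    qed
    then show "w \<in> {w \<in> lists {..<m}. length w = n}" by (auto simp: w perm_word_def)
  next
    fix w assume w: "w \<in> {w \<in> lists {..<m}. length w = n}"
    define W where "W j = w ! (j - 1)" for j
    define s where "s = inv (std_rank n W)"
    define v where "v = restrict (\<lambda>i. W (s i)) {1..n}"
    have p: "std_rank n W permutes {1..n}" by (rule std_rank_permutes)
    have s: "s permutes {1..n}" unfolding s_def by (rule permutes_inv[OF p])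
    have inv_s: "inv s = std_rank n W" unfolding s_def using permutes_inv_inv[OF p] .
    have sin: "s i \<in> {1..n}" if "i \<in> {1..n}" for i using permutes_in_image[OF s, of i] that by blast
    have rs: "std_rank n W (s i) = i" for i unfolding s_def using permutes_inverses(1)[OF p] .
    have Wm: "W j < m" if "j \<in> {1..n}" for j
    proof -
      have "w ! (j - 1) \<in> set w" using w that by (intro nth_mem) auto
      then show ?thesis using w by (auto simp: W_def)
    qed
    have "v \<in> admissible n m (descent_set n s)"
      unfolding admissible_def
    proof (intro CollectI conjI ballI)
      show "v \<in> {1..n} \<rightarrow>\<^sub>E {..<m}" using sin Wm by (auto simp: v_def)
      fix i assume i: "i \<in> {1..<n}"
      then have in': "i \<in> {1..n}" "i + 1 \<in> {1..n}" by auto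
      have "\<not> (W (s (i + 1)) < W (s i) \<or> W (s (i + 1)) = W (s i) \<and> s (i + 1) < s i)"
        using std_rank_less[OF sin[OF in'(2)] sin[OF in'(1)], of W] rs by auto
      then have "W (s i) < W (s (i + 1)) \<or> W (s i) = W (s (i + 1)) \<and> s i \<le> s (i + 1)" by linarith
      then show "v i \<le> v (i + 1)" "i \<in> descent_set n s \<longrightarrow> v i < v (i + 1)"
        using in' i by (auto simp: v_def descent_set_def)
    qed
    moreover have "perm_word n s v = w"
    proof (rule nth_equalityI)
      show "length (perm_word n s v) = length w" using w by (simp add: perm_word_def del: upt_Suc)
      fix k assume "k < length (perm_word n s v)"
      then have k: "k < n" by (simp add: perm_word_def del: upt_Suc)
      have "inv s (Suc k) \<in> {1..n}" using permutes_in_image[OF permutes_inv[OF s], of "Suc k"] k by simp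
      then show "perm_word n s v ! k = w ! k"
        using k permutes_inverses(1)[OF s] by (simp add: perm_word_def v_def W_def nth_append del: upt_Suc)
    qed
    ultimately show "w \<in> (\<lambda>(s, v). perm_word n s v) ` (Sigma (sym_grp n) (\<lambda>s. admissible n m (descent_set n s)))"
      using s by (intro image_eqI[of _ _ "(s, v)"]) (auto simp: sym_grp_def)
  qed
qed

lemma exc_count_map_upt:
  "exc_count P [] (map W [1..<Suc n]) =
     card {j \<in> {1..n}. P (W j) < length (filter (\<lambda>z. z \<noteq> W j) (map W [1..<j]))}"
proof (induction n)
  case (Suc n)
  have c: "card {j \<in> {1..Suc n}. Q j} = card {j \<in> {1..n}. Q j} + (if Q (Suc n) then 1 else 0)" for Q
  proof -
    have "{j \<in> {1..Suc n}. Q j} = {j \<in> {1..n}. Q j} \<union> (if Q (Suc n) then {Suc n} else {})"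
      by (auto simp: le_Suc_eq)
    also have "card \<dots> = card {j \<in> {1..n}. Q j} + (if Q (Suc n) then 1 else 0)"
      by (subst card_Un_disjoint) auto
    finally show ?thesis .
  qed
  have "map W [1..<Suc (Suc n)] = map W [1..<Suc n] @ [W (Suc n)]" by simp
  then show ?case unfolding c by (simp only: exc_count_append Suc.IH exc_count.simps append_Nil)
qed simp

lemma length_filter_map_upt: "length (filter Q (map W [a..<b])) = card {i \<in> {a..<b}. Q (W i)}"
proof -
  have "length (filter Q (map W [a..<b])) = length (filter (\<lambda>i. Q (W i)) [a..<b])"
    by (simp add: filter_map o_def)
  also have "\<dots> = card ({i. Q (W i)} \<inter> set [a..<b])" by (intro distinct_length_filter) simp
  also have "{i. Q (W i)} \<inter> set [a..<b] = {i \<in> {a..<b}. Q (W i)}" by auto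
  finally show ?thesis .
qed

text \<open>The excedances of the word are the positions \<open>j\<close> with
  \<open>inv s j < j\<close>; substituting \<open>j = s i\<close> turns them into excedances of
  \<open>s\<close>.\<close>

lemma word_exc_perm_word:
  assumes s: "s \<in> sym_grp n" and v: "v \<in> admissible n m (descent_set n s)"
  shows "word_exc (perm_word n s v) = exc n s"
proof -
  have p: "s permutes {1..n}" using s by (simp add: sym_grp_def)
  define W where "W j = v (inv s j)" for j
  have inv_s: "std_rank n W = inv s" by (rule std_rank_admissible[OF v p]) (simp add: W_def)
  have pw: "perm_word n s v = map W [1..<Suc n]" by (simp add: perm_word_def W_def)
  \<comment> \<open>The rank of \<open>j\<close> is \<open>card ?A + card ?B\<close>, and
    \<open>j\<close> itself is \<open>card ?B + card ?C\<close>. The test in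
    \<open>exc_count\<close> compares what is left after cancelling \<open>?B\<close>.\<close>
  have crit: "length (filter (\<lambda>z. z < W j) (map W [1..<Suc n])) < length (filter (\<lambda>z. z \<noteq> W j) (map W [1..<j]))
     \<longleftrightarrow> inv s j < j" if j: "j \<in> {1..n}" for j
  proof -
    let ?A = "{i \<in> {1..<Suc n}. W i < W j}" and ?B = "{i \<in> {1..j}. W i = W j}" and ?C = "{i \<in> {1..<j}. W i \<noteq> W j}"
    have "{i \<in> {1..n}. W i < W j \<or> W i = W j \<and> i \<le> j} = ?A \<union> ?B" using j by auto
    then have "inv s j = card (?A \<union> ?B)" using j by (simp add: std_rank_def flip: inv_s)
    also have "\<dots> = card ?A + card ?B" by (intro card_Un_disjoint) auto
    finally have 1: "inv s j = card ?A + card ?B" .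
    have "{1..j} = ?B \<union> ?C" using j by (auto simp: le_less)
    then have "j = card (?B \<union> ?C)" by (metis card_atLeastAtMost diff_Suc_1)
    also have "\<dots> = card ?B + card ?C" by (intro card_Un_disjoint) auto
    finally have 2: "j = card ?B + card ?C" .
    show ?thesis unfolding length_filter_map_upt using 1 2 by linarith
  qed
  have "word_exc (perm_word n s v) = card {j \<in> {1..n}. inv s j < j}"
    unfolding word_exc_def pw exc_count_map_upt by (intro arg_cong[where f = card]) (use crit in blast)
  also have "{j \<in> {1..n}. inv s j < j} = s ` {i \<in> {1..n}. s i > i}"
  proof (intro equalityI subsetI)
    fix j assume j: "j \<in> {j \<in> {1..n}. inv s j < j}"
    have "inv s j \<in> {1..n}" using permutes_in_image[OF permutes_inv[OF p], of j] j by blast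
    then show "j \<in> s ` {i \<in> {1..n}. s i > i}"
      using j permutes_inverses(1)[OF p] by (intro image_eqI[of _ _ "inv s j"]) auto
  next
    fix j assume "j \<in> s ` {i \<in> {1..n}. s i > i}"
    then show "j \<in> {j \<in> {1..n}. inv s j < j}"
      using permutes_inverses(2)[OF p] permutes_in_image[OF p] by auto
  qed
  also have "card \<dots> = exc n s" unfolding exc_def by (intro card_image) (rule permutes_inj_on[OF p])
  finally show ?thesis .
qed

lemma prod_list_perm_word:
  assumes s: "s \<in> sym_grp n"
  shows "prod_list (map x (perm_word n s v)) = (\<Prod>i\<in>{1..n}. x (v i) :: real)"
proof -
  have p: "inv s permutes {1..n}" using s by (simp add: sym_grp_def permutes_inv)
  have "prod_list (map x (perm_word n s v)) = (\<Prod>j\<in>set [1..<Suc n]. x (v (inv s j)))"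
    unfolding perm_word_def by (subst prod.distinct_set_conv_list) (simp_all add: o_def del: upt_Suc)
  also have "set [1..<Suc n] = {1..n}" by auto
  also have "(\<Prod>j\<in>{1..n}. x (v (inv s j))) = (\<Prod>i\<in>{1..n}. x (v i))"
    using prod.permute[OF p, of "\<lambda>i. x (v i)"] by (simp add: o_def)
  finally show ?thesis .
qed

lemma finite_sym_grp [simp]: "finite (sym_grp n)"
  unfolding sym_grp_def by (intro finite_permutations) simp

lemma sum_words_eq_sum_perms:
  fixes t :: real
  shows "(\<Sum>w | w \<in> lists {..<m} \<and> length w = n. t ^ word_exc w * prod_list (map x w)) =
    (\<Sum>s\<in>sym_grp n. t ^ exc n s * (\<Sum>v\<in>admissible n m (descent_set n s). \<Prod>i\<in>{1..n}. x (v i)))"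
proof -
  have "(\<Sum>w | w \<in> lists {..<m} \<and> length w = n. t ^ word_exc w * prod_list (map x w)) =
    (\<Sum>(s, v)\<in>Sigma (sym_grp n) (\<lambda>s. admissible n m (descent_set n s)). t ^ exc n s * (\<Prod>i\<in>{1..n}. x (v i)))"
    by (subst sum.reindex_bij_betw[OF bij_betw_perm_word, symmetric])
       (auto intro!: sum.cong simp: word_exc_perm_word prod_list_perm_word)
  then show ?thesis by (simp add: sum.Sigma sum_distrib_left)
qed

section \<open>Sums over monotone sequences and their product formula\<close>

lemma admissible_mono:
  assumes v: "v \<in> admissible n m D" and ab: "1 \<le> a" "a \<le> b" "b \<le> n"
  shows "v a \<le> v b"
  using ab(2,3)
proof (induction b rule: dec_induct)
  case (step b)
  then have "v b \<le> v (b + 1)" using v ab by (auto simp: admissible_def)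
  with step show ?case by simp
qed simp

text \<open>The complete homogeneous symmetric polynomial of degree \<open>n\<close> at \<open>1, q, \<dots>, q^(M-1)\<close>.\<close>

definition hcoef :: "real \<Rightarrow> nat \<Rightarrow> nat \<Rightarrow> real" where
  "hcoef q n M = (\<Sum>v\<in>admissible n M {}. q ^ (\<Sum>i\<in>{1..n}. M - 1 - v i))"

lemma hcoef_0 [simp]: "hcoef q 0 M = 1"
proof -
  have "admissible 0 M {} = {\<lambda>_. undefined}" by (auto simp: admissible_def)
  then show ?thesis by (simp add: hcoef_def)
qed

lemma hcoef_Suc_0 [simp]: "hcoef q (Suc n) 0 = 0"
proof -
  have "admissible (Suc n) 0 {} = {}" by (auto simp: admissible_def PiE_eq_empty_iff)
  then show ?thesis by (simp add: hcoef_def)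
qed

text \<open>If the last entry is the largest value \<open>M\<close>, it has exponent 0 and is
  dropped. Otherwise all values are below \<open>M\<close>, and measuring exponents against
  \<open>M\<close> values instead of \<open>Suc M\<close> saves one unit for each of the
  \<open>Suc n\<close> entries.\<close>

lemma hcoef_Suc_Suc: "hcoef q (Suc n) (Suc M) = hcoef q n (Suc M) + q ^ Suc n * hcoef q (Suc n) M"
proof -
  let ?e = "\<lambda>v. q ^ (\<Sum>i\<in>{1..Suc n}. Suc M - 1 - v i)"
  define A where "A = {v \<in> admissible (Suc n) (Suc M) {}. v (Suc n) = M}"
  have lt: "v i < Suc M" if "v \<in> admissible (Suc n) (Suc M) {}" "i \<in> {1..Suc n}" for v i
    using that by (auto simp: admissible_def PiE_iff)
  have split: "admissible (Suc n) (Suc M) {} = A \<union> admissible (Suc n) M {}"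
  proof (intro equalityI subsetI)
    fix v assume v: "v \<in> admissible (Suc n) (Suc M) {}"
    show "v \<in> A \<union> admissible (Suc n) M {}"
    proof (cases "v (Suc n) = M")
      case False
      then have "v (Suc n) < M" using lt[OF v, of "Suc n"] by simp
      then have "v i < M" if "i \<in> {1..Suc n}" for i
        using admissible_mono[OF v, of i "Suc n"] that by simp
      then show ?thesis using v by (auto simp: admissible_def PiE_iff)
    qed (use v in \<open>simp add: A_def\<close>)
  next
    fix v assume "v \<in> A \<union> admissible (Suc n) M {}"
    then show "v \<in> admissible (Suc n) (Suc M) {}"
      by (auto simp: A_def admissible_def PiE_iff less_Suc_eq)
  qed
  have "hcoef q (Suc n) (Suc M) = sum ?e A + sum ?e (admissible (Suc n) M {})"
    unfolding hcoef_def split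
  proof (rule sum.union_disjoint)
    show "finite A" by (simp add: A_def)
    show "A \<inter> admissible (Suc n) M {} = {}" by (auto simp: A_def admissible_def PiE_iff)
  qed simp
  also have "sum ?e A = hcoef q n (Suc M)"
    unfolding hcoef_def
  proof (rule sum.reindex_bij_witness[where i = "\<lambda>u. u(Suc n := M)" and j = "\<lambda>v. restrict v {1..n}"])
    fix v assume v: "v \<in> A"
    then have ext: "v \<in> extensional {1..Suc n}" and vn: "v (Suc n) = M"
      by (auto simp: A_def admissible_def PiE_iff)
    show "(restrict v {1..n})(Suc n := M) = v"
      using ext vn by (auto simp: fun_eq_iff restrict_def extensional_def)
    show "restrict v {1..n} \<in> admissible n (Suc M) {}"
      using v by (auto simp: A_def admissible_def)
    show "q ^ (\<Sum>i\<in>{1..n}. Suc M - 1 - restrict v {1..n} i) = ?e v"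
      using vn by (simp)
  next
    fix u assume u: "u \<in> admissible n (Suc M) {}"
    have ext: "u \<in> extensional {1..n}" and um: "\<And>i. i \<in> {1..n} \<Longrightarrow> u i \<le> M"
      using u by (auto simp: admissible_def PiE_iff less_Suc_eq_le)
    show "restrict (u(Suc n := M)) {1..n} = u"
      using ext by (auto simp: fun_eq_iff restrict_def extensional_def)
    have "u(Suc n := M) \<in> {1..Suc n} \<rightarrow>\<^sub>E {..<Suc M}"
      using um ext by (auto simp: PiE_iff extensional_def less_Suc_eq_le)
    moreover have "(u(Suc n := M)) i \<le> (u(Suc n := M)) (i + 1)" if "i \<in> {1..<Suc n}" for i
    proof (cases "i = n")
      case True then show ?thesis using that um by auto
    next
      case False then show ?thesis using that u by (auto simp: admissible_def)
    qed
    ultimately show "u(Suc n := M) \<in> A" by (simp add: A_def admissible_def)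
  qed
  also have "sum ?e (admissible (Suc n) M {}) = q ^ Suc n * hcoef q (Suc n) M"
    unfolding hcoef_def sum_distrib_left
  proof (rule sum.cong)
    fix v assume v: "v \<in> admissible (Suc n) M {}"
    have "(\<Sum>i\<in>{1..Suc n}. Suc M - 1 - v i) = (\<Sum>i\<in>{1..Suc n}. 1 + (M - 1 - v i))"
    proof (rule sum.cong)
      fix i assume "i \<in> {1..Suc n}"
      then have "v i < M" using v by (auto simp: admissible_def PiE_iff)
      then show "Suc M - 1 - v i = 1 + (M - 1 - v i)" by simp
    qed simp
    also have "\<dots> = Suc n + (\<Sum>i\<in>{1..Suc n}. M - 1 - v i)" by (simp only: sum.distrib) simp
    finally show "?e v = q ^ Suc n * q ^ (\<Sum>i\<in>{1..Suc n}. M - 1 - v i)" by (simp only: power_add)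
  qed simp
  finally show ?thesis .
qed

definition qpoch :: "'a::comm_ring_1 \<Rightarrow> nat \<Rightarrow> 'a" where
  "qpoch q n = (\<Prod>i<n. 1 - q ^ Suc i)"

lemma qpoch_Suc: "qpoch q (Suc n) = qpoch q n * (1 - q ^ Suc n)"
  by (simp add: qpoch_def)

lemma qpoch_pos: "0 < q \<Longrightarrow> q < 1 \<Longrightarrow> qpoch (q::real) n > 0"
  unfolding qpoch_def using power_Suc_less_one[of q] by (intro prod_pos) auto

text \<open>This is the product formula for a Gaussian binomial coefficient, cleared of
  denominators. The nested induction follows the two terms of \<open>hcoef_Suc_Suc\<close>.\<close>

lemma hcoef_mult_qpoch: "hcoef q n M * qpoch q n = (\<Prod>i<n. 1 - q ^ (M + i))"
proof (induction n arbitrary: M)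
  case 0
  then show ?case by (simp add: qpoch_def)
next
  case (Suc n)
  note IHn = Suc.IH
  show ?case
  proof (induction M)
    case 0
    have "(\<Prod>i<Suc n. 1 - q ^ (0 + i)) = 0" by (intro prod_zero bexI[of _ 0]) auto
    then show ?case by simp
  next
    case (Suc M)
    define R where "R = (\<Prod>i<n. 1 - q ^ (Suc M + i))"
    have R1: "(\<Prod>i<Suc n. 1 - q ^ (M + i)) = (1 - q ^ M) * R"
      unfolding R_def by (subst prod.lessThan_Suc_shift) simp
    have "hcoef q (Suc n) (Suc M) * qpoch q (Suc n) =
      hcoef q n (Suc M) * qpoch q n * (1 - q ^ Suc n) + q ^ Suc n * (hcoef q (Suc n) M * qpoch q (Suc n))"
      by (simp add: hcoef_Suc_Suc qpoch_Suc algebra_simps)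
    also have "\<dots> = R * (1 - q ^ Suc n) + q ^ Suc n * ((1 - q ^ M) * R)"
      unfolding IHn Suc.IH R1 R_def ..
    also have "\<dots> = R * (1 - q ^ (Suc M + n))" by (simp add: algebra_simps power_add)
    finally show ?case by (simp add: R_def)
  qed
qed

text \<open>Subtracting from \<open>v i\<close> the number \<open>d i\<close> of forced jumps before
  \<open>i\<close> leaves a weakly increasing sequence with \<open>m - card D\<close> possible
  values. A forced jump at \<open>j\<close> costs one unit of exponent at each of the positions
  \<open>1, ..., j\<close>, altogether the sum of \<open>D\<close>.\<close>

lemma sum_admissible:
  assumes D: "D \<subseteq> {1..<n}" and m: "card D < m"
  shows "(\<Sum>v\<in>admissible n m D. q ^ (\<Sum>i\<in>{1..n}. m - 1 - v i)) = q ^ (\<Sum>i\<in>D. i) * hcoef q n (m - card D)"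
proof -
  have fin: "finite D" using D finite_subset by blast
  define d where "d i = card {j \<in> D. j < i}" for i
  define c where "c = card D"
  have d1: "d (Suc 0) = 0" using D by (auto simp: d_def card_eq_0_iff)
  have dS: "d (Suc i) = d i + (if i \<in> D then 1 else 0)" for i
  proof -
    have "{j \<in> D. j < Suc i} = {j \<in> D. j < i} \<union> (if i \<in> D then {i} else {})" by (auto simp: less_Suc_eq)
    then show ?thesis unfolding d_def using fin by (simp add: card_Un_disjoint)
  qed
  have dc: "d i \<le> c" for i unfolding d_def c_def using fin by (intro card_mono) auto
  have dn: "d n = c" unfolding d_def c_def using D by (intro arg_cong[where f = card]) auto
  have maj: "(\<Sum>i\<in>{1..n}. c - d i) = (\<Sum>i\<in>D. i)"
  proof -
    have "c - d i = (\<Sum>j\<in>D. if i \<le> j then 1 else 0)" for i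
    proof -
      have "D = {j \<in> D. j < i} \<union> {j \<in> D. i \<le> j}" by auto
      then have "c = card ({j \<in> D. j < i} \<union> {j \<in> D. i \<le> j})" by (simp add: c_def)
      also have "\<dots> = d i + card {j \<in> D. i \<le> j}" unfolding d_def using fin by (intro card_Un_disjoint) auto
      finally have "c - d i = card {j \<in> D. i \<le> j}" by simp
      also have "\<dots> = (\<Sum>j\<in>D. if i \<le> j then 1 else 0)" using fin by (simp flip: sum.inter_filter)
      finally show ?thesis .
    qed
    then have "(\<Sum>i\<in>{1..n}. c - d i) = (\<Sum>i\<in>{1..n}. \<Sum>j\<in>D. if i \<le> j then 1 else 0)" by simp
    also have "\<dots> = (\<Sum>j\<in>D. \<Sum>i\<in>{1..n}. if i \<le> j then 1 else 0)" by (rule sum.swap)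
    also have "\<dots> = (\<Sum>j\<in>D. j)"
    proof (rule sum.cong)
      fix j assume "j \<in> D"
      then have "{i \<in> {1..n}. i \<le> j} = {1..j}" using D by auto
      then show "(\<Sum>i\<in>{1..n}. if i \<le> j then 1 else 0) = j" by (simp flip: sum.inter_filter)
    qed simp
    finally show ?thesis .
  qed
  have ge: "d i \<le> v i" if v: "v \<in> admissible n m D" and i: "1 \<le> i" "i \<le> n" for v i
    using i
  proof (induction i rule: dec_induct)
    case base then show ?case using d1 by simp
  next
    case (step i)
    then have "v i \<le> v (i + 1) \<and> (i \<in> D \<longrightarrow> v i < v (i + 1))" using v by (auto simp: admissible_def)
    with step show ?case by (auto simp: dS)
  qed
  show ?thesis
    unfolding hcoef_def sum_distrib_left
  proof (rule sum.reindex_bij_witness[where i = "\<lambda>l. restrict (\<lambda>i. l i + d i) {1..n}"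
        and j = "\<lambda>v. restrict (\<lambda>i. v i - d i) {1..n}"])
    fix v assume v: "v \<in> admissible n m D"
    have ext: "v \<in> extensional {1..n}" using v by (auto simp: admissible_def PiE_iff)
    show "restrict (\<lambda>i. restrict (\<lambda>i. v i - d i) {1..n} i + d i) {1..n} = v"
      using ext ge[OF v] by (auto simp: fun_eq_iff restrict_def extensional_def)
    have step: "v i - d i \<le> v (Suc i) - d (Suc i)" if "i \<in> {1..<n}" for i
    proof -
      have "v i \<le> v (i + 1) \<and> (i \<in> D \<longrightarrow> v i < v (i + 1))" using v that by (auto simp: admissible_def)
      then show ?thesis by (auto simp: dS)
    qed
    have mono: "v i - d i \<le> v n - d n" if "i \<in> {1..n}" for i
    proof -
      have "i \<le> n" using that by simp
      then show ?thesis
      proof (induction rule: inc_induct)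
        case (step k)
        have "k \<in> {1..<n}" using step that by auto
        then show ?case using \<open>\<And>i. i \<in> {1..<n} \<Longrightarrow> v i - d i \<le> v (Suc i) - d (Suc i)\<close>[of k] step by simp
      qed simp
    qed
    have lt: "v i - d i < m - c" if i: "i \<in> {1..n}" for i
    proof -
      have "v n < m" using v i by (auto simp: admissible_def PiE_iff)
      then have "v n - d n < m - c" using dn m c_def by simp
      then show ?thesis using mono[OF i] by simp
    qed
    show "restrict (\<lambda>i. v i - d i) {1..n} \<in> admissible n (m - card D) {}"
      unfolding admissible_def using lt step by (auto simp: c_def)
    \<comment> \<open>The exponent splits into the \<open>c - d i\<close> forced jumps still to come
      and the exponent of the reduced sequence.\<close>
    have "(\<Sum>i\<in>{1..n}. m - 1 - v i) = (\<Sum>i\<in>{1..n}. (c - d i) + (m - c - 1 - (v i - d i)))"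
    proof (rule sum.cong)
      fix i assume i: "i \<in> {1..n}"
      then have "d i \<le> v i" using ge[OF v] by simp
      then show "m - 1 - v i = (c - d i) + (m - c - 1 - (v i - d i))" using lt[OF i] dc[of i] by simp
    qed simp
    then have "(\<Sum>i\<in>{1..n}. m - 1 - v i) = (\<Sum>i\<in>D. i) + (\<Sum>i\<in>{1..n}. m - c - 1 - (v i - d i))"
      by (simp only: sum.distrib maj)
    then show "q ^ (\<Sum>i\<in>D. i) * q ^ (\<Sum>i\<in>{1..n}. m - card D - 1 - restrict (\<lambda>i. v i - d i) {1..n} i) =
        q ^ (\<Sum>i\<in>{1..n}. m - 1 - v i)" by (simp add: power_add c_def)
  next
    fix l assume l: "l \<in> admissible n (m - card D) {}"
    have ext: "l \<in> extensional {1..n}" using l by (auto simp: admissible_def PiE_iff)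
    show "restrict (\<lambda>i. restrict (\<lambda>i. l i + d i) {1..n} i - d i) {1..n} = l"
      using ext by (auto simp: fun_eq_iff restrict_def extensional_def)
    have "l i + d i < m" if i: "i \<in> {1..n}" for i
    proof -
      have "l i < m - c" using l i by (auto simp: admissible_def PiE_iff c_def)
      then show ?thesis using dc[of i] by simp
    qed
    moreover have "l i + d i \<le> l (Suc i) + d (Suc i)" "i \<in> D \<Longrightarrow> l i + d i < l (Suc i) + d (Suc i)"
      if "i \<in> {1..<n}" for i
    proof -
      have "l i \<le> l (Suc i)" using l that by (auto simp: admissible_def)
      then show "l i + d i \<le> l (Suc i) + d (Suc i)" "i \<in> D \<Longrightarrow> l i + d i < l (Suc i) + d (Suc i)"
        by (auto simp: dS)
    qed
    ultimately show "restrict (\<lambda>i. l i + d i) {1..n} \<in> admissible n m D"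
      unfolding admissible_def by auto
  qed
qed

section \<open>The generating function of excedances and major index\<close>

text \<open>The coefficient of \<open>z ^ n\<close> in the sum over words in \<open>m\<close>
  letters, rewritten over permutations by \<open>sum_words_eq_sum_perms\<close>.\<close>

definition trunc_sum :: "real \<Rightarrow> real \<Rightarrow> nat \<Rightarrow> nat \<Rightarrow> real" where
  "trunc_sum q t m n = (\<Sum>s\<in>sym_grp n. t ^ exc n s *
     (\<Sum>v\<in>admissible n m (descent_set n s). q ^ (\<Sum>i\<in>{1..n}. m - 1 - v i)))"

fun elim_seq :: "real \<Rightarrow> real \<Rightarrow> real \<Rightarrow> nat \<Rightarrow> real" where
  "elim_seq t q z 0 = 1"
| "elim_seq t q z (Suc m) = elim_step t (z * q ^ m) (elim_seq t q z m)"

lemma elim_iter_eq_elim_seq: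
  "k \<le> m \<Longrightarrow> elim_iter k t (\<lambda>b. z * q ^ (m - 1 - b)) (elim_seq t q z (m - k)) = elim_seq t q z m"
proof (induction k)
  case (Suc k)
  then have "m - k = Suc (m - Suc k)" by simp
  then have "elim_seq t q z (m - k) = elim_step t (z * q ^ (m - Suc k)) (elim_seq t q z (m - Suc k))" by simp
  with Suc show ?case by simp
qed simp

text \<open>The recursion is affine in its value. One solution is
  \<open>- t * (q - z * q ^ m) / (1 - t * q)\<close>, the homogeneous recursion is solved by the
  quotient of the two products, and the value 1 at \<open>m = 0\<close> fixes the coefficient
  \<open>(1 - t * z) / (1 - t * q)\<close>. The statement clears the denominators.\<close>

lemma elim_seq_closed_form:
  assumes "\<And>b. t * (z * q ^ b) \<noteq> 1"
  shows "(1 - t * q) * elim_seq t q z m * (\<Prod>b<m. 1 - t * (z * q ^ b)) =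
     (1 - t * z) * (\<Prod>b<m. 1 - z * q ^ b) - t * (q - z * q ^ m) * (\<Prod>b<m. 1 - t * (z * q ^ b))"
proof (induction m)
  case 0
  then show ?case by (simp add: algebra_simps)
next
  case (Suc m)
  define x where "x = z * q ^ m"
  define V where "V = elim_seq t q z m"
  define P where "P = (\<Prod>b<m. 1 - t * (z * q ^ b))"
  define N where "N = (\<Prod>b<m. 1 - z * q ^ b)"
  have ne: "1 - t * x \<noteq> 0" using assms[of m] by (simp add: x_def)
  have IH: "(1 - t * q) * V * P = (1 - t * z) * N - t * (q - x) * P"
    using Suc.IH by (simp add: x_def V_def P_def N_def)
  have "(1 - t * q) * elim_step t x V * (P * (1 - t * x)) = (1 - t * q) * ((V - t * x) * (1 - x)) * P"
    using ne by (simp add: elim_step_def)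
  also have "\<dots> = ((1 - t * q) * V * P - (1 - t * q) * t * x * P) * (1 - x)" by (simp add: algebra_simps)
  also have "\<dots> = (1 - t * z) * (N * (1 - x)) - t * (q - x * q) * (P * (1 - t * x))"
    unfolding IH by (simp add: algebra_simps)
  finally show ?case by (simp add: x_def V_def P_def N_def mult_ac)
qed

text \<open>The bound on \<open>z\<close> keeps twice the sum of the variables below 1 uniformly in
  \<open>m\<close>, by comparison with the geometric series.\<close>

lemma trunc_sum_sums:
  assumes q: "0 < q" "q < 1" and t: "0 \<le> t" "t \<le> 1" and z: "0 \<le> z" "2 * z < 1 - q"
  shows "(\<lambda>n. trunc_sum q t m n * z ^ n) sums (1 / elim_seq t q z m)" "elim_seq t q z m > 0"
proof -
  \<comment> \<open>With this reversed numbering the letters, eliminated from the largest down, have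
    the variables \<open>z, z * q, z * q ^ 2, ...\<close> in the order in which
    \<open>elim_seq\<close> uses them.\<close>
  define x where "x = (\<lambda>b. z * q ^ (m - 1 - b))"
  have z1: "z < 1" using z q by simp
  have x0: "0 \<le> x i" for i using q z by (simp add: x_def)
  have x1: "x i < 1" for i
  proof -
    have "x i \<le> z * 1" unfolding x_def using q z by (intro mult_left_mono) (auto simp: power_le_one)
    then show ?thesis using z1 by simp
  qed
  have "(\<Sum>i<m. x i) = z * (\<Sum>i<m. q ^ i)"
    using sum.nat_diff_reindex[of "\<lambda>i. q ^ i" m] by (simp add: x_def flip: sum_distrib_left)
  also have "\<dots> = z * ((1 - q ^ m) / (1 - q))" using q by (simp add: sum_gp_strict)
  also have "\<dots> \<le> z * (1 / (1 - q))" using q z by (intro mult_left_mono divide_right_mono) auto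
  finally have "(\<Sum>i<m. x i) \<le> z * (1 / (1 - q))" .
  moreover have "2 * (z * (1 / (1 - q))) < 1" using q z by simp
  ultimately have s: "2 * (\<Sum>i<m. x i) < 1" by linarith
  have eq: "elim_iter m t x 1 = elim_seq t q z m"
    using elim_iter_eq_elim_seq[of m m t z q] by (simp add: x_def)
  show "elim_seq t q z m > 0" using has_sum_words(2)[OF t x0 x1 s] eq by simp
  let ?f = "\<lambda>w. t ^ word_exc w * prod_list (map x w)"
  have "(?f has_sum 1 / elim_seq t q z m) (lists {..<m})"
    using has_sum_words(1)[OF t x0 x1 s] eq by simp
  moreover have bij: "bij_betw (\<lambda>w. (length w, w)) (lists {..<m}) (Sigma UNIV (\<lambda>n. {w \<in> lists {..<m}. length w = n}))"
    by (rule bij_betwI[where g = snd]) auto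
  ultimately have "((\<lambda>p. ?f (snd p)) has_sum 1 / elim_seq t q z m) (Sigma UNIV (\<lambda>n. {w \<in> lists {..<m}. length w = n}))"
    using has_sum_reindex_bij_betw[OF bij, of "\<lambda>p. ?f (snd p)"] by simp
  then have "((\<lambda>n. \<Sum>w | w \<in> lists {..<m} \<and> length w = n. ?f w) has_sum 1 / elim_seq t q z m) UNIV"
    by (rule has_sum_SigmaD) (simp add: has_sum_finite_iff finite_lists_length_eq lists_eq_set)
  moreover have "(\<Sum>w | w \<in> lists {..<m} \<and> length w = n. ?f w) = trunc_sum q t m n * z ^ n" for n
    unfolding sum_words_eq_sum_perms trunc_sum_def sum_distrib_right
    by (intro sum.cong refl) (simp add: x_def prod.distrib power_sum sum_distrib_right mult_ac flip: sum_distrib_left)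
  ultimately show "(\<lambda>n. trunc_sum q t m n * z ^ n) sums (1 / elim_seq t q z m)"
    by (simp add: has_sum_imp_sums)
qed

text \<open>Values are available only at small positive arguments. After division by the lowest
  occurring power of the variable, the limit at 0 from the right would make the leading coefficient
  vanish.\<close>

lemma fps_eq_0_if_eval_0:
  fixes K :: "real fps"
  assumes r: "fps_conv_radius K > 0" and e: "e > 0" and z: "\<And>z. 0 < z \<Longrightarrow> z < e \<Longrightarrow> eval_fps K z = 0"
  shows "K = 0"
proof (rule ccontr)
  assume K: "K \<noteq> 0"
  define s where "s = subdegree K"
  define L where "L = fps_shift s K"
  have L0: "fps_nth L 0 \<noteq> 0" using K by (simp add: L_def s_def)
  have KL: "K = L * fps_X ^ s" unfolding L_def s_def by (rule subdegree_decompose)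
  have rL: "fps_conv_radius L > 0" using r by (simp add: L_def)
  have "eventually (\<lambda>z. eval_fps L z = 0) (at_right 0)"
  proof -
    obtain \<delta> :: real where \<delta>: "\<delta> > 0" "ereal \<delta> < fps_conv_radius L"
      using ereal_dense2[OF rL] by (auto simp: zero_ereal_def)
    have "eventually (\<lambda>z. z \<in> {0<..<min e \<delta>}) (at_right (0::real))"
      using e \<delta> by (intro eventually_at_right_real) auto
    then show ?thesis
    proof eventually_elim
      case (elim z)
      then have "ereal (norm z) < fps_conv_radius L" using \<delta> by (intro le_less_trans[OF _ \<delta>(2)]) auto
      then have "eval_fps K z = eval_fps L z * z ^ s" unfolding KL by (subst eval_fps_mult) auto
      then show ?case using z[of z] elim by simp
    qed
  qed
  then have "(eval_fps L \<longlongrightarrow> 0) (at_right 0)" by (rule tendsto_eventually)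
  moreover have "(eval_fps L \<longlongrightarrow> eval_fps L 0) (at_right 0)"
  proof -
    have "isCont (eval_fps L) 0" by (rule continuous_eval_fps) (use rL in \<open>auto simp: zero_ereal_def\<close>)
    then show ?thesis using filterlim_at_split isCont_def by blast
  qed
  ultimately have "eval_fps L 0 = 0" using tendsto_unique by (metis trivial_limit_at_right_real)
  with L0 show False by (simp add: eval_fps_at_0)
qed

lemma trunc_sum_fps:
  assumes q: "0 < q" "q < 1" and t: "0 \<le> t" "t \<le> 1"
  shows "Abs_fps (trunc_sum q t m) * fps_of_poly ([:1, -t:] * (\<Prod>b<m. [:1, -(q ^ b):])
           - [:t * q, -(t * q ^ m):] * (\<Prod>b<m. [:1, -(t * q ^ b):])) =
         fps_of_poly ([:1 - t * q:] * (\<Prod>b<m. [:1, -(t * q ^ b):]))"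
proof -
  define G where "G = Abs_fps (trunc_sum q t m)"
  define A where "A = [:1, -t:] * (\<Prod>b<m. [:1, -(q ^ b):]) - [:t * q, -(t * q ^ m):] * (\<Prod>b<m. [:1, -(t * q ^ b):])"
  define B where "B = [:1 - t * q:] * (\<Prod>b<m. [:1, -(t * q ^ b):])"
  \<comment> \<open>The choice makes \<open>2 * e < 1 - q\<close>, the range of
    \<open>trunc_sum_sums\<close>.\<close>
  define e where "e = (1 - q) / 4"
  have e: "e > 0" using q by (simp add: e_def)
  have e2: "2 * e < 1 - q" using q by (simp add: e_def)
  have rG: "fps_conv_radius G \<ge> e"
  proof -
    have "summable (\<lambda>n. fps_nth G n * e ^ n)"
      using trunc_sum_sums(1)[OF q t _ e2] e by (auto simp: G_def sums_iff)
    from conv_radius_geI[OF this] show ?thesis using e by (simp add: fps_conv_radius_def)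
  qed
  have "G * fps_of_poly A - fps_of_poly B = 0"
  proof (rule fps_eq_0_if_eval_0[OF _ e])
    have "min (fps_conv_radius (G * fps_of_poly A)) (fps_conv_radius (fps_of_poly B)) \<le> fps_conv_radius (G * fps_of_poly A - fps_of_poly B)"
      by (rule fps_conv_radius_diff)
    moreover have "min (fps_conv_radius G) (fps_conv_radius (fps_of_poly A)) \<le> fps_conv_radius (G * fps_of_poly A)"
      by (rule fps_conv_radius_mult)
    moreover have "0 < fps_conv_radius G" using rG e by (metis ereal_less(2) less_le_trans)
    ultimately show "fps_conv_radius (G * fps_of_poly A - fps_of_poly B) > 0" by simp
    fix z assume z: "0 < z" "z < e"
    have nz: "ereal (norm z) < fps_conv_radius G" by (rule less_le_trans[OF _ rG]) (use z in simp)
    have nzA: "ereal (norm z) < fps_conv_radius (G * fps_of_poly A)"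
      using fps_conv_radius_mult[of G "fps_of_poly A"] less_le_trans[OF nz] by simp
    have z2: "2 * z < 1 - q" using z e2 by simp
    have ne: "t * (z * q ^ b) \<noteq> 1" for b
    proof -
      have "t * (z * q ^ b) \<le> 1 * (z * 1)" using t q z by (intro mult_mono) (auto simp: power_le_one)
      then show ?thesis using z2 q by auto
    qed
    have "eval_fps G z = 1 / elim_seq t q z m"
      using trunc_sum_sums(1)[OF q t _ z2] z by (auto simp: eval_fps_def G_def sums_iff)
    moreover have "poly A z = (1 - t * q) * elim_seq t q z m * (\<Prod>b<m. 1 - t * (z * q ^ b))"
      unfolding elim_seq_closed_form[OF ne] A_def by (simp add: poly_prod algebra_simps)
    moreover have "poly B z = (1 - t * q) * (\<Prod>b<m. 1 - t * (z * q ^ b))"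
      by (simp add: B_def poly_prod algebra_simps)
    ultimately have "eval_fps G z * poly A z = poly B z"
      using trunc_sum_sums(2)[OF q t _ z2, of m] z by simp
    then show "eval_fps (G * fps_of_poly A - fps_of_poly B) z = 0"
      using nz nzA by (simp add: eval_fps_diff eval_fps_mult)
  qed
  then show ?thesis by (simp add: G_def A_def B_def)
qed

text \<open>This removes the variable \<open>q ^ m\<close>, whereas \<open>hcoef_Suc_Suc\<close>
  removes the variable 1. It is read off from the product formula.\<close>

lemma hcoef_Suc_eq:
  assumes "0 < q" "q < 1"
  shows "hcoef q (Suc n) (Suc m) - q ^ m * hcoef q n (Suc m) = hcoef q (Suc n) m"
proof -
  define R where "R = (\<Prod>i<n. 1 - q ^ (Suc m + i))"
  have R: "hcoef q n (Suc m) * qpoch q n = R" by (simp add: hcoef_mult_qpoch R_def)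
  have 1: "hcoef q (Suc n) (Suc m) * qpoch q (Suc n) = R * (1 - q ^ (Suc m + n))"
    by (simp add: hcoef_mult_qpoch R_def)
  have 2: "hcoef q (Suc n) m * qpoch q (Suc n) = (1 - q ^ m) * R"
    unfolding hcoef_mult_qpoch R_def by (subst prod.lessThan_Suc_shift) simp
  have "(hcoef q (Suc n) (Suc m) - q ^ m * hcoef q n (Suc m)) * qpoch q (Suc n) =
     hcoef q (Suc n) (Suc m) * qpoch q (Suc n) - q ^ m * (hcoef q n (Suc m) * qpoch q n) * (1 - q ^ Suc n)"
    by (simp add: algebra_simps qpoch_Suc)
  also have "\<dots> = (1 - q ^ m) * R" unfolding 1 R by (simp add: algebra_simps power_add)
  also have "\<dots> = hcoef q (Suc n) m * qpoch q (Suc n)" by (simp add: 2)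
  finally show ?thesis using qpoch_pos[OF assms, of "Suc n"] by simp
qed

lemma fps_hcoef:
  assumes "0 < q" "q < 1"
  shows "Abs_fps (\<lambda>n. t ^ n * hcoef q n m) * fps_of_poly (\<Prod>b<m. [:1, -(t * q ^ b):]) = 1"
proof (induction m)
  case 0
  show ?case
  proof (rule fps_ext)
    fix n show "fps_nth (Abs_fps (\<lambda>n. t ^ n * hcoef q n 0) * fps_of_poly (\<Prod>b<0. [:1, -(t * q ^ b):])) n = fps_nth 1 n"
      by (cases n) auto
  qed
next
  case (Suc m)
  have "Abs_fps (\<lambda>n. t ^ n * hcoef q n (Suc m)) * fps_of_poly [:1, -(t * q ^ m):] = Abs_fps (\<lambda>n. t ^ n * hcoef q n m)"
  proof (rule fps_ext)
    fix n
    have *: "fps_of_poly [:1, -(t * q ^ m):] = 1 - fps_const (t * q ^ m) * fps_X"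
      by (simp add: fps_of_poly_pCons)
    show "fps_nth (Abs_fps (\<lambda>n. t ^ n * hcoef q n (Suc m)) * fps_of_poly [:1, -(t * q ^ m):]) n =
      fps_nth (Abs_fps (\<lambda>n. t ^ n * hcoef q n m)) n"
    proof (cases n)
      case 0 then show ?thesis unfolding * by (simp add: algebra_simps)
    next
      case (Suc k)
      have "fps_nth (Abs_fps (\<lambda>n. t ^ n * hcoef q n (Suc m)) * (1 - fps_const (t * q ^ m) * fps_X)) (Suc k) =
        t ^ Suc k * hcoef q (Suc k) (Suc m) - t * q ^ m * (t ^ k * hcoef q k (Suc m))"
        by (simp add: right_diff_distrib mult.left_commute[of _ "fps_const _"] flip: mult.assoc)
      also have "\<dots> = t ^ Suc k * (hcoef q (Suc k) (Suc m) - q ^ m * hcoef q k (Suc m))" by (simp add: algebra_simps)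
      finally show ?thesis using hcoef_Suc_eq[OF assms] by (simp only: Suc * fps_nth_Abs_fps)
    qed
  qed
  moreover have "fps_of_poly (\<Prod>b<Suc m. [:1, -(t * q ^ b):]) =
      fps_of_poly [:1, -(t * q ^ m):] * fps_of_poly (\<Prod>b<m. [:1, -(t * q ^ b):])"
    by (simp only: prod.lessThan_Suc fps_of_poly_mult mult.commute)
  ultimately show ?case using Suc by (simp only: mult.assoc[symmetric])
qed

text \<open>Dividing by both products replaces them by series whose coefficients visibly converge as
  \<open>m\<close> grows, which prepares the coefficientwise limit.\<close>

lemma trunc_sum_fps':
  assumes q: "0 < q" "q < 1" and t: "0 \<le> t" "t \<le> 1"
  shows "Abs_fps (trunc_sum q t m) *
      ((1 - fps_const t * fps_X) * Abs_fps (\<lambda>n. t ^ n * hcoef q n m)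
       - (fps_const (t * q) - fps_const (t * q ^ m) * fps_X) * Abs_fps (\<lambda>n. hcoef q n m)) =
     fps_const (1 - t * q) * Abs_fps (\<lambda>n. hcoef q n m)"
proof -
  define N where "N = fps_of_poly (\<Prod>b<m. [:1, -(q ^ b):])"
  define D where "D = fps_of_poly (\<Prod>b<m. [:1, -(t * q ^ b):])"
  define Ht where "Ht = Abs_fps (\<lambda>n. t ^ n * hcoef q n m)"
  define H where "H = Abs_fps (\<lambda>n. hcoef q n m)"
  define G where "G = Abs_fps (trunc_sum q t m)"
  have HN: "H * N = 1" using fps_hcoef[OF q, of 1 m] by (simp add: H_def N_def)
  have HD: "Ht * D = 1" using fps_hcoef[OF q, of t m] by (simp add: Ht_def D_def)
  have lin: "fps_of_poly [:1, -t:] = 1 - fps_const t * fps_X"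
    and lin': "fps_of_poly [:t * q, -(t * q ^ m):] = fps_const (t * q) - fps_const (t * q ^ m) * fps_X"
    and cst: "fps_of_poly [:1 - t * q:] = fps_const (1 - t * q)"
    by (simp_all add: fps_of_poly_pCons mult.commute flip: fps_const_neg)
  have "G * ((1 - fps_const t * fps_X) * N - (fps_const (t * q) - fps_const (t * q ^ m) * fps_X) * D) = fps_const (1 - t * q) * D"
    using trunc_sum_fps[OF q t, of m] unfolding fps_of_poly_mult fps_of_poly_diff lin lin' cst G_def N_def D_def .
  then have "G * ((1 - fps_const t * fps_X) * N - (fps_const (t * q) - fps_const (t * q ^ m) * fps_X) * D) * (H * Ht) = fps_const (1 - t * q) * D * (H * Ht)"
    by simp
  also have "G * ((1 - fps_const t * fps_X) * N - (fps_const (t * q) - fps_const (t * q ^ m) * fps_X) * D) * (H * Ht) =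
     G * ((1 - fps_const t * fps_X) * Ht * (H * N) - (fps_const (t * q) - fps_const (t * q ^ m) * fps_X) * H * (Ht * D))"
    by (simp add: algebra_simps)
  also have "fps_const (1 - t * q) * D * (H * Ht) = fps_const (1 - t * q) * H * (Ht * D)" by (simp add: mult_ac)
  finally show ?thesis unfolding HN HD by (simp add: G_def H_def Ht_def)
qed

section \<open>The limit of infinitely many letters\<close>

lemma hcoef_tendsto:
  assumes q: "0 < q" "q < 1"
  shows "(\<lambda>m. hcoef q n (m - c)) \<longlonglongrightarrow> 1 / qpoch q n"
proof -
  have "(\<lambda>m. (\<Prod>i<n. 1 - q ^ (m + i))) \<longlonglongrightarrow> (\<Prod>i<n. 1 - 0)"
    using q by (intro tendsto_prod tendsto_diff tendsto_const LIMSEQ_ignore_initial_segment LIMSEQ_power_zero) auto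
  then have "(\<lambda>m. (\<Prod>i<n. 1 - q ^ (m + i)) / qpoch q n) \<longlonglongrightarrow> (\<Prod>i<n. 1 - 0) / qpoch q n"
    using qpoch_pos[OF q, of n] by (intro tendsto_divide tendsto_const) auto
  moreover have "(\<Prod>i<n. 1 - q ^ (m + i)) / qpoch q n = hcoef q n m" for m
    using hcoef_mult_qpoch[of q n m] qpoch_pos[OF q, of n] by (simp add: field_simps)
  ultimately have "(\<lambda>m. hcoef q n m) \<longlonglongrightarrow> 1 / qpoch q n" by simp
  then have "(\<lambda>m. hcoef q n (m + c - c)) \<longlonglongrightarrow> 1 / qpoch q n" by simp
  then show ?thesis by (rule LIMSEQ_offset)
qed

definition exc_maj_poly :: "'a::comm_ring_1 \<Rightarrow> 'a \<Rightarrow> nat \<Rightarrow> 'a" where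
  "exc_maj_poly q t n = (\<Sum>s\<in>sym_grp n. t ^ exc n s * q ^ maj n s)"

lemma trunc_sum_tendsto:
  assumes q: "0 < q" "q < 1"
  shows "(\<lambda>m. trunc_sum q t m n) \<longlonglongrightarrow> exc_maj_poly q t n / qpoch q n"
proof -
  have "(\<lambda>m. \<Sum>s\<in>sym_grp n. t ^ exc n s * (q ^ maj n s * hcoef q n (m - des n s))) \<longlonglongrightarrow>
     (\<Sum>s\<in>sym_grp n. t ^ exc n s * (q ^ maj n s * (1 / qpoch q n)))"
    by (intro tendsto_sum tendsto_mult tendsto_const hcoef_tendsto q)
  also have "(\<Sum>s\<in>sym_grp n. t ^ exc n s * (q ^ maj n s * (1 / qpoch q n))) = exc_maj_poly q t n / qpoch q n"
    by (simp add: exc_maj_poly_def sum_divide_distrib)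
  finally show ?thesis
  proof (rule Lim_transform_eventually)
    show "\<forall>\<^sub>F m in sequentially. (\<Sum>s\<in>sym_grp n. t ^ exc n s * (q ^ maj n s * hcoef q n (m - des n s))) = trunc_sum q t m n"
      using eventually_gt_at_top[of n]
    proof eventually_elim
      case (elim m)
      have "(\<Sum>v\<in>admissible n m (descent_set n s). q ^ (\<Sum>i\<in>{1..n}. m - 1 - v i)) = q ^ maj n s * hcoef q n (m - des n s)" for s
      proof -
        have sub: "descent_set n s \<subseteq> {1..<n}" by (auto simp: descent_set_def)
        have "card (descent_set n s) \<le> card {1..<n}" using sub by (intro card_mono) auto
        then have "card (descent_set n s) < m" using elim by simp
        from sum_admissible[OF sub this] show ?thesis by (simp add: maj_def des_def)
      qed
      then show ?case by (simp add: trunc_sum_def)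
    qed
  qed
qed

lemma fps_mult_nth_tendsto:
  fixes F G :: "nat \<Rightarrow> real fps"
  assumes "\<And>n. (\<lambda>m. fps_nth (F m) n) \<longlonglongrightarrow> fps_nth F' n" "\<And>n. (\<lambda>m. fps_nth (G m) n) \<longlonglongrightarrow> fps_nth G' n"
  shows "(\<lambda>m. fps_nth (F m * G m) n) \<longlonglongrightarrow> fps_nth (F' * G') n"
  unfolding fps_mult_nth by (intro tendsto_sum tendsto_mult assms)

text \<open>In the limit the term with \<open>q ^ m\<close> disappears, and
  \<open>(1 - t z) E(t z) = E(t q z)\<close> absorbs the linear factor. The result is the functional
  equation of the overview with \<open>t * q\<close> in place of its \<open>t\<close>.\<close>

lemma exc_maj_fps:
  fixes q t :: real
  assumes q: "0 < q" "q < 1" and t: "0 \<le> t" "t \<le> 1"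
  shows "Abs_fps (\<lambda>n. exc_maj_poly q t n / qpoch q n) *
     (Abs_fps (\<lambda>n. (t * q) ^ n / qpoch q n) - fps_const (t * q) * Abs_fps (\<lambda>n. 1 / qpoch q n)) =
     fps_const (1 - t * q) * Abs_fps (\<lambda>n. 1 / qpoch q n)"
proof -
  define E where "E = Abs_fps (\<lambda>n. 1 / qpoch q n)"
  define Et where "Et = Abs_fps (\<lambda>n. t ^ n * (1 / qpoch q n))"
  define F where "F = Abs_fps (\<lambda>n. exc_maj_poly q t n / qpoch q n)"
  have H: "(\<lambda>m. fps_nth (Abs_fps (\<lambda>n. hcoef q n m)) n) \<longlonglongrightarrow> fps_nth E n" for n
    using hcoef_tendsto[OF q, of n 0] by (simp add: E_def)
  have Ht: "(\<lambda>m. fps_nth (Abs_fps (\<lambda>n. t ^ n * hcoef q n m)) n) \<longlonglongrightarrow> fps_nth Et n" for n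
    using tendsto_mult[OF tendsto_const[of "t ^ n"] hcoef_tendsto[OF q, of n 0]] by (simp add: Et_def)
  have c: "(\<lambda>m. fps_nth (fps_const (t * q) - fps_const (t * q ^ m) * fps_X) n) \<longlonglongrightarrow> fps_nth (fps_const (t * q)) n" for n
  proof -
    have "(\<lambda>m. t * q ^ m) \<longlonglongrightarrow> t * 0" using q by (intro tendsto_mult tendsto_const LIMSEQ_power_zero) auto
    then have "(\<lambda>m. fps_nth (fps_const (t * q)) n - (if n = 1 then t * q ^ m else 0)) \<longlonglongrightarrow> fps_nth (fps_const (t * q)) n - 0"
      by (intro tendsto_diff tendsto_const) (cases "n = 1"; simp)
    moreover have "fps_nth (fps_const (t * q) - fps_const (t * q ^ m) * fps_X) n =
        fps_nth (fps_const (t * q)) n - (if n = 1 then t * q ^ m else 0)" for m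
      by (cases n) auto
    ultimately show ?thesis by (simp only: diff_zero)
  qed
  have "(\<lambda>m. fps_nth (Abs_fps (trunc_sum q t m) *
      ((1 - fps_const t * fps_X) * Abs_fps (\<lambda>n. t ^ n * hcoef q n m)
       - (fps_const (t * q) - fps_const (t * q ^ m) * fps_X) * Abs_fps (\<lambda>n. hcoef q n m))) n) \<longlonglongrightarrow>
     fps_nth (F * ((1 - fps_const t * fps_X) * Et - fps_const (t * q) * E)) n" for n
  proof (rule fps_mult_nth_tendsto)
    show "(\<lambda>m. fps_nth (Abs_fps (trunc_sum q t m)) n) \<longlonglongrightarrow> fps_nth F n" for n
      using trunc_sum_tendsto[OF q] by (simp add: F_def)
    show "(\<lambda>m. fps_nth ((1 - fps_const t * fps_X) * Abs_fps (\<lambda>n. t ^ n * hcoef q n m)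
       - (fps_const (t * q) - fps_const (t * q ^ m) * fps_X) * Abs_fps (\<lambda>n. hcoef q n m)) n) \<longlonglongrightarrow>
      fps_nth ((1 - fps_const t * fps_X) * Et - fps_const (t * q) * E) n" for n
      unfolding fps_sub_nth by (intro tendsto_diff fps_mult_nth_tendsto tendsto_const H Ht c)
  qed
  moreover have "(\<lambda>m. fps_nth (fps_const (1 - t * q) * Abs_fps (\<lambda>n. hcoef q n m)) n) \<longlonglongrightarrow> fps_nth (fps_const (1 - t * q) * E) n" for n
    by (intro fps_mult_nth_tendsto tendsto_const H)
  ultimately have main: "F * ((1 - fps_const t * fps_X) * Et - fps_const (t * q) * E) = fps_const (1 - t * q) * E"
    unfolding trunc_sum_fps'[OF q t] by (intro fps_ext) (blast intro: LIMSEQ_unique)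
  have "(1 - fps_const t * fps_X) * Et = Abs_fps (\<lambda>n. (t * q) ^ n / qpoch q n)"
  proof (rule fps_ext)
    fix n
    show "fps_nth ((1 - fps_const t * fps_X) * Et) n = fps_nth (Abs_fps (\<lambda>n. (t * q) ^ n / qpoch q n)) n"
    proof (cases n)
      case 0
      then show ?thesis by (simp add: Et_def algebra_simps)
    next
      case (Suc k)
      have p: "qpoch q k > 0" "qpoch q (Suc k) > 0" using qpoch_pos[OF q] by auto
      have "1 / qpoch q k = (1 - q ^ Suc k) / qpoch q (Suc k)"
        using p by (auto simp: qpoch_Suc)
      then have "t ^ Suc k * (1 / qpoch q (Suc k)) - t * (t ^ k * (1 / qpoch q k)) = (t * q) ^ Suc k / qpoch q (Suc k)"
        by (simp add: diff_divide_distrib power_mult_distrib right_diff_distrib)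
      moreover have "fps_nth ((1 - fps_const t * fps_X) * Et) (Suc k) = fps_nth Et (Suc k) - t * fps_nth Et k"
        by (simp add: left_diff_distrib mult.assoc)
      ultimately show ?thesis by (simp add: Suc Et_def)
    qed
  qed
  with main show ?thesis by (simp add: F_def E_def)
qed

section \<open>Permutations without double descents\<close>

fun list_des :: "nat list \<Rightarrow> nat" where
  "list_des (x # y # zs) = (if y < x then 1 else 0) + list_des (y # zs)"
| "list_des _ = 0"

fun list_inv :: "nat list \<Rightarrow> nat" where
  "list_inv [] = 0"
| "list_inv (x # xs) = length (filter (\<lambda>y. y < x) xs) + list_inv xs"

text \<open>The flag records whether the first entry is preceded by a larger one.\<close>

fun no_dd :: "bool \<Rightarrow> nat list \<Rightarrow> bool" where
  "no_dd p (x # y # zs) = (if y < x then \<not> p \<and> no_dd True (y # zs) else no_dd False (y # zs))"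
| "no_dd p _ = True"

text \<open>Without double descents no two descents are adjacent, and a larger entry in front
  forbids a descent at the start. With the flag set, the bound keeps the exponent of
  \<open>1 + t\<close> in \<open>dd_weight\<close> from truncating.\<close>

lemma list_des_bound: "no_dd p xs \<Longrightarrow> xs \<noteq> [] \<Longrightarrow> 2 * list_des xs + (if p then 1 else 0) \<le> length xs"
  by (induction p xs rule: no_dd.induct) (auto split: if_splits)

lemma list_des_append_max:
  "L \<noteq> [] \<Longrightarrow> \<forall>a\<in>set L. a < M \<Longrightarrow> list_des (L @ M # R) = list_des L + list_des (M # R)"
  by (induction L rule: list_des.induct) auto

lemma no_dd_append_max:
  "L \<noteq> [] \<Longrightarrow> \<forall>a\<in>set L. a < M \<Longrightarrow> no_dd p (L @ M # R) \<longleftrightarrow> no_dd p L \<and> no_dd False (M # R)"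
  by (induction p L rule: no_dd.induct) auto

lemma list_des_max_Cons: "R \<noteq> [] \<Longrightarrow> \<forall>a\<in>set R. a < M \<Longrightarrow> list_des (M # R) = Suc (list_des R)"
  by (cases R) auto

lemma no_dd_max_Cons: "R \<noteq> [] \<Longrightarrow> \<forall>a\<in>set R. a < M \<Longrightarrow> no_dd p (M # R) \<longleftrightarrow> \<not> p \<and> no_dd True R"
  by (cases R) auto

section \<open>Decomposition at the largest entry\<close>

definition cross_inv :: "nat set \<Rightarrow> nat set \<Rightarrow> nat" where
  "cross_inv S T = (\<Sum>a\<in>S. card {b \<in> T. b < a})"

lemma list_inv_append:
  assumes "distinct xs" "distinct ys"
  shows "list_inv (xs @ ys) = list_inv xs + list_inv ys + cross_inv (set xs) (set ys)"
  using assms(1)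
proof (induction xs)
  case (Cons x xs)
  have "length (filter (\<lambda>y. y < x) ys) = card ({b. b < x} \<inter> set ys)"
    using assms(2) by (rule distinct_length_filter)
  also have "{b. b < x} \<inter> set ys = {b \<in> set ys. b < x}" by auto
  finally show ?case using Cons by (simp add: cross_inv_def)
qed (simp add: cross_inv_def)

text \<open>The flag \<open>True\<close> stands for the infinite entry in front of the word. The
  infinite entry behind it is built into \<open>no_dd\<close>, which never rejects a last
  entry.\<close>

definition dd_weight :: "real \<Rightarrow> real \<Rightarrow> nat list \<Rightarrow> real" where
  "dd_weight q t xs = (if no_dd True xs
     then q ^ list_inv xs * t ^ list_des xs * (1 + t) ^ (length xs - 1 - 2 * list_des xs) else 0)"

text \<open>For its neighbours \<open>M\<close> acts like the infinite boundary, so \<open>L\<close>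
  and \<open>R\<close> inherit the same condition. As last entry after a nonempty \<open>L\<close>
  it adds length but no descent, hence the factor \<open>1 + t\<close>; in front of a nonempty
  \<open>R\<close> it is a double descent; in between it adds one entry and one descent, which makes
  the exponents of \<open>1 + t\<close> additive.\<close>

lemma dd_weight_split:
  assumes M: "\<forall>a\<in>set L \<union> set R. a < M" and d: "distinct L" "distinct R"
  shows "dd_weight q t (L @ M # R) =
    (if R = [] then (if L = [] then 1 else (1 + t) * dd_weight q t L)
     else if L = [] then 0
     else t * q ^ (length R + cross_inv (set L) (set R)) * dd_weight q t L * dd_weight q t R)"
proof -
  have inv: "list_inv (L @ M # R) = list_inv L + list_inv R + length R + cross_inv (set L) (set R)"
  proof -
    have dM: "distinct (M # R)" using M d by auto
    have "cross_inv (set L) (set (M # R)) = cross_inv (set L) (set R)"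
      unfolding cross_inv_def
    proof (intro sum.cong refl arg_cong[where f = card])
      fix a assume "a \<in> set L"
      then have "a < M" using M by blast
      then show "{b \<in> set (M # R). b < a} = {b \<in> set R. b < a}" by auto
    qed
    moreover have "filter (\<lambda>y. y < M) R = R" using M by (simp add: filter_id_conv)
    ultimately show ?thesis using list_inv_append[OF d(1) dM] by simp
  qed
  consider "R = []" "L = []" | "R = []" "L \<noteq> []" | "R \<noteq> []" "L = []" | "R \<noteq> []" "L \<noteq> []" by blast
  then show ?thesis
  proof cases
    case 1 then show ?thesis by (simp add: dd_weight_def)
  next
    case 2
    have nd: "no_dd True (L @ M # R) = no_dd True L" using 2 M by (subst no_dd_append_max) auto
    have de: "list_des (L @ M # R) = list_des L" using 2 M by (subst list_des_append_max) auto
    have "dd_weight q t (L @ M # R) = (1 + t) * dd_weight q t L"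
    proof (cases "no_dd True L")
      case True
      have "length (L @ M # R) - 1 - 2 * list_des L = Suc (length L - 1 - 2 * list_des L)"
        using list_des_bound[OF True 2(2)] 2 by simp
      then show ?thesis unfolding dd_weight_def nd de inv using 2 True by (simp add: cross_inv_def)
    qed (simp add: dd_weight_def nd)
    then show ?thesis using 2 by simp
  next
    case 3
    then have "\<not> no_dd True (L @ M # R)" using no_dd_max_Cons[of R M True] M by auto
    then show ?thesis using 3 by (simp add: dd_weight_def)
  next
    case 4
    have nd: "no_dd True (L @ M # R) \<longleftrightarrow> no_dd True L \<and> no_dd True R"
      using 4 M by (subst no_dd_append_max) (auto simp: no_dd_max_Cons)
    have de: "list_des (L @ M # R) = Suc (list_des L + list_des R)"
      using 4 M by (subst list_des_append_max) (auto simp: list_des_max_Cons)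
    show ?thesis
    proof (cases "no_dd True L \<and> no_dd True R")
      case True
      have "length (L @ M # R) - 1 - 2 * Suc (list_des L + list_des R) =
         (length L - 1 - 2 * list_des L) + (length R - 1 - 2 * list_des R)"
        using list_des_bound[of True L] list_des_bound[of True R] True 4 by simp
      then show ?thesis unfolding dd_weight_def nd de inv using 4 True by (simp add: power_add)
    next
      case False
      then show ?thesis using 4 by (auto simp: dd_weight_def nd)
    qed
  qed
qed

lemma sum_permutations_split:
  fixes g :: "nat list \<Rightarrow> real"
  assumes fin: "finite Y" and M: "M \<notin> Y"
  shows "(\<Sum>xs\<in>permutations_of_set (insert M Y). g xs) =
    (\<Sum>S\<in>Pow Y. \<Sum>L\<in>permutations_of_set S. \<Sum>R\<in>permutations_of_set (Y - S). g (L @ M # R))"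
proof -
  let ?A = "Sigma (Pow Y) (\<lambda>S. permutations_of_set S \<times> permutations_of_set (Y - S))"
  let ?h = "\<lambda>(S, L, R). L @ M # R"
  have bij: "bij_betw ?h ?A (permutations_of_set (insert M Y))"
    unfolding bij_betw_def
  proof
    show "inj_on ?h ?A"
    proof (rule inj_onI)
      fix p p' assume "p \<in> ?A" "p' \<in> ?A" "?h p = ?h p'"
      moreover obtain S L R S' L' R' where p: "p = (S, L, R)" "p' = (S', L', R')" by (metis prod_cases3)
      ultimately have *: "S \<subseteq> Y" "S' \<subseteq> Y" "L \<in> permutations_of_set S" "L' \<in> permutations_of_set S'"
        "R \<in> permutations_of_set (Y - S)" "R' \<in> permutations_of_set (Y - S')" and eq: "L @ M # R = L' @ M # R'"
        by auto
      have "M \<notin> set L" "M \<notin> set R" "M \<notin> set L'" using * M by (auto simp: permutations_of_set_def)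
      then have "L = L' \<and> R = R'" using eq by (metis append_Cons_eq_iff)
      then show "p = p'" using * unfolding p by (auto simp: permutations_of_set_def)
    qed
    show "?h ` ?A = permutations_of_set (insert M Y)"
    proof (intro equalityI subsetI)
      fix xs assume "xs \<in> ?h ` ?A"
      then show "xs \<in> permutations_of_set (insert M Y)" using M by (auto simp: permutations_of_set_def)
    next
      fix xs assume xs: "xs \<in> permutations_of_set (insert M Y)"
      then have "M \<in> set xs" by (simp add: permutations_of_set_def)
      then obtain L R where LR: "xs = L @ M # R" by (meson split_list)
      have d: "distinct (L @ M # R)" "set (L @ M # R) = insert M Y" using xs LR by (auto simp: permutations_of_set_def)
      have "set L \<subseteq> Y" "set R = Y - set L"
        using d M by auto
      then have "(set L, L, R) \<in> ?A" using d by (simp add: permutations_of_set_def)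
      then show "xs \<in> ?h ` ?A" unfolding LR by (intro image_eqI[of _ _ "(set L, L, R)"]) auto
    qed
  qed
  have "(\<Sum>xs\<in>permutations_of_set (insert M Y). g xs) = (\<Sum>(S, L, R)\<in>?A. g (L @ M # R))"
    by (subst sum.reindex_bij_betw[OF bij, symmetric]) (simp add: split_def)
  also have "\<dots> = (\<Sum>S\<in>Pow Y. \<Sum>(L, R)\<in>permutations_of_set S \<times> permutations_of_set (Y - S). g (L @ M # R))"
    using fin by (subst sum.Sigma) (auto intro: finite_subset simp: split_def)
  finally show ?thesis by (simp add: sum.cartesian_product)
qed

section \<open>Gaussian binomial coefficients as sums over subsets\<close>

definition gauss_sum :: "'a::comm_ring_1 \<Rightarrow> nat set \<Rightarrow> nat \<Rightarrow> 'a" where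
  "gauss_sum q Y k = (\<Sum>S | S \<subseteq> Y \<and> card S = k. q ^ cross_inv S (Y - S))"

lemma gauss_sum_0: "finite Y \<Longrightarrow> gauss_sum q Y 0 = 1"
proof -
  assume "finite Y"
  then have "S \<subseteq> Y \<and> card S = 0 \<longleftrightarrow> S = {}" for S using finite_subset[of S Y] by auto
  then have "{S. S \<subseteq> Y \<and> card S = 0} = {{}}" by simp
  then show ?thesis by (simp add: gauss_sum_def cross_inv_def)
qed

lemma gauss_sum_large: "finite Y \<Longrightarrow> card Y < k \<Longrightarrow> gauss_sum q Y k = 0"
proof -
  assume "finite Y" "card Y < k"
  then have "{S. S \<subseteq> Y \<and> card S = k} = {}" by (auto dest: card_mono[of Y])
  then show ?thesis unfolding gauss_sum_def by (simp only: sum.empty)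
qed

text \<open>The \<open>q\<close>-Pascal rule: if the new maximum \<open>b\<close> is in the subset,
  it exceeds all \<open>card Y - k\<close> elements of the complement; if not, it takes part in no
  inversion.\<close>

lemma gauss_sum_insert_max:
  assumes fin: "finite Y" and b: "\<forall>a\<in>Y. a < b"
  shows "gauss_sum q (insert b Y) (Suc k) = gauss_sum q Y (Suc k) + q ^ (card Y - k) * gauss_sum q Y k"
proof -
  have bY: "b \<notin> Y" using b by auto
  let ?A = "{S. S \<subseteq> Y \<and> card S = Suc k}" and ?B = "{S. S \<subseteq> Y \<and> card S = k}"
  have split: "{S. S \<subseteq> insert b Y \<and> card S = Suc k} = ?A \<union> insert b ` ?B"
  proof (intro equalityI subsetI)
    fix S assume S: "S \<in> {S. S \<subseteq> insert b Y \<and> card S = Suc k}"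
    then have fS: "finite S" using fin finite_subset by blast
    show "S \<in> ?A \<union> insert b ` ?B"
    proof (cases "b \<in> S")
      case True
      then have "S = insert b (S - {b})" "S - {b} \<in> ?B" using S fS by auto
      then show ?thesis by blast
    qed (use S in auto)
  next
    fix S assume "S \<in> ?A \<union> insert b ` ?B"
    then show "S \<in> {S. S \<subseteq> insert b Y \<and> card S = Suc k}"
    proof
      assume "S \<in> insert b ` ?B"
      then obtain S' where S': "S = insert b S'" "S' \<subseteq> Y" "card S' = k" by auto
      then have "finite S'" "b \<notin> S'" using fin bY finite_subset by blast+
      then show ?thesis using S' by auto
    qed auto
  qed
  have "gauss_sum q (insert b Y) (Suc k) = (\<Sum>S\<in>?A. q ^ cross_inv S (insert b Y - S)) + (\<Sum>S\<in>insert b ` ?B. q ^ cross_inv S (insert b Y - S))"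
    unfolding gauss_sum_def split using fin bY by (intro sum.union_disjoint) auto
  also have "(\<Sum>S\<in>?A. q ^ cross_inv S (insert b Y - S)) = gauss_sum q Y (Suc k)"
    unfolding gauss_sum_def
  proof (rule sum.cong)
    fix S assume S: "S \<in> ?A"
    have "cross_inv S (insert b Y - S) = cross_inv S (Y - S)"
      unfolding cross_inv_def
    proof (intro sum.cong refl arg_cong[where f = card])
      fix a assume "a \<in> S"
      then have "\<not> b < a" using S b by (auto dest: less_asym)
      then show "{c \<in> insert b Y - S. c < a} = {c \<in> Y - S. c < a}" by auto
    qed
    then show "q ^ cross_inv S (insert b Y - S) = q ^ cross_inv S (Y - S)" by simp
  qed simp
  also have "(\<Sum>S\<in>insert b ` ?B. q ^ cross_inv S (insert b Y - S)) = (\<Sum>S\<in>?B. q ^ cross_inv (insert b S) (insert b Y - insert b S))"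
  proof (rule sum.reindex[unfolded o_def])
    show "inj_on (insert b) ?B" using bY by (intro inj_onI) (metis (no_types, lifting) CollectD insert_ident subsetD)
  qed
  also have "\<dots> = q ^ (card Y - k) * gauss_sum q Y k"
    unfolding gauss_sum_def sum_distrib_left
  proof (rule sum.cong)
    fix S assume S: "S \<in> ?B"
    then have fS: "finite S" "b \<notin> S" using fin bY finite_subset by blast+
    have e: "insert b Y - insert b S = Y - S" using bY by auto
    have "{c \<in> Y - S. c < b} = Y - S" using b by auto
    then have "card {c \<in> Y - S. c < b} = card Y - k" using S fS by (simp add: card_Diff_subset)
    then have "cross_inv (insert b S) (Y - S) = card Y - k + cross_inv S (Y - S)"
      using fS by (simp add: cross_inv_def)
    then show "q ^ cross_inv (insert b S) (insert b Y - insert b S) = q ^ (card Y - k) * q ^ cross_inv S (Y - S)"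
      unfolding e by (simp add: power_add)
  qed simp
  finally show ?thesis .
qed

lemma gauss_sum_qpoch:
  assumes "finite Y" "k \<le> card Y"
  shows "gauss_sum q Y k * (qpoch q k * qpoch q (card Y - k)) = qpoch q (card Y)"
  using assms
proof (induction arbitrary: k rule: finite_linorder_max_induct)
  case empty
  then show ?case by (simp add: gauss_sum_0 qpoch_def)
next
  case (insert b Y)
  have c: "card (insert b Y) = Suc (card Y)" using insert by (intro card_insert_disjoint) auto
  define n where "n = card Y"
  show ?case
  proof (cases k)
    case 0
    then show ?thesis using insert by (simp add: gauss_sum_0) (simp add: qpoch_def)
  next
    case (Suc j)
    then have jn: "j \<le> n" using insert.prems c by (simp add: n_def)
    have g: "gauss_sum q (insert b Y) (Suc j) = gauss_sum q Y (Suc j) + q ^ (n - j) * gauss_sum q Y j"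
      unfolding n_def by (rule gauss_sum_insert_max) (use insert in auto)
    have IH: "gauss_sum q Y j * (qpoch q j * qpoch q (n - j)) = qpoch q n"
      using insert.IH[of j] jn by (simp add: n_def)
    \<comment> \<open>In this form both sides vanish for \<open>j = n\<close>, so the
      \<open>q\<close>-Pascal rule can be applied to all \<open>j\<close> alike.\<close>
    have IH': "gauss_sum q Y (Suc j) * (qpoch q (Suc j) * qpoch q (n - j)) = qpoch q n * (1 - q ^ (n - j))"
    proof (cases "j = n")
      case True
      then show ?thesis using insert.hyps by (simp add: gauss_sum_large n_def)
    next
      case False
      then obtain i where i: "n - j = Suc i" using jn by (metis Suc_diff_Suc le_neq_implies_less)
      then have "n - Suc j = i" "Suc j \<le> n" by auto
      then have "gauss_sum q Y (Suc j) * (qpoch q (Suc j) * qpoch q i) = qpoch q n"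
        using insert.IH[of "Suc j"] by (simp add: n_def)
      then show ?thesis unfolding i qpoch_Suc[of q i] by (metis mult.assoc)
    qed
    have "gauss_sum q (insert b Y) (Suc j) * (qpoch q (Suc j) * qpoch q (n - j)) =
      gauss_sum q Y (Suc j) * (qpoch q (Suc j) * qpoch q (n - j)) +
      q ^ (n - j) * (1 - q ^ Suc j) * (gauss_sum q Y j * (qpoch q j * qpoch q (n - j)))"
      unfolding g qpoch_Suc[of q j] by (simp add: algebra_simps)
    also have "\<dots> = qpoch q n * (1 - q ^ (n - j) + q ^ (n - j) * (1 - q ^ Suc j))"
      unfolding IH IH' by (simp add: algebra_simps)
    also have "1 - q ^ (n - j) + q ^ (n - j) * (1 - q ^ Suc j) = 1 - q ^ (n - j + Suc j)"
      by (simp add: algebra_simps power_add)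
    also have "n - j + Suc j = Suc n" using jn by simp
    finally show ?thesis unfolding c Suc n_def[symmetric] qpoch_Suc[of q n] by simp
  qed
qed

section \<open>The quadratic recurrence\<close>

text \<open>Substitution of \<open>q\<close> times the variable, the operator of
  \<open>q\<close>-difference equations.\<close>

definition fps_scale :: "real \<Rightarrow> real fps \<Rightarrow> real fps" where
  "fps_scale q F = Abs_fps (\<lambda>n. q ^ n * fps_nth F n)"

lemma fps_scale_mult: "fps_scale q (F * G) = fps_scale q F * fps_scale q G"
proof (rule fps_ext)
  fix n
  have "q ^ n * (fps_nth F i * fps_nth G (n - i)) = q ^ i * fps_nth F i * (q ^ (n - i) * fps_nth G (n - i))" if "i \<in> {0..n}" for i
  proof -
    have "q ^ n = q ^ i * q ^ (n - i)" using that by (simp flip: power_add)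
    then show ?thesis by simp
  qed
  then have "(\<Sum>i\<in>{0..n}. q ^ n * (fps_nth F i * fps_nth G (n - i))) =
      (\<Sum>i\<in>{0..n}. q ^ i * fps_nth F i * (q ^ (n - i) * fps_nth G (n - i)))" by (rule sum.cong[OF refl])
  then show "fps_nth (fps_scale q (F * G)) n = fps_nth (fps_scale q F * fps_scale q G) n"
    by (simp add: fps_scale_def fps_mult_nth sum_distrib_left)
qed

lemma exc_maj_poly_0: "exc_maj_poly q t 0 = 1"
  by (simp add: exc_maj_poly_def sym_grp_def exc_def maj_def descent_set_def)

text \<open>Scaling the variable by \<open>q\<close> multiplies \<open>E\<close> and
  \<open>T\<close> only by linear factors. Comparing the functional equation with its scaled form
  therefore eliminates both and leaves \<open>F - F' = X (F + c F' (F - 1))\<close>, where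
  \<open>F'\<close> is the scaled \<open>F\<close>; the claim is its coefficient at
  \<open>Suc n\<close>.\<close>

lemma exc_maj_quadratic:
  fixes q t :: real
  assumes q: "0 < q" "q < 1" and t: "0 \<le> t" "t \<le> 1"
  defines "a \<equiv> \<lambda>n. exc_maj_poly q t n / qpoch q n"
  shows "(1 - q ^ Suc n) * a (Suc n) = a n + t * q * (\<Sum>k<n. q ^ k * a k * a (n - k))"
proof -
  define F where "F = Abs_fps a"
  define E where "E = Abs_fps (\<lambda>n. 1 / qpoch q n)"
  define T where "T = Abs_fps (\<lambda>n. (t * q) ^ n / qpoch q n)"
  define c where "c = fps_const (t * q)"
  define G where "G = T - c * E"
  have "t * q \<le> 1 * q" using t q by (intro mult_right_mono) auto
  then have tq: "t * q < 1" using q by linarith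
  have pos: "qpoch q n > 0" for n using qpoch_pos[OF q] .
  have pS: "1 / qpoch q k = (1 - q ^ Suc k) / qpoch q (Suc k)" for k
    using pos[of k] pos[of "Suc k"] by (auto simp: qpoch_Suc)
  have FG: "F * G = (1 - c) * E"
    using exc_maj_fps[OF q t] by (simp add: F_def G_def T_def E_def c_def a_def flip: fps_const_1_eq_1 fps_const_sub)
  have scale_E: "fps_scale q E = (1 - fps_X) * E"
  proof (rule fps_ext)
    fix n show "fps_nth (fps_scale q E) n = fps_nth ((1 - fps_X) * E) n"
    proof (cases n)
      case (Suc k)
      then show ?thesis using pS[of k]
        by (simp add: fps_scale_def E_def left_diff_distrib diff_divide_distrib)
    qed (simp add: fps_scale_def E_def left_diff_distrib)
  qed
  have scale_T: "fps_scale q T = (1 - c * fps_X) * T"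
  proof (rule fps_ext)
    fix n show "fps_nth (fps_scale q T) n = fps_nth ((1 - c * fps_X) * T) n"
    proof (cases n)
      case (Suc k)
      have "t * q * ((t * q) ^ k / qpoch q k) = (t * q) ^ Suc k * (1 / qpoch q k)" by simp
      also have "\<dots> = (t * q) ^ Suc k / qpoch q (Suc k) - q ^ Suc k * ((t * q) ^ Suc k / qpoch q (Suc k))"
        unfolding pS[of k] by (simp add: diff_divide_distrib right_diff_distrib)
      finally have "q ^ Suc k * ((t * q) ^ Suc k / qpoch q (Suc k)) =
        (t * q) ^ Suc k / qpoch q (Suc k) - t * q * ((t * q) ^ k / qpoch q k)" by simp
      moreover have "fps_nth ((1 - c * fps_X) * T) (Suc k) = fps_nth T (Suc k) - t * q * fps_nth T k"
        by (simp add: left_diff_distrib mult.assoc c_def)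
      ultimately show ?thesis by (simp only: Suc fps_scale_def T_def fps_nth_Abs_fps)
    qed (simp add: fps_scale_def T_def c_def left_diff_distrib mult.assoc)
  qed
  define F' where "F' = fps_scale q F"
  define G' where "G' = (1 - c * fps_X) * T - c * ((1 - fps_X) * E)"
  have sc: "fps_scale q (H - K) = fps_scale q H - fps_scale q K" for H K
    by (rule fps_ext) (simp add: fps_scale_def right_diff_distrib)
  have scc: "fps_scale q (fps_const d) = fps_const d" for d
    by (rule fps_ext) (simp add: fps_scale_def)
  have sc1: "fps_scale q 1 = 1" using scc[of 1] by simp
  have G'_eq: "fps_scale q G = G'"
    unfolding G_def G'_def sc fps_scale_mult scale_E scale_T by (simp add: c_def scc)
  have F'G': "F' * G' = (1 - c) * ((1 - fps_X) * E)"
    unfolding F'_def G'_eq[symmetric] fps_scale_mult[symmetric] FG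
    unfolding fps_scale_mult sc sc1 scale_E by (simp add: c_def scc)
  have "fps_nth G 0 \<noteq> 0" using tq by (simp add: G_def T_def E_def c_def qpoch_def)
  then have G0: "G \<noteq> 0" by auto
  have "fps_nth G' 0 \<noteq> 0" using tq by (simp add: G'_def T_def E_def c_def qpoch_def)
  then have G'0: "G' \<noteq> 0" by auto
  \<comment> \<open>After multiplication by \<open>G * G'\<close> the unknown series occur only in
    the known products \<open>F * G\<close> and \<open>F' * G'\<close>. The factor can be cancelled
    because \<open>G\<close> and \<open>G'\<close> have the constant term
    \<open>1 - t * q\<close>.\<close>
  have "(F - F' - fps_X * (F + c * F' * (F - 1))) * (G * G') =
     (F * G) * G' - (F' * G') * G - fps_X * ((F * G) * G' + c * (F' * G') * (F * G - G))"
    by (simp add: algebra_simps)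
  also have "\<dots> = 0"
    unfolding FG F'G' unfolding G_def G'_def by (simp add: algebra_simps)
  finally have "F - F' - fps_X * (F + c * F' * (F - 1)) = 0" using G0 G'0 by simp
  then have "fps_nth (F - F') (Suc n) = fps_nth (fps_X * (F + c * F' * (F - 1))) (Suc n)" by simp
  moreover have "fps_nth (F - F') (Suc n) = (1 - q ^ Suc n) * a (Suc n)"
    by (simp add: F_def F'_def fps_scale_def algebra_simps)
  moreover have "fps_nth (fps_X * (F + c * F' * (F - 1))) (Suc n) = a n + t * q * fps_nth (F' * (F - 1)) n"
    by (simp add: F_def c_def mult.assoc)
  moreover have "fps_nth (F' * (F - 1)) n = (\<Sum>k<n. q ^ k * a k * a (n - k))"
  proof -
    have a0: "a 0 = 1" by (simp add: a_def exc_maj_poly_0 qpoch_def)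
    have "fps_nth (F' * (F - 1)) n = (\<Sum>k\<in>{0..n}. q ^ k * a k * (a (n - k) - (if n - k = 0 then 1 else 0)))"
      by (simp add: fps_mult_nth F_def F'_def fps_scale_def)
    \<comment> \<open>The term \<open>k = n\<close> drops out since \<open>a 0 = 1\<close>.\<close>
    also have "\<dots> = (\<Sum>k<n. q ^ k * a k * (a (n - k) - (if n - k = 0 then 1 else 0)))"
      by (rule sum.mono_neutral_right) (auto simp: a0 not_less)
    also have "\<dots> = (\<Sum>k<n. q ^ k * a k * a (n - k))" by (intro sum.cong) auto
    finally show ?thesis .
  qed
  ultimately show ?thesis by simp
qed

lemma exc_maj_recurrence:
  fixes q t :: real
  assumes q: "0 < q" "q < 1" and t: "0 \<le> t" "t \<le> 1"
  defines "A \<equiv> exc_maj_poly q t"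
  shows "A (Suc 0) = 1"
    and "n \<ge> 1 \<Longrightarrow> A (Suc n) = (1 + t * q) * A n +
      t * q * (\<Sum>k\<in>{1..<n}. q ^ (n - k) * A k * A (n - k) * (qpoch q n / (qpoch q k * qpoch q (n - k))))"
proof -
  have pos: "qpoch q n > 0" for n using qpoch_pos[OF q] .
  have rec: "A (Suc n) = A n + t * q * (\<Sum>k<n. q ^ k * A k * A (n - k) * (qpoch q n / (qpoch q k * qpoch q (n - k))))" for n
  proof -
    have "1 - q ^ Suc n > 0" using power_Suc_less_one[OF q, of n] by simp
    then have "A (Suc n) = (1 - q ^ Suc n) * (A (Suc n) / qpoch q (Suc n)) * qpoch q n"
      using pos[of n] by (simp add: qpoch_Suc)
    also have "\<dots> = A n + t * q * ((\<Sum>k<n. q ^ k * (A k / qpoch q k) * (A (n - k) / qpoch q (n - k))) * qpoch q n)"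
      using exc_maj_quadratic[OF q t, of n] pos[of n] by (simp add: A_def distrib_right)
    also have "(\<Sum>k<n. q ^ k * (A k / qpoch q k) * (A (n - k) / qpoch q (n - k))) * qpoch q n =
      (\<Sum>k<n. q ^ k * A k * A (n - k) * (qpoch q n / (qpoch q k * qpoch q (n - k))))"
      unfolding sum_distrib_right by (intro sum.cong) auto
    finally show ?thesis .
  qed
  have A0: "A 0 = 1" by (simp add: A_def exc_maj_poly_0)
  show "A (Suc 0) = 1" using rec[of 0] A0 by simp
  assume n: "n \<ge> 1"
  let ?f = "\<lambda>k. q ^ k * A k * A (n - k) * (qpoch q n / (qpoch q k * qpoch q (n - k)))"
  \<comment> \<open>The term \<open>k = 0\<close> is another \<open>A n\<close> and produces the
    coefficient \<open>1 + t * q\<close>.\<close>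
  have "{..<n} = insert 0 {1..<n}" using n by auto
  then have "(\<Sum>k<n. ?f k) = ?f 0 + (\<Sum>k\<in>{1..<n}. ?f k)" by simp
  also have "?f 0 = A n"
  proof -
    have "qpoch q 0 = 1" by (simp add: qpoch_def)
    then show ?thesis using pos[of n] A0 by simp
  qed
  \<comment> \<open>Reflection turns \<open>q ^ k\<close> into \<open>q ^ (n - k)\<close>, the
    inversions that a largest entry forms with a right part of length \<open>n - k\<close>.\<close>
  also have "(\<Sum>k\<in>{1..<n}. ?f k) = (\<Sum>k\<in>{1..<n}. q ^ (n - k) * A k * A (n - k) * (qpoch q n / (qpoch q k * qpoch q (n - k))))"
    by (rule sum.reindex_bij_witness[where i = "\<lambda>k. n - k" and j = "\<lambda>k. n - k"]) (auto simp: mult_ac)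
  finally show "A (Suc n) = (1 + t * q) * A n +
      t * q * (\<Sum>k\<in>{1..<n}. q ^ (n - k) * A k * A (n - k) * (qpoch q n / (qpoch q k * qpoch q (n - k))))"
    using rec[of n] by (simp add: algebra_simps)
qed

lemma sum_dd_weight:
  fixes q t :: real
  assumes q: "0 < q" "q < 1" and t: "0 \<le> t" "t \<le> 1" and Y: "finite Y" "Y \<noteq> {}"
  shows "(\<Sum>xs\<in>permutations_of_set Y. dd_weight q (t * q) xs) = exc_maj_poly q t (card Y)"
  using Y
proof (induction "card Y" arbitrary: Y rule: less_induct)
  case less
  define A where "A = exc_maj_poly q t"
  define c where "c = t * q"
  let ?g = "\<lambda>Y. \<Sum>xs\<in>permutations_of_set Y. dd_weight q c xs"
  define M where "M = Max Y"
  define Z where "Z = Y - {M}"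
  have "M \<in> Y" unfolding M_def using less.prems by (intro Max_in)
  then have Y: "Y = insert M Z" by (auto simp: Z_def)
  have MZ: "M \<notin> Z" "finite Z" using less.prems by (auto simp: Z_def)
  have lt: "a < M" if "a \<in> Z" for a
  proof -
    have "a \<le> M" unfolding M_def using that less.prems by (intro Max_ge) (auto simp: Z_def)
    moreover have "a \<noteq> M" using that MZ by auto
    ultimately show ?thesis by simp
  qed
  define n where "n = card Z"
  have cY: "card Y = Suc n" using MZ by (simp add: Y n_def)
  have IH: "?g S = A (card S)" if "S \<subseteq> Z" "S \<noteq> {}" for S
  proof -
    have "finite S" "card S \<le> n" using that MZ by (auto simp: n_def intro: card_mono finite_subset)
    then show ?thesis using less.hyps[of S] that cY by (simp add: A_def c_def)
  qed
  show ?case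
  proof (cases "Z = {}")
    case True
    then have "?g Y = 1" by (simp add: Y dd_weight_def)
    moreover have "A 1 = 1" using exc_maj_recurrence(1)[OF q t] by (simp add: A_def)
    ultimately show ?thesis using cY True by (simp add: A_def c_def n_def)
  next
    case False
    then have n1: "n \<ge> 1" using MZ by (simp add: n_def Suc_le_eq card_gt_0_iff)
    define P where "P = {S. S \<subseteq> Z \<and> S \<noteq> {} \<and> S \<noteq> Z}"
    define h where "h S = (\<Sum>L\<in>permutations_of_set S. \<Sum>R\<in>permutations_of_set (Z - S). dd_weight q c (L @ M # R))" for S
    have ds: "dd_weight q c (L @ M # R) = (if R = [] then (if L = [] then 1 else (1 + c) * dd_weight q c L)
     else if L = [] then 0
     else c * q ^ (length R + cross_inv (set L) (set R)) * dd_weight q c L * dd_weight q c R)"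
      if "L \<in> permutations_of_set S" "R \<in> permutations_of_set (Z - S)" "S \<subseteq> Z" for L R S
      by (rule dd_weight_split) (use that lt in \<open>auto simp: permutations_of_set_def\<close>)
    have hZ: "h Z = (1 + c) * A n"
    proof -
      have "h Z = (\<Sum>L\<in>permutations_of_set Z. (1 + c) * dd_weight q c L)"
        unfolding h_def
      proof (rule sum.cong[OF refl])
        fix L assume L: "L \<in> permutations_of_set Z"
        then have "L \<noteq> []" using False by (auto simp: permutations_of_set_def)
        then show "(\<Sum>R\<in>permutations_of_set (Z - Z). dd_weight q c (L @ M # R)) = (1 + c) * dd_weight q c L"
          using ds[OF L, of "[]"] by simp
      qed
      also have "\<dots> = (1 + c) * ?g Z" by (simp add: sum_distrib_left)
      finally show ?thesis using IH[of Z] False by (simp add: n_def)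
    qed
    have h0: "h {} = 0"
      unfolding h_def
    proof (intro sum.neutral ballI)
      fix L R :: "nat list" assume L: "L \<in> permutations_of_set {}" and R: "R \<in> permutations_of_set (Z - {})"
      then have "L = []" "R \<noteq> []" using False by (auto simp: permutations_of_set_def)
      then show "dd_weight q c (L @ M # R) = 0" using ds[OF L R] by simp
    qed
    have hP: "h S = c * q ^ (n - card S) * A (card S) * A (n - card S) * q ^ cross_inv S (Z - S)" if "S \<in> P" for S
    proof -
      have S: "S \<subseteq> Z" "S \<noteq> {}" "Z - S \<noteq> {}" "finite S" using that MZ finite_subset by (auto simp: P_def)
      have cd: "card (Z - S) = n - card S" using S by (simp add: n_def card_Diff_subset)
      have "h S = (\<Sum>L\<in>permutations_of_set S. \<Sum>R\<in>permutations_of_set (Z - S).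
          c * q ^ (n - card S + cross_inv S (Z - S)) * (dd_weight q c L * dd_weight q c R))"
        unfolding h_def
      proof (intro sum.cong refl)
        fix L R assume LR: "L \<in> permutations_of_set S" "R \<in> permutations_of_set (Z - S)"
        then have "length R = n - card S" using cd distinct_card[of R] by (simp add: permutations_of_set_def)
        moreover have "set L = S" "set R = Z - S" using LR by (auto simp: permutations_of_set_def)
        moreover from this have "L \<noteq> []" "R \<noteq> []" using S by auto
        ultimately show "dd_weight q c (L @ M # R) = c * q ^ (n - card S + cross_inv S (Z - S)) * (dd_weight q c L * dd_weight q c R)"
          using ds[OF LR S(1)] by simp
      qed
      also have "\<dots> = c * q ^ (n - card S + cross_inv S (Z - S)) * (?g S * ?g (Z - S))"
        unfolding sum_product by (simp only: sum_distrib_left)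
      also have "\<dots> = c * q ^ (n - card S + cross_inv S (Z - S)) * (A (card S) * A (n - card S))"
        using IH[of S] IH[of "Z - S"] S cd by simp
      finally show ?thesis by (simp add: power_add)
    qed
    have "?g Y = sum h (Pow Z)"
      unfolding Y h_def by (rule sum_permutations_split[OF MZ(2,1)])
    \<comment> \<open>The subset holds the entries left of \<open>M\<close>: \<open>Z\<close> means
      that \<open>M\<close> comes last, \<open>{}\<close> is the vanishing case, and
      \<open>P\<close> collects the splits with two nonempty parts.\<close>
    also have "Pow Z = insert Z (insert {} P)" by (auto simp: P_def)
    also have "sum h \<dots> = h Z + (h {} + sum h P)"
      using False MZ by (simp add: P_def)
    also have "sum h P = (\<Sum>k\<in>{1..<n}. \<Sum>S | S \<in> P \<and> card S = k. h S)"
    proof (rule sum.group[symmetric])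
      show "finite P" using MZ by (simp add: P_def)
      show "card ` P \<subseteq> {1..<n}"
      proof
        fix k assume "k \<in> card ` P"
        then obtain S where S: "k = card S" "S \<subset> Z" "S \<noteq> {}" by (auto simp: P_def)
        then have "finite S" using MZ finite_subset by blast
        then show "k \<in> {1..<n}" using S psubset_card_mono[of Z S] MZ by (auto simp: n_def Suc_le_eq card_gt_0_iff)
      qed
    qed simp
    also have "\<dots> = (\<Sum>k\<in>{1..<n}. c * (q ^ (n - k) * A k * A (n - k) * gauss_sum q Z k))"
    proof (rule sum.cong)
      fix k assume k: "k \<in> {1..<n}"
      then have eq: "{S. S \<in> P \<and> card S = k} = {S. S \<subseteq> Z \<and> card S = k}" by (auto simp: P_def n_def)
      have "(\<Sum>S | S \<in> P \<and> card S = k. h S) = (\<Sum>S | S \<subseteq> Z \<and> card S = k. c * (q ^ (n - k) * A k * A (n - k) * q ^ cross_inv S (Z - S)))"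
      proof (rule sum.cong[OF eq])
        fix S assume "S \<in> {S. S \<subseteq> Z \<and> card S = k}"
        then have "S \<in> P" "card S = k" unfolding eq[symmetric] by auto
        then show "h S = c * (q ^ (n - k) * A k * A (n - k) * q ^ cross_inv S (Z - S))" using hP[of S] by (simp add: mult_ac)
      qed
      then show "(\<Sum>S | S \<in> P \<and> card S = k. h S) = c * (q ^ (n - k) * A k * A (n - k) * gauss_sum q Z k)"
        by (simp add: gauss_sum_def sum_distrib_left)
    qed simp
    also have "\<dots> = c * (\<Sum>k\<in>{1..<n}. q ^ (n - k) * A k * A (n - k) * (qpoch q n / (qpoch q k * qpoch q (n - k))))"
      unfolding sum_distrib_left
    proof (rule sum.cong)
      fix k assume k: "k \<in> {1..<n}"
      then have "gauss_sum q Z k * (qpoch q k * qpoch q (n - k)) = qpoch q n"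
        using gauss_sum_qpoch[OF MZ(2), of k q] by (simp add: n_def)
      then have "gauss_sum q Z k = qpoch q n / (qpoch q k * qpoch q (n - k))"
        using qpoch_pos[OF q] by (metis less_irrefl mult_eq_0_iff nonzero_eq_divide_eq)
      then show "c * (q ^ (n - k) * A k * A (n - k) * gauss_sum q Z k) =
         c * (q ^ (n - k) * A k * A (n - k) * (qpoch q n / (qpoch q k * qpoch q (n - k))))" by simp
    qed simp
    finally show ?thesis
      using exc_maj_recurrence(2)[OF q t n1] hZ h0 by (simp add: cY A_def c_def)
  qed
qed

section \<open>From lists to permutations and from real numbers to rings\<close>

lemma list_des_eq_card: "list_des xs = card {i. Suc i < length xs \<and> xs ! i > xs ! Suc i}"
proof (induction xs rule: list_des.induct)
  case (1 x y zs)
  let ?xs = "x # y # zs"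
  let ?A = "{i. Suc i < length (y # zs) \<and> (y # zs) ! i > (y # zs) ! Suc i}"
  have fin: "finite ?A" by (rule finite_subset[of _ "{..<length (y # zs)}"]) auto
  have "{i. Suc i < length ?xs \<and> ?xs ! i > ?xs ! Suc i} = (if y < x then {0} else {}) \<union> Suc ` ?A"
  proof (rule set_eqI)
    fix i show "i \<in> {i. Suc i < length ?xs \<and> ?xs ! i > ?xs ! Suc i} \<longleftrightarrow> i \<in> (if y < x then {0} else {}) \<union> Suc ` ?A"
      by (cases i) auto
  qed
  also have "card \<dots> = (if y < x then 1 else 0) + card ?A"
    using fin by (subst card_Un_disjoint) (auto simp: card_image)
  finally show ?case using 1 by simp
qed auto

lemma list_inv_eq_card: "list_inv xs = card {(i, j). i < j \<and> j < length xs \<and> xs ! i > xs ! j}"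
proof (induction xs)
  case (Cons x xs)
  let ?A = "{(i, j). i < j \<and> j < length xs \<and> xs ! i > xs ! j}"
  let ?B = "{j. j < length xs \<and> xs ! j < x}"
  have fin: "finite ?A" by (rule finite_subset[of _ "{..<length xs} \<times> {..<length xs}"]) auto
  have split: "{(i, j). i < j \<and> j < length (x # xs) \<and> (x # xs) ! i > (x # xs) ! j} =
     (\<lambda>j. (0, Suc j)) ` ?B \<union> map_prod Suc Suc ` ?A" (is "?L = ?R")
  proof (intro equalityI subsetI)
    fix p assume "p \<in> ?L"
    then obtain i j where p: "p = (i, j)" and ij: "i < j" "j < length (x # xs)" "(x # xs) ! i > (x # xs) ! j" by auto
    obtain j' where j': "j = Suc j'" using ij(1) by (cases j) auto
    show "p \<in> ?R"
    proof (cases i)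
      case 0
      then have "j' \<in> ?B" using ij j' by simp
      then show ?thesis unfolding p 0 j' by blast
    next
      case (Suc i')
      then have "(i', j') \<in> ?A" using ij j' by simp
      from imageI[OF this, of "map_prod Suc Suc"] show ?thesis unfolding p Suc j' by simp
    qed
  next
    fix p assume "p \<in> ?R"
    then show "p \<in> ?L" by auto
  qed
  have un: "card ((\<lambda>j. (0, Suc j)) ` ?B \<union> map_prod Suc Suc ` ?A) = card ((\<lambda>j. (0::nat, Suc j)) ` ?B) + card (map_prod Suc Suc ` ?A)"
  proof (rule card_Un_disjoint)
    show "finite ((\<lambda>j. (0::nat, Suc j)) ` ?B)" by simp
    show "finite (map_prod Suc Suc ` ?A)" using fin by (rule finite_imageI)
    show "(\<lambda>j. (0::nat, Suc j)) ` ?B \<inter> map_prod Suc Suc ` ?A = {}" by auto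
  qed
  have B: "card ((\<lambda>j. (0::nat, Suc j)) ` ?B) = length (filter (\<lambda>y. y < x) xs)"
  proof -
    have "inj_on (\<lambda>j. (0::nat, Suc j)) ?B" by (rule inj_onI) simp
    then show ?thesis by (simp only: card_image length_filter_conv_card)
  qed
  have A: "card (map_prod Suc Suc ` ?A) = card ?A"
    by (intro card_image inj_on_subset[OF prod.inj_map[OF inj_Suc inj_Suc] subset_UNIV])
  show ?case unfolding split un A B list_inv.simps Cons.IH ..
qed simp

lemma no_dd_iff_nth: "no_dd p xs \<longleftrightarrow>
   \<not> (p \<and> 1 < length xs \<and> xs ! 0 > xs ! 1) \<and>
   (\<forall>i. Suc (Suc i) < length xs \<longrightarrow> \<not> (xs ! i > xs ! Suc i \<and> xs ! Suc i > xs ! Suc (Suc i)))"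
proof (induction p xs rule: no_dd.induct)
  case (1 p x y zs)
  have "(\<forall>i. Suc (Suc i) < length (x # y # zs) \<longrightarrow> \<not> ((x # y # zs) ! i > (x # y # zs) ! Suc i \<and> (x # y # zs) ! Suc i > (x # y # zs) ! Suc (Suc i)))
    \<longleftrightarrow> \<not> (y < x \<and> 1 < length (y # zs) \<and> (y # zs) ! 0 > (y # zs) ! 1) \<and>
     (\<forall>i. Suc (Suc i) < length (y # zs) \<longrightarrow> \<not> ((y # zs) ! i > (y # zs) ! Suc i \<and> (y # zs) ! Suc i > (y # zs) ! Suc (Suc i)))"
    (is "(\<forall>i. ?P i) \<longleftrightarrow> _")
  proof -
    have "(\<forall>i. P i) \<longleftrightarrow> P 0 \<and> (\<forall>i. P (Suc i))" for P :: "nat \<Rightarrow> bool" by (metis not0_implies_Suc)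
    from this[of ?P] show ?thesis by auto
  qed
  then show ?case using 1 by auto
qed auto

abbreviation perm_list :: "nat \<Rightarrow> (nat \<Rightarrow> nat) \<Rightarrow> nat list" where
  "perm_list n s \<equiv> map s [1..<Suc n]"

lemma nth_perm_list: "i < n \<Longrightarrow> perm_list n s ! i = s (Suc i)"
  by (simp del: upt_Suc)

lemma length_perm_list: "length (perm_list n s) = n"
  by (simp del: upt_Suc)

lemma list_des_perm_list: "list_des (perm_list n s) = des n s"
proof -
  have "descent_set n s = Suc ` {i. Suc i < n \<and> s (Suc i) > s (Suc (Suc i))}"
  proof (rule set_eqI)
    fix i show "i \<in> descent_set n s \<longleftrightarrow> i \<in> Suc ` {i. Suc i < n \<and> s (Suc i) > s (Suc (Suc i))}"
      by (cases i) (auto simp: descent_set_def)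
  qed
  then have "des n s = card {i. Suc i < n \<and> s (Suc i) > s (Suc (Suc i))}" by (simp add: des_def card_image)
  also have "{i. Suc i < n \<and> s (Suc i) > s (Suc (Suc i))} = {i. Suc i < length (perm_list n s) \<and> perm_list n s ! i > perm_list n s ! Suc i}"
    unfolding length_perm_list by (auto simp: nth_perm_list simp del: upt_Suc)
  finally show ?thesis unfolding list_des_eq_card by simp
qed

lemma list_inv_perm_list: "list_inv (perm_list n s) = invs n s"
proof -
  have "{(i, j). 1 \<le> i \<and> i < j \<and> j \<le> n \<and> s i > s j} = map_prod Suc Suc ` {(i, j). i < j \<and> j < n \<and> s (Suc i) > s (Suc j)}"
    (is "?L = _ ` ?A")
  proof (intro equalityI subsetI)
    fix p assume "p \<in> ?L"
    then obtain i j where p: "p = (i, j)" and ij: "1 \<le> i" "i < j" "j \<le> n" "s i > s j" by auto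
    obtain i' j' where ij': "i = Suc i'" "j = Suc j'" using ij by (cases i; cases j) auto
    then have "(i', j') \<in> ?A" using ij by simp
    from imageI[OF this, of "map_prod Suc Suc"] show "p \<in> map_prod Suc Suc ` ?A" unfolding p ij' by simp
  next
    fix p assume "p \<in> map_prod Suc Suc ` ?A"
    then show "p \<in> ?L" by auto
  qed
  then have "invs n s = card (map_prod Suc Suc ` {(i, j). i < j \<and> j < n \<and> s (Suc i) > s (Suc j)})" by (simp add: invs_def)
  also have "\<dots> = card {(i, j). i < j \<and> j < n \<and> s (Suc i) > s (Suc j)}"
    by (intro card_image inj_on_subset[OF prod.inj_map[OF inj_Suc inj_Suc] subset_UNIV])
  also have "{(i, j). i < j \<and> j < n \<and> s (Suc i) > s (Suc j)} =
     {(i, j). i < j \<and> j < length (perm_list n s) \<and> perm_list n s ! i > perm_list n s ! j}"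
    unfolding length_perm_list by (auto simp: nth_perm_list simp del: upt_Suc)
  finally show ?thesis unfolding list_inv_eq_card by simp
qed

text \<open>Position 1 has the infinite entry on its left, so only its right neighbour matters,
  which is the flag clause of \<open>no_dd_iff_nth\<close>. Position \<open>n\<close> is followed by
  the infinite entry and never qualifies.\<close>

lemma no_dd_perm_list: "no_dd True (perm_list n s) \<longleftrightarrow> dd n s = 0"
proof -
  define D where "D = {i \<in> {1..n}. ext_word n s (i - 1) > ext_word n s i \<and> ext_word n s i > ext_word n s (i + 1)}"
  have "finite D" "0 \<notin> D" by (auto simp: D_def)
  then have "dd n s = 0 \<longleftrightarrow> (\<forall>i. i \<notin> D)" unfolding dd_def D_def[symmetric] by auto
  also have "\<dots> \<longleftrightarrow> 1 \<notin> D \<and> (\<forall>i. Suc (Suc i) \<notin> D)"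
    using \<open>0 \<notin> D\<close> by (metis One_nat_def not0_implies_Suc)
  finally have dd: "dd n s = 0 \<longleftrightarrow> 1 \<notin> D \<and> (\<forall>i. Suc (Suc i) \<notin> D)" .
  have D1: "1 \<in> D \<longleftrightarrow> 1 < n \<and> perm_list n s ! 0 > perm_list n s ! 1"
  proof (cases "1 < n")
    case True
    then show ?thesis by (simp add: D_def ext_word_def nth_perm_list del: upt_Suc)
  next
    case False
    then show ?thesis by (simp add: D_def ext_word_def del: upt_Suc)
  qed
  have D2: "Suc (Suc i) \<in> D \<longleftrightarrow> Suc (Suc i) < n \<and> perm_list n s ! i > perm_list n s ! Suc i
      \<and> perm_list n s ! Suc i > perm_list n s ! Suc (Suc i)" for i
  proof (cases "Suc (Suc i) < n")
    case True
    then show ?thesis by (simp add: D_def ext_word_def nth_perm_list del: upt_Suc)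
  next
    case False
    then show ?thesis by (simp add: D_def ext_word_def del: upt_Suc)
  qed
  show ?thesis unfolding dd D1 D2 no_dd_iff_nth length_perm_list by blast
qed

lemma bij_betw_perm_list: "bij_betw (perm_list n) (sym_grp n) (permutations_of_set {1..n})"
proof -
  have inj: "inj_on (perm_list n) (sym_grp n)"
  proof (rule inj_onI)
    fix s s' assume s: "s \<in> sym_grp n" "s' \<in> sym_grp n" and eq: "perm_list n s = perm_list n s'"
    have "s i = s' i" if "i \<in> {1..n}" for i
      using eq that by (simp add: map_eq_conv del: upt_Suc)
    moreover have "s i = s' i" if "i \<notin> {1..n}" for i
      using s permutes_not_in[of s "{1..n}" i] permutes_not_in[of s' "{1..n}" i] that by (simp add: sym_grp_def)
    ultimately show "s = s'" by blast
  qed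
  have sub: "perm_list n ` sym_grp n \<subseteq> permutations_of_set {1..n}"
  proof
    fix xs assume "xs \<in> perm_list n ` sym_grp n"
    then obtain s where s: "xs = perm_list n s" "s permutes {1..n}" by (auto simp: sym_grp_def)
    have st: "set [1..<Suc n] = {1..n}" by auto
    have "set xs = {1..n}" unfolding s(1) set_map st using permutes_image[OF s(2)] .
    moreover have "distinct xs" unfolding s(1) distinct_map st using permutes_inj_on[OF s(2)] by simp
    ultimately show "xs \<in> permutations_of_set {1..n}" by (simp add: permutations_of_set_def)
  qed
  \<comment> \<open>Surjectivity follows by counting: both sides have \<open>fact n\<close>
    elements.\<close>
  have "card (perm_list n ` sym_grp n) = fact n"
    using card_image[OF inj] card_permutations[of "{1..n}" n] by (simp add: sym_grp_def)
  then have "perm_list n ` sym_grp n = permutations_of_set {1..n}"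
    using sub by (intro card_subset_eq) auto
  with inj show ?thesis by (simp add: bij_betw_def)
qed

lemma gamma_sum_eq_sum_dd_weight:
  fixes q t :: real
  assumes "n \<ge> 1"
  shows "(\<Sum>k = 0..(n - 1) div 2. (\<Sum>s\<in>no_dd_perms n k. q ^ invs n s) * t ^ k * (1 + t) ^ (n - 1 - 2 * k)) =
    (\<Sum>xs\<in>permutations_of_set {1..n}. dd_weight q t xs)"
proof -
  let ?D = "{s \<in> sym_grp n. dd n s = 0}"
  let ?h = "\<lambda>s. q ^ invs n s * t ^ des n s * (1 + t) ^ (n - 1 - 2 * des n s)"
  have "(\<Sum>xs\<in>permutations_of_set {1..n}. dd_weight q t xs) = (\<Sum>s\<in>sym_grp n. dd_weight q t (perm_list n s))"
    by (rule sum.reindex_bij_betw[OF bij_betw_perm_list, symmetric])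
  also have "\<dots> = (\<Sum>s\<in>sym_grp n. if dd n s = 0 then ?h s else 0)"
    by (intro sum.cong refl) (simp only: dd_weight_def no_dd_perm_list list_inv_perm_list list_des_perm_list length_perm_list)
  also have "\<dots> = (\<Sum>s\<in>?D. ?h s)" by (rule sum.inter_filter[symmetric]) simp
  also have "\<dots> = (\<Sum>k = 0..(n - 1) div 2. \<Sum>s | s \<in> ?D \<and> des n s = k. ?h s)"
  proof (rule sum.group[symmetric])
    \<comment> \<open>The bound on descents makes all groups beyond the given range of
      \<open>k\<close> empty.\<close>
    show "des n ` ?D \<subseteq> {0..(n - 1) div 2}"
    proof
      fix k assume "k \<in> des n ` ?D"
      then obtain s where s: "k = des n s" "dd n s = 0" by auto
      have "perm_list n s \<noteq> []" using length_perm_list[of s n] assms by (metis list.size(3) not_one_le_zero)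
      from list_des_bound[of True, OF _ this] s have "2 * k + 1 \<le> n"
        by (simp only: no_dd_perm_list list_des_perm_list length_perm_list if_True)
      then show "k \<in> {0..(n - 1) div 2}" by auto
    qed
  qed auto
  also have "\<dots> = (\<Sum>k = 0..(n - 1) div 2. (\<Sum>s\<in>no_dd_perms n k. q ^ invs n s) * t ^ k * (1 + t) ^ (n - 1 - 2 * k))"
    unfolding sum_distrib_right by (intro sum.cong) (auto simp: no_dd_perms_def)
  finally show ?thesis by simp
qed

section \<open>Transfer from an open set of real parameters to commutative rings\<close>

text \<open>For fixed \<open>q\<close> the polynomial in \<open>t\<close> has all of the interval
  below \<open>q\<close> as roots, so its coefficients vanish; these are polynomials in
  \<open>q\<close> with all of the unit interval as roots.\<close>

lemma bivariate_coeffs_zero: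
  fixes C :: "nat \<Rightarrow> nat \<Rightarrow> int"
  assumes "\<And>q t :: real. 0 < q \<Longrightarrow> q < 1 \<Longrightarrow> 0 < t \<Longrightarrow> t < q \<Longrightarrow> (\<Sum>u\<le>N. (\<Sum>v\<le>N. of_int (C u v) * q ^ v) * t ^ u) = 0"
    and uv: "u \<le> N" "v \<le> N"
  shows "C u v = 0"
proof -
  have "(\<Sum>v\<le>N. of_int (C u v) * q ^ v) = 0" if q: "0 < q" "q < 1" for q :: real
  proof -
    have "{0<..<q} \<subseteq> {t. (\<Sum>u\<le>N. (\<Sum>v\<le>N. of_int (C u v) * q ^ v) * t ^ u) = 0}" using assms(1)[OF q] by auto
    moreover have "infinite {0<..<q}" using q by simp
    ultimately have "infinite {t. (\<Sum>u\<le>N. (\<Sum>v\<le>N. of_int (C u v) * q ^ v) * t ^ u) = 0}" using finite_subset by blast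
    then show ?thesis using uv(1) unfolding polyfun_finite_roots by blast
  qed
  then have "{0<..<1} \<subseteq> {q::real. (\<Sum>v\<le>N. of_int (C u v) * q ^ v) = 0}" by auto
  moreover have "infinite {0<..<1::real}" by simp
  ultimately have "infinite {q::real. (\<Sum>v\<le>N. of_int (C u v) * q ^ v) = 0}" using finite_subset by blast
  then have "(of_int (C u v) :: real) = 0" using uv(2) unfolding polyfun_finite_roots by blast
  then show ?thesis by simp
qed

text \<open>Everything depends on the collected integer coefficients \<open>C u v\<close>, which the
  real case forces to be zero. The collection identity \<open>eq\<close> is proved at a fresh type
  so that it serves the reals and the target ring.\<close>

lemma monomial_sum_zero_transfer:
  fixes c :: "'i \<Rightarrow> int" and t q :: "'a::comm_ring_1"
  assumes fin: "finite I"
    and real: "\<And>q t :: real. 0 < q \<Longrightarrow> q < 1 \<Longrightarrow> 0 < t \<Longrightarrow> t < q \<Longrightarrow> (\<Sum>i\<in>I. of_int (c i) * t ^ a i * q ^ b i) = 0"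
  shows "(\<Sum>i\<in>I. of_int (c i) * t ^ a i * q ^ b i) = 0"
proof -
  define N where "N = (\<Sum>i\<in>I. a i + b i)"
  define C where "C u v = (\<Sum>i | i \<in> I \<and> (a i, b i) = (u, v). c i)" for u v
  have N: "a i \<le> N \<and> b i \<le> N" if "i \<in> I" for i
    using member_le_sum[OF that, of "\<lambda>i. a i + b i"] fin by (simp add: N_def)
  have eq: "(\<Sum>i\<in>I. of_int (c i) * t ^ a i * q ^ b i) = (\<Sum>u\<le>N. (\<Sum>v\<le>N. of_int (C u v) * q ^ v) * t ^ u)"
    for t q :: "'b::comm_ring_1"
  proof -
    have "(\<Sum>i\<in>I. of_int (c i) * t ^ a i * q ^ b i) =
       (\<Sum>p\<in>{..N} \<times> {..N}. \<Sum>i | i \<in> I \<and> (a i, b i) = p. of_int (c i) * t ^ a i * q ^ b i)"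
      using fin N by (intro sum.group[symmetric]) auto
    also have "\<dots> = (\<Sum>p\<in>{..N} \<times> {..N}. of_int (C (fst p) (snd p)) * q ^ snd p * t ^ fst p)"
    proof (rule sum.cong)
      fix p assume "p \<in> {..N} \<times> {..N}"
      show "(\<Sum>i | i \<in> I \<and> (a i, b i) = p. of_int (c i) * t ^ a i * q ^ b i) = of_int (C (fst p) (snd p)) * q ^ snd p * t ^ fst p"
        unfolding C_def of_int_sum sum_distrib_right by (intro sum.cong) auto
    qed simp
    also have "\<dots> = (\<Sum>u\<le>N. (\<Sum>v\<le>N. of_int (C u v) * q ^ v) * t ^ u)"
      by (simp add: sum_distrib_right sum.cartesian_product split_def)
    finally show ?thesis .
  qed
  have "C u v = 0" if "u \<le> N" "v \<le> N" for u v
  proof (rule bivariate_coeffs_zero[OF _ that])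
    fix q t :: real assume "0 < q" "q < 1" "0 < t" "t < q"
    then show "(\<Sum>u\<le>N. (\<Sum>v\<le>N. of_int (C u v) * q ^ v) * t ^ u) = 0" using real eq[of t q] by simp
  qed
  then show ?thesis unfolding eq by simp
qed

lemma monomial_sum_transfer:
  fixes c :: "'i \<Rightarrow> nat" and c' :: "'j \<Rightarrow> nat" and t q :: "'a::comm_ring_1"
  assumes fin: "finite I" "finite J"
    and real: "\<And>q t :: real. 0 < q \<Longrightarrow> q < 1 \<Longrightarrow> 0 < t \<Longrightarrow> t < q \<Longrightarrow>
      (\<Sum>i\<in>I. of_nat (c i) * t ^ a i * q ^ b i) = (\<Sum>j\<in>J. of_nat (c' j) * t ^ a' j * q ^ b' j)"
  shows "(\<Sum>i\<in>I. of_nat (c i) * t ^ a i * q ^ b i) = (\<Sum>j\<in>J. of_nat (c' j) * t ^ a' j * q ^ b' j)"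
proof -
  define C where "C = case_sum (\<lambda>i. int (c i)) (\<lambda>j. - int (c' j))"
  define A where "A = case_sum a a'"
  define B where "B = case_sum b b'"
  have eq: "(\<Sum>k\<in>I <+> J. of_int (C k) * t ^ A k * q ^ B k) =
      (\<Sum>i\<in>I. of_nat (c i) * t ^ a i * q ^ b i) - (\<Sum>j\<in>J. of_nat (c' j) * t ^ a' j * q ^ b' j)"
    for t q :: "'b::comm_ring_1"
    using fin by (simp add: sum.Plus A_def B_def C_def sum_negf o_def)
  have "(\<Sum>k\<in>I <+> J. of_int (C k) * t ^ A k * q ^ B k) = 0"
  proof (rule monomial_sum_zero_transfer)
    fix q t :: real assume "0 < q" "q < 1" "0 < t" "t < q"
    then show "(\<Sum>k\<in>I <+> J. of_int (C k) * t ^ A k * q ^ B k) = 0" unfolding eq using real by simp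
  qed (use fin in simp)
  then show ?thesis unfolding eq by simp
qed

text \<open>As \<open>exc n s \<le> maj n s\<close>, the factor \<open>q ^ exc n s\<close> contained
  in \<open>(t * q) ^ exc n s\<close> restores the full \<open>q ^ maj n s\<close>.\<close>

lemma basic_eulerian_eq_exc_maj_poly:
  fixes q t :: "'a::comm_ring_1"
  shows "basic_eulerian n (t * q) 1 q = exc_maj_poly q t n"
  unfolding basic_eulerian_def exc_maj_poly_def
proof (rule sum.cong)
  fix s assume "s \<in> sym_grp n"
  then have "q ^ maj n s = q ^ exc n s * q ^ (maj n s - exc n s)" by (simp add: exc_le_maj flip: power_add)
  then show "(t * q) ^ exc n s * 1 ^ fixpts n s * q ^ (maj n s - exc n s) = t ^ exc n s * q ^ maj n s"
    by (simp add: power_mult_distrib)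
qed simp

text \<open>The form that \<open>monomial_sum_transfer\<close> asks for: natural coefficients, and
  an index set that is the same for all rings.\<close>

lemma gamma_sum_expand:
  fixes t q :: "'a::comm_ring_1"
  shows "(\<Sum>k = 0..(n - 1) div 2. (\<Sum>s\<in>no_dd_perms n k. q ^ invs n s) * t ^ k * (1 + t) ^ (n - 1 - 2 * k)) =
    (\<Sum>(k, s, j)\<in>Sigma {0..(n - 1) div 2} (\<lambda>k. no_dd_perms n k \<times> {..n - 1 - 2 * k}).
       of_nat ((n - 1 - 2 * k) choose j) * t ^ (k + j) * q ^ invs n s)"
proof -
  have fin: "finite (no_dd_perms n k)" for k by (simp add: no_dd_perms_def)
  have "(\<Sum>s\<in>no_dd_perms n k. q ^ invs n s) * t ^ k * (1 + t) ^ N =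
      (\<Sum>(s, j)\<in>no_dd_perms n k \<times> {..N}. of_nat (N choose j) * t ^ (k + j) * q ^ invs n s)" for k N
  proof -
    have "(1 + t) ^ N = (\<Sum>j\<le>N. of_nat (N choose j) * t ^ j)"
      using binomial_ring[of t 1 N] by (simp add: add.commute)
    then have "(\<Sum>s\<in>no_dd_perms n k. q ^ invs n s) * t ^ k * (1 + t) ^ N =
       (\<Sum>s\<in>no_dd_perms n k. \<Sum>j\<le>N. q ^ invs n s * t ^ k * (of_nat (N choose j) * t ^ j))"
      by (simp only: sum_distrib_right[where r = "t ^ k"] sum_product)
    also have "\<dots> = (\<Sum>s\<in>no_dd_perms n k. \<Sum>j\<le>N. of_nat (N choose j) * t ^ (k + j) * q ^ invs n s)"
      by (intro sum.cong) (simp_all add: power_add mult_ac)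
    finally show ?thesis by (simp add: sum.cartesian_product)
  qed
  then show ?thesis using fin by (simp add: sum.Sigma split_def)
qed

theorem theorem1p4:
  fixes n :: nat and t q :: "'a::comm_ring_1"
  assumes "n \<ge> 1"
  shows "basic_eulerian n t 1 q =
    (\<Sum>k = 0..(n - 1) div 2.
       (\<Sum>s\<in>no_dd_perms n k. q ^ invs n s) * t ^ k * (1 + t) ^ (n - 1 - 2 * k))"
proof -
  let ?J = "Sigma {0..(n - 1) div 2} (\<lambda>k. no_dd_perms n k \<times> {..n - 1 - 2 * k})"
  have L: "basic_eulerian n t 1 q = (\<Sum>s\<in>sym_grp n. of_nat 1 * t ^ exc n s * q ^ (maj n s - exc n s))"
    for t q :: "'b::comm_ring_1"
    by (simp add: basic_eulerian_def)
  have R: "(\<Sum>k = 0..(n - 1) div 2. (\<Sum>s\<in>no_dd_perms n k. q ^ invs n s) * t ^ k * (1 + t) ^ (n - 1 - 2 * k)) =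
    (\<Sum>p\<in>?J. of_nat ((n - 1 - 2 * fst p) choose snd (snd p)) * t ^ (fst p + snd (snd p)) * q ^ invs n (fst (snd p)))"
    for t q :: "'b::comm_ring_1"
    unfolding gamma_sum_expand by (simp add: split_def)
  show ?thesis
    unfolding L R
  proof (rule monomial_sum_transfer)
    show "finite (sym_grp n)" by simp
    show "finite ?J" by (simp add: no_dd_perms_def)
    fix q t :: real assume q: "0 < q" "q < 1" and t: "0 < t" "t < q"
    \<comment> \<open>The excedance variable of \<open>exc_maj_poly\<close> is \<open>t\<close>
      divided by \<open>q\<close>, since that polynomial carries \<open>q ^ maj\<close>;
      \<open>t < q\<close> gives \<open>r \<le> 1\<close>.\<close>
    define r where "r = t / q"
    have r: "0 \<le> r" "r \<le> 1" "r * q = t" using q t by (auto simp: r_def)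
    have "basic_eulerian n t 1 q = exc_maj_poly q r n"
      using basic_eulerian_eq_exc_maj_poly[of n r q] r by simp
    also have "\<dots> = (\<Sum>xs\<in>permutations_of_set {1..n}. dd_weight q t xs)"
      using sum_dd_weight[OF q r(1,2), of "{1..n}"] assms r by simp
    also have "\<dots> = (\<Sum>k = 0..(n - 1) div 2. (\<Sum>s\<in>no_dd_perms n k. q ^ invs n s) * t ^ k * (1 + t) ^ (n - 1 - 2 * k))"
      by (rule gamma_sum_eq_sum_dd_weight[OF assms, symmetric])
    finally show "(\<Sum>s\<in>sym_grp n. of_nat 1 * t ^ exc n s * q ^ (maj n s - exc n s)) =
      (\<Sum>p\<in>?J. of_nat ((n - 1 - 2 * fst p) choose snd (snd p)) * t ^ (fst p + snd (snd p)) * q ^ invs n (fst (snd p)))"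
      unfolding L R .
  qed
qed

end
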